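(* Let $\epsilon\in\{-1,1\}$. Any (connected) surface $f:M^2\to\mathbb{Q}_\epsilon^n\times\mathbb{R}$ in class $\mathcal{A}$ with parallel mean curvature vector is a rotational surface in a totally geodesic submanifold $\mathbb{Q}_\epsilon^m\times\mathbb{R}$, $m\le4$, over a curve in a totally geodesic submanifold $\mathbb{Q}_\epsilon^s\times\mathbb{R}$, $s\le3$.
   Context: $\mathbb{Q}_1^n=\mathbb{S}^n$, $\mathbb{Q}_{-1}^n=\mathbb{H}^n$; $\mathbb{E}^{n+2}$ is $\mathbb{R}^{n+2}$ if $\epsilon=1$ and Lorentzian space $\mathbb{L}^{n+2}$ if $\epsilon=-1$, with canonical basis $e_0,\dots,e_{n+1}$ ($e_0$ timelike if $\epsilon=-1$), $\mathbb{Q}_\epsilon^n\times\mathbb{R}\subset\mathbb{E}^{n+2}$ canonically, $e_{n+1}$ being the direction of the factor $\mathbb{R}$. $\partial/\partial t$ is a unit vector field tangent to the factor $\mathbb{R}$; for an isometric immersion $f$, $T$ (tangent) and $\eta$ (normal) are defined by $\frac{\partial}{\partial t}=f_*T+\eta$. Class $\mathcal{A}$ is the class of isometric immersions into $\mathbb{Q}_\epsilon^n\times\mathbb{R}$ such that $T$ is an eigenvector of all shape operators (in particular, $T$ is nowhere vanishing). Parallel mean curvature vector means $\nabla^\perp H=0$, where $\nabla^\perp$ is the normal connection (the case $H=0$ included). Rotational surfaces in $\mathbb{Q}_\epsilon^n\times\mathbb{R}$. Up to ambient isometries, let $P^{n+1}\subset\mathbb{E}^{n+2}$ be a linear subspace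 of dimension $n+1$ containing $e_0$ and $e_{n+1}$, so that $(\mathbb{Q}_\epsilon^n\times\mathbb{R})\cap P^{n+1}=\mathbb{Q}_\epsilon^{n-1}\times\mathbb{R}$, let $P^n\subset P^{n+1}$ be a linear subspace of dimension $n$ containing $e_{n+1}$, and let $\mathcal{I}$ be the group of (linear) isometries of $\mathbb{E}^{n+2}$ fixing $P^n$ pointwise. For a curve $\alpha$ in $\mathbb{Q}_\epsilon^{n-1}\times\mathbb{R}\subset P^{n+1}$ lying in one of the two half-spaces of $P^{n+1}$ determined by $P^n$, the rotational surface over (with profile) $\alpha$ and axis $P^n$ is the orbit of $\alpha$ under $\mathcal{I}$. A surface $f$ is called rotational if its image is an open part of such an orbit. In the claim the definition is applied with $n$ replaced by $m$. *)

theory Defs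
  imports "HOL-Analysis.Analysis"
begin

section \<open>Smooth maps on open sets\<close>

primrec Ck_on :: "nat \<Rightarrow> 'a::real_normed_vector set \<Rightarrow> ('a \<Rightarrow> 'b::real_normed_vector) \<Rightarrow> bool" where
  "Ck_on 0 S f \<longleftrightarrow> continuous_on S f"
| "Ck_on (Suc k) S f \<longleftrightarrow>
     (\<forall>x\<in>S. f differentiable (at x)) \<and> (\<forall>v. Ck_on k S (\<lambda>x. frechet_derivative f (at x) v))"

text \<open>Intended for open \<open>S\<close> and a finite-dimensional domain.\<close>

definition smooth_on :: "'a::real_normed_vector set \<Rightarrow> ('a \<Rightarrow> 'b::real_normed_vector) \<Rightarrow> bool" where
  "smooth_on S f \<longleftrightarrow> (\<forall>k. Ck_on k S f)"


section \<open>The ambient space\<close>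

text \<open>
  The flat space of dimension \<open>n + 2\<close>, \<open>n = CARD('n)\<close>, with coordinates
  \<open>(x\<^sub>0, (x\<^sub>1, \<dots>, x\<^sub>n), x\<^sub>n\<^sub>+\<^sub>1)\<close>; it is Euclidean for \<open>\<epsilon> = 1\<close> and Lorentzian
  for \<open>\<epsilon> = -1\<close>.
\<close>

type_synonym 'n amb = "real \<times> (real ^ 'n) \<times> real"

definition ip :: "real \<Rightarrow> 'n::finite amb \<Rightarrow> 'n amb \<Rightarrow> real" where
  "ip \<epsilon> x y = \<epsilon> * (fst x * fst y) + fst (snd x) \<bullet> fst (snd y) + snd (snd x) * snd (snd y)"

definition e_first :: "'n::finite amb" where
  "e_first = (1, 0, 0)"

definition e_last :: "'n::finite amb" where
  "e_last = (0, 0, 1)"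

definition QR :: "real \<Rightarrow> 'n::finite amb set" where
  "QR \<epsilon> = {(a, b, t) | a b t. \<epsilon> * a\<^sup>2 + b \<bullet> b = \<epsilon> \<and> (\<epsilon> = -1 \<longrightarrow> a > 0)}"

text \<open>
  The component of \<open>p\<close> in the factor containing \<open>Q\<close>. On \<open>QR \<epsilon>\<close> it is the unit normal
  (of square norm \<open>\<epsilon>\<close>) of \<open>QR \<epsilon>\<close> in the flat ambient space.
\<close>

definition Q_part :: "'n::finite amb \<Rightarrow> 'n amb" where
  "Q_part p = (fst p, fst (snd p), 0)"

definition tangent_QR :: "real \<Rightarrow> 'n::finite amb \<Rightarrow> 'n amb set" where
  "tangent_QR \<epsilon> p = {v. ip \<epsilon> v (Q_part p) = 0}"


section \<open>Local geometry of a parametrized surface\<close>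

text \<open>
  Here \<open>x\<close> is a local parametrization, defined on an open subset of the plane, of a surface in
  \<open>QR \<epsilon>\<close>. Tangent vectors of the surface at the point of parameter \<open>u\<close> are written in the
  coordinates of the parametrization, so \<open>D x u\<close> plays the role of \<open>f\<^sub>*\<close>.
  The surface carries the metric induced by \<open>x\<close>.
\<close>

abbreviation D :: "('a::real_normed_vector \<Rightarrow> 'b::real_normed_vector) \<Rightarrow> 'a \<Rightarrow> 'a \<Rightarrow> 'b" where
  "D x u w \<equiv> frechet_derivative x (at u) w"

definition induced_metric ::
    "real \<Rightarrow> (real^2 \<Rightarrow> 'n::finite amb) \<Rightarrow> real^2 \<Rightarrow> real^2 \<Rightarrow> real^2 \<Rightarrow> real" where
  "induced_metric \<epsilon> x u v w = ip \<epsilon> (D x u v) (D x u w)"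

definition normal_space :: "real \<Rightarrow> (real^2 \<Rightarrow> 'n::finite amb) \<Rightarrow> real^2 \<Rightarrow> 'n amb set" where
  "normal_space \<epsilon> x u = {\<xi> \<in> tangent_QR \<epsilon> (x u). \<forall>w. ip \<epsilon> \<xi> (D x u w) = 0}"

text \<open>Tangential (in coordinates) and normal part of a vector of \<open>tangent_QR \<epsilon> (x u)\<close>.\<close>

definition tan_part :: "real \<Rightarrow> (real^2 \<Rightarrow> 'n::finite amb) \<Rightarrow> real^2 \<Rightarrow> 'n amb \<Rightarrow> real^2" where
  "tan_part \<epsilon> x u v = (THE w. \<forall>h. ip \<epsilon> (v - D x u w) (D x u h) = 0)"

definition nor_part :: "real \<Rightarrow> (real^2 \<Rightarrow> 'n::finite amb) \<Rightarrow> real^2 \<Rightarrow> 'n amb \<Rightarrow> 'n amb" where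
  "nor_part \<epsilon> x u v = v - D x u (tan_part \<epsilon> x u v)"

text \<open>
  Levi-Civita derivative in \<open>QR \<epsilon>\<close>, in direction \<open>w\<close>, of a vector field \<open>V\<close> along \<open>x\<close> tangent to
  \<open>QR \<epsilon>\<close>: the flat derivative projected to \<open>tangent_QR \<epsilon> (x u)\<close>
  (the unit normal has square norm \<open>\<epsilon>\<close>, and \<open>1 / \<epsilon> = \<epsilon>\<close>).
\<close>

definition cov_deriv ::
    "real \<Rightarrow> (real^2 \<Rightarrow> 'n::finite amb) \<Rightarrow> (real^2 \<Rightarrow> 'n amb) \<Rightarrow> real^2 \<Rightarrow> real^2 \<Rightarrow> 'n amb" where
  "cov_deriv \<epsilon> x V u w = D V u w - (\<epsilon> * ip \<epsilon> (D V u w) (Q_part (x u))) *\<^sub>R Q_part (x u)"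

text \<open>By tensoriality the second argument may be extended to a field with constant coordinates.\<close>

definition second_ff ::
    "real \<Rightarrow> (real^2 \<Rightarrow> 'n::finite amb) \<Rightarrow> real^2 \<Rightarrow> real^2 \<Rightarrow> real^2 \<Rightarrow> 'n amb" where
  "second_ff \<epsilon> x u v w = nor_part \<epsilon> x u (cov_deriv \<epsilon> x (\<lambda>u'. D x u' w) u v)"

definition shape_op ::
    "real \<Rightarrow> (real^2 \<Rightarrow> 'n::finite amb) \<Rightarrow> real^2 \<Rightarrow> 'n amb \<Rightarrow> real^2 \<Rightarrow> real^2" where
  "shape_op \<epsilon> x u \<xi> v =
     (THE a. \<forall>w. induced_metric \<epsilon> x u a w = ip \<epsilon> (second_ff \<epsilon> x u v w) \<xi>)"

definition gram :: "real \<Rightarrow> (real^2 \<Rightarrow> 'n::finite amb) \<Rightarrow> real^2 \<Rightarrow> real^2^2" where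
  "gram \<epsilon> x u = (\<chi> i j. induced_metric \<epsilon> x u (axis i 1) (axis j 1))"

text \<open>Half of the metric trace of the second fundamental form.\<close>

definition mean_curv :: "real \<Rightarrow> (real^2 \<Rightarrow> 'n::finite amb) \<Rightarrow> real^2 \<Rightarrow> 'n amb" where
  "mean_curv \<epsilon> x u =
     (1/2) *\<^sub>R (\<Sum>i\<in>UNIV. \<Sum>j\<in>UNIV.
        matrix_inv (gram \<epsilon> x u) $ i $ j *\<^sub>R second_ff \<epsilon> x u (axis i 1) (axis j 1))"

definition normal_conn ::
    "real \<Rightarrow> (real^2 \<Rightarrow> 'n::finite amb) \<Rightarrow> (real^2 \<Rightarrow> 'n amb) \<Rightarrow> real^2 \<Rightarrow> real^2 \<Rightarrow> 'n amb" where
  "normal_conn \<epsilon> x \<xi> u w = nor_part \<epsilon> x u (cov_deriv \<epsilon> x \<xi> u w)"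

text \<open>The vector field \<open>T\<close> in \<open>\<partial>/\<partial>t = f\<^sub>* T + \<eta>\<close>; note \<open>\<partial>/\<partial>t = e_last\<close>.\<close>

definition T_field :: "real \<Rightarrow> (real^2 \<Rightarrow> 'n::finite amb) \<Rightarrow> real^2 \<Rightarrow> real^2" where
  "T_field \<epsilon> x u = tan_part \<epsilon> x u e_last"


section \<open>Surfaces\<close>

text \<open>
  An atlas consists of pairs \<open>(U, \<phi>)\<close> where \<open>\<phi>\<close> is a parametrization, by the open plane set \<open>U\<close>,
  of an open subset of the surface.
\<close>

type_synonym 'm atlas = "((real^2) set \<times> (real^2 \<Rightarrow> 'm)) set"

definition smooth_surface :: "'m topology \<Rightarrow> 'm atlas \<Rightarrow> bool" where
  "smooth_surface X A \<longleftrightarrow>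
     Hausdorff_space X \<and> second_countable X \<and>
     (\<forall>(U, \<phi>)\<in>A. open U \<and> openin X (\<phi> ` U) \<and>
        homeomorphic_map (top_of_set U) (subtopology X (\<phi> ` U)) \<phi>) \<and>
     (\<Union>(U, \<phi>)\<in>A. \<phi> ` U) = topspace X \<and>
     (\<forall>(U, \<phi>)\<in>A. \<forall>(U', \<phi>')\<in>A.
        smooth_on {u \<in> U. \<phi> u \<in> \<phi>' ` U'} (inv_into U' \<phi>' \<circ> \<phi>))"

text \<open>
  Smooth immersions into \<open>QR \<epsilon>\<close>. They are isometric immersions for the induced metric, which is
  the metric put on the surface.
\<close>

definition immersion_QR :: "real \<Rightarrow> 'm topology \<Rightarrow> 'm atlas \<Rightarrow> ('m \<Rightarrow> 'n::finite amb) \<Rightarrow> bool" where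
  "immersion_QR \<epsilon> X A f \<longleftrightarrow>
     f ` topspace X \<subseteq> QR \<epsilon> \<and>
     (\<forall>(U, \<phi>)\<in>A. smooth_on U (f \<circ> \<phi>) \<and> (\<forall>u\<in>U. inj (D (f \<circ> \<phi>) u)))"

definition class_A :: "real \<Rightarrow> 'm atlas \<Rightarrow> ('m \<Rightarrow> 'n::finite amb) \<Rightarrow> bool" where
  "class_A \<epsilon> A f \<longleftrightarrow>
     (\<forall>(U, \<phi>)\<in>A. \<forall>u\<in>U. let x = f \<circ> \<phi>; T = T_field \<epsilon> x u in
        T \<noteq> 0 \<and> (\<forall>\<xi>\<in>normal_space \<epsilon> x u. \<exists>c. shape_op \<epsilon> x u \<xi> T = c *\<^sub>R T))"

definition parallel_mean_curv :: "real \<Rightarrow> 'm atlas \<Rightarrow> ('m \<Rightarrow> 'n::finite amb) \<Rightarrow> bool" where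
  "parallel_mean_curv \<epsilon> A f \<longleftrightarrow>
     (\<forall>(U, \<phi>)\<in>A. \<forall>u\<in>U. \<forall>w. let x = f \<circ> \<phi> in
        normal_conn \<epsilon> x (mean_curv \<epsilon> x) u w = 0)"


section \<open>Totally geodesic products and rotational surfaces\<close>

text \<open>Isometries of the flat space leaving \<open>QR \<epsilon>\<close> invariant.\<close>

definition ambient_isometry :: "real \<Rightarrow> ('n::finite amb \<Rightarrow> 'n amb) \<Rightarrow> bool" where
  "ambient_isometry \<epsilon> \<Phi> \<longleftrightarrow>
     bij \<Phi> \<and> (\<forall>x y. ip \<epsilon> (\<Phi> x - \<Phi> y) (\<Phi> x - \<Phi> y) = ip \<epsilon> (x - y) (x - y)) \<and>
     \<Phi> ` QR \<epsilon> = QR \<epsilon>"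

text \<open>
  A linear subspace playing the role of the flat space of dimension \<open>m + 2\<close>: its intersection
  with \<open>QR \<epsilon>\<close> is the canonical product of the \<open>m\<close>-dimensional space form and the line.
\<close>

definition flat_subspace :: "nat \<Rightarrow> 'n::finite amb set \<Rightarrow> bool" where
  "flat_subspace m V \<longleftrightarrow> subspace V \<and> dim V = m + 2 \<and> e_first \<in> V \<and> e_last \<in> V"

definition totally_geodesic_product :: "real \<Rightarrow> nat \<Rightarrow> 'n::finite amb set \<Rightarrow> bool" where
  "totally_geodesic_product \<epsilon> m N \<longleftrightarrow>
     (\<exists>\<Phi> V. ambient_isometry \<epsilon> \<Phi> \<and> flat_subspace m V \<and> N = \<Phi> ` (V \<inter> QR \<epsilon>))"

text \<open>Linear isometries of \<open>V\<close> (their values outside \<open>V\<close> are irrelevant) fixing \<open>P\<close> pointwise.\<close>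

definition rotations ::
    "real \<Rightarrow> 'n::finite amb set \<Rightarrow> 'n amb set \<Rightarrow> ('n amb \<Rightarrow> 'n amb) set" where
  "rotations \<epsilon> V P =
     {L. linear L \<and> L ` V = V \<and> (\<forall>x\<in>V. \<forall>y\<in>V. ip \<epsilon> (L x) (L y) = ip \<epsilon> x y) \<and> (\<forall>p\<in>P. L p = p)}"

definition regular_curve :: "real set \<Rightarrow> (real \<Rightarrow> 'n::finite amb) \<Rightarrow> bool" where
  "regular_curve I \<alpha> \<longleftrightarrow>
     open I \<and> is_interval I \<and> I \<noteq> {} \<and> smooth_on I \<alpha> \<and> (\<forall>s\<in>I. vector_derivative \<alpha> (at s) \<noteq> 0)"

text \<open>
  \<open>S\<close> is an open part of a rotational surface in \<open>N\<close>, a totally geodesic product with factors of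
  dimensions \<open>m\<close> and \<open>1\<close>, over a curve with image \<open>C\<close>. The isometry \<open>\<Phi>\<close> moves the standard
  configuration, which consists of the linear subspaces \<open>P0 \<subseteq> P1 \<subseteq> V\<close> of dimensions
  \<open>m\<close>, \<open>m + 1\<close>, \<open>m + 2\<close>, of the axis \<open>P0\<close>, and of the profile curve \<open>\<alpha>\<close>, which lies in the
  half-space of \<open>P1\<close> bounded by \<open>P0\<close> on the side of \<open>w\<close>.
\<close>

definition rotational_surface ::
    "real \<Rightarrow> nat \<Rightarrow> 'n::finite amb set \<Rightarrow> 'n amb set \<Rightarrow> 'n amb set \<Rightarrow> bool" where
  "rotational_surface \<epsilon> m N C S \<longleftrightarrow>
     (\<exists>\<Phi> V P1 P0 w I \<alpha>.
        ambient_isometry \<epsilon> \<Phi> \<and>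
        flat_subspace m V \<and> N = \<Phi> ` (V \<inter> QR \<epsilon>) \<and>
        subspace P1 \<and> P1 \<subseteq> V \<and> dim P1 = m + 1 \<and> e_first \<in> P1 \<and> e_last \<in> P1 \<and>
        subspace P0 \<and> P0 \<subseteq> P1 \<and> dim P0 = m \<and> e_last \<in> P0 \<and>
        w \<in> P1 - P0 \<and>
        regular_curve I \<alpha> \<and>
        \<alpha> ` I \<subseteq> QR \<epsilon> \<inter> {p + c *\<^sub>R w | p c. p \<in> P0 \<and> c > 0} \<and>
        C = \<Phi> ` \<alpha> ` I \<and>
        openin (top_of_set (\<Phi> ` (\<Union>L\<in>rotations \<epsilon> V P0. L ` \<alpha> ` I))) S)"

end

theory Submission
  imports Defs
begin

text \<open>
  Write \<open>S = T / |T|\<^sup>2\<close> and let \<open>X\<close> be a horizontal unit tangent vector of the surface, so that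
  \<open>X\<close> is orthogonal to \<open>S\<close> and the height grows at unit speed along \<open>S\<close>. Let \<open>q\<close> be the component of the position in the
  space form, \<open>H\<close> the mean curvature vector and \<open>W\<close> the flat derivative of \<open>X\<close> along itself. Class \<open>A\<close> makes
  the flat derivative of \<open>X\<close> along \<open>S\<close> vanish, and together with the Codazzi symmetry of
  second derivatives the condition that \<open>H\<close> is parallel closes the system: the derivatives of \<open>q, S, X, W, H\<close> along
  \<open>X\<close> and \<open>S\<close> are polynomials in these vectors and their scalar products. Three consequences follow.

  The plane spanned by \<open>X\<close> and \<open>W\<close> is constant, and along the curves of constant height all these vectors
  move by the isometries fixing its orthogonal complement. Along \<open>S\<close> the state \<open>(q, S, W, H)\<close> solves an
  autonomous ODE in the height, so by uniqueness and connectedness a single solution, moved by these isometries,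
  describes the whole surface; its first component is the profile curve. Finally \<open>e_last, q, S, X, W, H\<close> at one point
  span a space invariant under the system, which bounds the dimension by 6 and hence \<open>m\<close> by 4.
\<close>

section \<open>Smooth maps\<close>

text \<open>Pairing with \<open>q\<close> replaces it: differentiating <X,q> = 0 along
  \<open>X\<close> gives <W,q> = -1, and the products with \<open>X\<close> and \<open>q\<close>
  then recover the coefficients of every vector of the plane. The same -1 fixes the codimension of
  the axis and keeps the profile on one side of it. Besides the nonvanishing of \<open>T\<close>,
  class A enters only through the vanishing of the second fundamental form on \<open>T\<close> and
  \<open>X\<close>, obtained by testing with the shape operator of that very value. Integral curves
  come from inverting the height together with <X,q(u1)>, and the surface itself supplies the
  solutions of the profile equation; what remains to be shown is uniqueness. \<open>X\<close> is
  determined only up to sign, while \<open>q\<close>, \<open>S\<close>, \<open>W\<close>,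
  \<open>H\<close> do not depend on this sign. Hence the state omits \<open>X\<close>, and the
  global argument speaks of the orthogonal complement of the plane.\<close>

lemma Ck_on_cong:
  assumes "open S" "\<And>x. x \<in> S \<Longrightarrow> f x = g x" "Ck_on k S f"
  shows "Ck_on k S g"
  using assms(2,3)
proof (induction k arbitrary: f g)
  case 0
  then show ?case by (simp add: continuous_on_cong[of S S f g])
next
  case (Suc k)
  have diff: "g differentiable (at x)" if "x \<in> S" for x
    using Suc.prems that assms(1)
    by (metis Ck_on.simps(2) differentiable_def has_derivative_transform_within_open)
  have eq: "frechet_derivative f (at x) = frechet_derivative g (at x)" if "x \<in> S" for x
    using Suc.prems that assms(1) by (intro frechet_derivative_transform_within_open[of f x S g]) auto
  have "Ck_on k S (\<lambda>x. frechet_derivative g (at x) v)" for v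
    by (rule Suc.IH[of "\<lambda>x. frechet_derivative f (at x) v"]) (use eq Suc.prems in auto)
  then show ?case using diff by simp
qed

lemma Ck_on_SucD: "Ck_on (Suc k) S f \<Longrightarrow> Ck_on k S f"
proof (induction k arbitrary: f)
  case 0
  then show ?case
    by (auto intro!: differentiable_imp_continuous_on differentiable_at_imp_differentiable_on)
next
  case (Suc k)
  then show ?case by (simp only: Ck_on.simps) blast
qed

lemma Ck_on_SucI:
  assumes "open S" "\<And>x. x \<in> S \<Longrightarrow> (f has_derivative f' x) (at x)" "\<And>v. Ck_on k S (\<lambda>x. f' x v)"
  shows "Ck_on (Suc k) S f"
proof -
  have "Ck_on k S (\<lambda>x. frechet_derivative f (at x) v)" for v
    by (rule Ck_on_cong[OF assms(1) _ assms(3)[of v]]) (use assms(2) frechet_derivative_at in metis)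
  then show ?thesis using assms(2) by (auto simp: differentiable_def)
qed

lemma Ck_on_const: "open S \<Longrightarrow> Ck_on k S (\<lambda>x. c)"
  by (induction k arbitrary: c) auto

lemma Ck_on_SucE:
  assumes "Ck_on (Suc k) S f" "x \<in> S"
  shows "(f has_derivative (\<lambda>v. D f x v)) (at x)"
  using assms by (auto simp: frechet_derivative_works)

lemma Ck_on_bounded_linear:
  assumes S: "open S" and L: "bounded_linear L"
  shows "Ck_on k S f \<Longrightarrow> Ck_on k S (\<lambda>x. L (f x))"
proof (induction k arbitrary: f)
  case 0
  then show ?case using L by (auto intro: bounded_linear.continuous_on)
next
  case (Suc k)
  show ?case
    by (rule Ck_on_SucI[OF S, where f' = "\<lambda>x v. L (D f x v)"])
      (use Suc in \<open>auto intro!: bounded_linear.has_derivative[OF L] Ck_on_SucE\<close>)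
qed

lemma Ck_on_add:
  assumes S: "open S"
  shows "Ck_on k S f \<Longrightarrow> Ck_on k S g \<Longrightarrow> Ck_on k S (\<lambda>x. f x + g x)"
proof (induction k arbitrary: f g)
  case 0
  then show ?case by (auto intro: continuous_intros)
next
  case (Suc k)
  show ?case
    by (rule Ck_on_SucI[OF S, where f' = "\<lambda>x v. D f x v + D g x v"])
      (use Suc in \<open>auto intro!: has_derivative_add Ck_on_SucE\<close>)
qed

lemma Ck_on_bilinear:
  assumes S: "open S" and B: "bounded_bilinear B"
  shows "Ck_on k S f \<Longrightarrow> Ck_on k S g \<Longrightarrow> Ck_on k S (\<lambda>x. B (f x) (g x))"
proof (induction k arbitrary: f g)
  case 0
  then show ?case using B by (auto intro: bounded_bilinear.continuous_on)
next
  case (Suc k)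
  show ?case
  proof (rule Ck_on_SucI[OF S, where f' = "\<lambda>x v. B (f x) (D g x v) + B (D f x v) (g x)"])
    show "((\<lambda>x. B (f x) (g x)) has_derivative (\<lambda>v. B (f x) (D g x v) + B (D f x v) (g x))) (at x)"
      if "x \<in> S" for x
      using Suc.prems that by (intro bounded_bilinear.FDERIV[OF B] Ck_on_SucE)
    show "Ck_on k S (\<lambda>x. B (f x) (D g x v) + B (D f x v) (g x))" for v
    proof (rule Ck_on_add[OF S Suc.IH[OF Ck_on_SucD[OF Suc.prems(1)]] Suc.IH[OF _ Ck_on_SucD[OF Suc.prems(2)]]])
      show "Ck_on k S (\<lambda>x. D g x v)" "Ck_on k S (\<lambda>x. D f x v)" using Suc.prems by auto
    qed
  qed
qed

text \<open>Powers of positive functions serve two purposes below: exponent -1/2 normalises a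
  tangent vector, exponent -1 divides. Differentiation shifts the exponent, hence an induction over
  all exponents at once.\<close>

lemma Ck_on_powr:
  fixes f :: "'a::real_normed_vector \<Rightarrow> real"
  assumes S: "open S" and pos: "\<And>x. x \<in> S \<Longrightarrow> f x > 0"
  shows "Ck_on k S f \<Longrightarrow> Ck_on k S (\<lambda>x. f x powr a)"
proof (induction k arbitrary: a)
  case 0
  then show ?case using pos by (auto intro!: continuous_on_powr simp: order_less_imp_not_eq2)
next
  case (Suc k)
  show ?case
  proof (rule Ck_on_SucI[OF S, where f' = "\<lambda>x v. (a * f x powr (a - 1)) * D f x v"])
    fix x assume x: "x \<in> S"
    have "((\<lambda>y. y powr a) has_real_derivative (a * f x powr (a - 1))) (at (f x))"
      using pos[OF x] by (rule has_real_derivative_powr)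
    then show "((\<lambda>x. f x powr a) has_derivative (\<lambda>v. (a * f x powr (a - 1)) * D f x v)) (at x)"
      using has_derivative_compose[OF Ck_on_SucE[OF Suc.prems x], of "\<lambda>y. y powr a"
        "\<lambda>v. (a * f x powr (a - 1)) * v"]
      by (simp add: has_field_derivative_def)
  next
    fix v
    have "Ck_on k S (\<lambda>x. a * f x powr (a - 1))"
      by (rule Ck_on_bilinear[OF S bounded_bilinear_mult Ck_on_const[OF S] Suc.IH[OF Ck_on_SucD[OF Suc.prems]]])
    then show "Ck_on k S (\<lambda>x. (a * f x powr (a - 1)) * D f x v)"
      by (rule Ck_on_bilinear[OF S bounded_bilinear_mult]) (use Suc.prems in auto)
  qed
qed

lemma smooth_on_D: "smooth_on S f \<Longrightarrow> smooth_on S (\<lambda>x. D f x v)"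
  unfolding smooth_on_def using Ck_on.simps(2) by blast

lemma smooth_on_has_derivative:
  assumes "smooth_on S f" "x \<in> S"
  shows "(f has_derivative (\<lambda>v. D f x v)) (at x)"
  by (rule Ck_on_SucE[of 0 S]) (use assms in \<open>auto simp: smooth_on_def simp del: Ck_on.simps\<close>)

lemma smooth_on_continuous: "smooth_on S f \<Longrightarrow> continuous_on S f"
  unfolding smooth_on_def by (metis Ck_on.simps(1))

lemma smooth_on_const: "open S \<Longrightarrow> smooth_on S (\<lambda>x. c)"
  by (simp add: smooth_on_def Ck_on_const)

lemma smooth_on_cong:
  assumes "open S" "\<And>x. x \<in> S \<Longrightarrow> f x = g x" "smooth_on S f"
  shows "smooth_on S g"
  using assms Ck_on_cong[OF assms(1), of f g] by (simp add: smooth_on_def)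

lemma smooth_on_bounded_linear:
  "open S \<Longrightarrow> bounded_linear L \<Longrightarrow> smooth_on S f \<Longrightarrow> smooth_on S (\<lambda>x. L (f x))"
  by (simp add: smooth_on_def Ck_on_bounded_linear)

lemma smooth_on_add:
  "open S \<Longrightarrow> smooth_on S f \<Longrightarrow> smooth_on S g \<Longrightarrow> smooth_on S (\<lambda>x. f x + g x)"
  by (simp add: smooth_on_def Ck_on_add)

lemma smooth_on_bilinear:
  "open S \<Longrightarrow> bounded_bilinear B \<Longrightarrow> smooth_on S f \<Longrightarrow> smooth_on S g \<Longrightarrow> smooth_on S (\<lambda>x. B (f x) (g x))"
  by (simp add: smooth_on_def Ck_on_bilinear)

lemmas smooth_on_mult = smooth_on_bilinear[OF _ bounded_bilinear_mult]
lemmas smooth_on_scaleR = smooth_on_bilinear[OF _ bounded_bilinear_scaleR]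

lemma smooth_on_minus:
  "open S \<Longrightarrow> smooth_on S f \<Longrightarrow> smooth_on S (\<lambda>x. - f x)"
  by (rule smooth_on_bounded_linear[OF _ bounded_linear_minus[OF bounded_linear_ident]])

lemma smooth_on_diff:
  "open S \<Longrightarrow> smooth_on S f \<Longrightarrow> smooth_on S g \<Longrightarrow> smooth_on S (\<lambda>x. f x - g x)"
  unfolding diff_conv_add_uminus by (rule smooth_on_add[OF _ _ smooth_on_minus])

lemma smooth_on_powr:
  fixes f :: "'a::real_normed_vector \<Rightarrow> real"
  assumes "open S" "\<And>x. x \<in> S \<Longrightarrow> f x > 0" "smooth_on S f"
  shows "smooth_on S (\<lambda>x. f x powr a)"
  using Ck_on_powr[where f = f, OF assms(1,2)] assms(3) unfolding smooth_on_def by blast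

lemma smooth_on_sum:
  "open S \<Longrightarrow> (\<And>i. i \<in> I \<Longrightarrow> smooth_on S (f i)) \<Longrightarrow> smooth_on S (\<lambda>x. \<Sum>i\<in>I. f i x)"
proof (induction I rule: infinite_finite_induct)
  case (insert i I)
  then show ?case using smooth_on_add[of S "f i" "\<lambda>x. \<Sum>i\<in>I. f i x"] by simp
qed (simp_all add: smooth_on_const)

section \<open>Derivatives along vector fields and their symmetry\<close>

lemma D_expand:
  fixes f :: "'a::euclidean_space \<Rightarrow> 'b::real_normed_vector"
  assumes "smooth_on S f" "x \<in> S"
  shows "D f x v = (\<Sum>b\<in>Basis. (v \<bullet> b) *\<^sub>R D f x b)"
proof -
  have l: "linear (D f x)"
    using smooth_on_has_derivative[OF assms] by (simp add: bounded_linear.linear has_derivative_bounded_linear)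
  have "D f x v = D f x (\<Sum>b\<in>Basis. (v \<bullet> b) *\<^sub>R b)" by (simp add: euclidean_representation)
  then show ?thesis by (simp add: linear_sum[OF l] linear_scale[OF l])
qed

text \<open>\<open>smooth_on\<close> controls derivatives in constant directions; a varying
  direction is reduced to these by expanding it in the basis.\<close>

lemma smooth_on_D_field:
  fixes f :: "'a::euclidean_space \<Rightarrow> 'b::real_normed_vector"
  assumes "open S" "smooth_on S f" "smooth_on S \<xi>"
  shows "smooth_on S (\<lambda>u. D f u (\<xi> u))"
proof (rule smooth_on_cong[OF assms(1)])
  show "(\<Sum>b\<in>Basis. (\<xi> u \<bullet> b) *\<^sub>R D f u b) = D f u (\<xi> u)" if "u \<in> S" for u
    by (rule D_expand[OF assms(2) that, symmetric])
  show "smooth_on S (\<lambda>u. \<Sum>b\<in>Basis. (\<xi> u \<bullet> b) *\<^sub>R D f u b)"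
    by (rule smooth_on_sum[OF assms(1)], rule smooth_on_scaleR[OF assms(1)
          smooth_on_bounded_linear[OF assms(1) bounded_linear_inner_left assms(3)] smooth_on_D[OF assms(2)]])
qed

text \<open>The mean value theorem twice: along \<open>v\<close> for the increment in direction
  \<open>w\<close>, and along \<open>w\<close> for the derivative in direction \<open>v\<close>. The
  difference on the left is symmetric in \<open>v\<close> and \<open>w\<close>, which is what makes
  it useful.\<close>

lemma second_difference:
  fixes g :: "'a::real_normed_vector \<Rightarrow> real"
  assumes d: "0 < d"
    and Sg: "smooth_on S g"
    and S: "\<And>s t. 0 \<le> s \<Longrightarrow> s \<le> d \<Longrightarrow> 0 \<le> t \<Longrightarrow> t \<le> d \<Longrightarrow> u + s *\<^sub>R v + t *\<^sub>R w \<in> S"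
  shows "\<exists>s t. 0 < s \<and> s < d \<and> 0 < t \<and> t < d \<and>
    g (u + d *\<^sub>R v + d *\<^sub>R w) - g (u + d *\<^sub>R v) - g (u + d *\<^sub>R w) + g u
      = d * (d * D (\<lambda>u. D g u v) (u + s *\<^sub>R v + t *\<^sub>R w) w)"
proof -
  have affine: "((\<lambda>s. a + s *\<^sub>R z) has_derivative (\<lambda>h. h *\<^sub>R z)) (at s)" for a z :: 'a and s
    by (rule has_derivative_eq_rhs, rule has_derivative_add[OF has_derivative_const
          has_derivative_scaleR_left[OF has_derivative_ident]]) simp
  note der = smooth_on_has_derivative[OF Sg]
  note der2 = smooth_on_has_derivative[OF smooth_on_D[OF Sg, of v]]
  have line: "((\<lambda>s. g (a + s *\<^sub>R v)) has_real_derivative D g (a + s *\<^sub>R v) v) (at s)"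
    if "a + s *\<^sub>R v \<in> S" for a s
  proof -
    have "((\<lambda>s. g (a + s *\<^sub>R v)) has_derivative (\<lambda>h. D g (a + s *\<^sub>R v) (h *\<^sub>R v))) (at s)"
      by (rule has_derivative_compose[OF affine der[OF that]])
    moreover have "linear (D g (a + s *\<^sub>R v))"
      using der[OF that] has_derivative_bounded_linear bounded_linear.linear by blast
    ultimately show ?thesis
      unfolding has_field_derivative_def by (simp add: linear_scale mult_commute_abs)
  qed
  have line2: "((\<lambda>s. D g (a + s *\<^sub>R w) v) has_real_derivative D (\<lambda>u. D g u v) (a + s *\<^sub>R w) w) (at s)"
    if "a + s *\<^sub>R w \<in> S" for a s
  proof -
    have "((\<lambda>s. D g (a + s *\<^sub>R w) v) has_derivative (\<lambda>h. D (\<lambda>u. D g u v) (a + s *\<^sub>R w) (h *\<^sub>R w))) (at s)"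
      by (rule has_derivative_compose[OF affine der2[OF that]])
    moreover have "linear (D (\<lambda>u. D g u v) (a + s *\<^sub>R w))"
      using der2[OF that] has_derivative_bounded_linear bounded_linear.linear by blast
    ultimately show ?thesis
      unfolding has_field_derivative_def by (simp add: linear_scale mult_commute_abs)
  qed
  define \<psi> where "\<psi> s = g ((u + d *\<^sub>R w) + s *\<^sub>R v) - g (u + s *\<^sub>R v)" for s
  have "\<exists>s. 0 < s \<and> s < d \<and> \<psi> d - \<psi> 0 = (d - 0) * (D g ((u + d *\<^sub>R w) + s *\<^sub>R v) v - D g (u + s *\<^sub>R v) v)"
    unfolding \<psi>_def
  proof (rule MVT2[OF d], rule DERIV_diff; rule line)
    fix s assume "0 \<le> s" "s \<le> d"
    then show "u + d *\<^sub>R w + s *\<^sub>R v \<in> S" "u + s *\<^sub>R v \<in> S"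
      using S[of s d] S[of s 0] d by (auto simp: algebra_simps)
  qed
  then obtain s where s: "0 < s" "s < d"
    "\<psi> d - \<psi> 0 = d * (D g ((u + d *\<^sub>R w) + s *\<^sub>R v) v - D g (u + s *\<^sub>R v) v)" by auto
  have "\<exists>t. 0 < t \<and> t < d \<and> D g ((u + s *\<^sub>R v) + d *\<^sub>R w) v - D g ((u + s *\<^sub>R v) + 0 *\<^sub>R w) v
      = (d - 0) * D (\<lambda>u. D g u v) ((u + s *\<^sub>R v) + t *\<^sub>R w) w"
    by (rule MVT2[OF d], rule line2) (use s S in auto)
  then obtain t where t: "0 < t" "t < d" "D g ((u + s *\<^sub>R v) + d *\<^sub>R w) v - D g (u + s *\<^sub>R v) v
      = d * D (\<lambda>u. D g u v) ((u + s *\<^sub>R v) + t *\<^sub>R w) w" by auto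
  have "\<psi> d - \<psi> 0 = g (u + d *\<^sub>R v + d *\<^sub>R w) - g (u + d *\<^sub>R v) - g (u + d *\<^sub>R w) + g u"
    by (simp add: \<psi>_def algebra_simps)
  moreover have "(u + d *\<^sub>R w) + s *\<^sub>R v = (u + s *\<^sub>R v) + d *\<^sub>R w" by (simp add: algebra_simps)
  ultimately show ?thesis using s t by metis
qed

text \<open>Schwarz's theorem. Writing one second difference in both orders shows that one mixed
  derivative at some point equals the other at another point, both arbitrarily close to
  \<open>u\<close>; continuity does the rest.\<close>

lemma D2_symmetric_real:
  fixes g :: "'a::real_normed_vector \<Rightarrow> real"
  assumes S: "open S" and Sg: "smooth_on S g" and u: "u \<in> S"
  shows "D (\<lambda>u. D g u v) u w = D (\<lambda>u. D g u w) u v"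
proof -
  let ?A = "\<lambda>x. D (\<lambda>u. D g u v) x w" and ?B = "\<lambda>x. D (\<lambda>u. D g u w) x v"
  have cA: "continuous (at u) ?A" and cB: "continuous (at u) ?B"
    using smooth_on_continuous[OF smooth_on_D[OF smooth_on_D[OF Sg]]] S u
    by (auto simp: continuous_on_eq_continuous_at)
  have "\<bar>?A u - ?B u\<bar> \<le> e" if "e > 0" for e
  proof -
    obtain r0 where r0: "r0 > 0" "ball u r0 \<subseteq> S" using S u openE by blast
    have "\<exists>r>0. \<forall>x. dist x u < r \<longrightarrow> dist (?A x) (?A u) < e/2"
      using cA[unfolded continuous_at_eps_delta, rule_format, of "e/2"] that by simp
    then obtain r1 where r1: "r1 > 0" "\<And>x. dist x u < r1 \<Longrightarrow> dist (?A x) (?A u) < e/2" by blast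
    have "\<exists>r>0. \<forall>x. dist x u < r \<longrightarrow> dist (?B x) (?B u) < e/2"
      using cB[unfolded continuous_at_eps_delta, rule_format, of "e/2"] that by simp
    then obtain r2 where r2: "r2 > 0" "\<And>x. dist x u < r2 \<Longrightarrow> dist (?B x) (?B u) < e/2" by blast
    define r where "r = min r0 (min r1 r2)"
    have r: "r > 0" "\<And>x. dist x u < r \<Longrightarrow> x \<in> S \<and> \<bar>?A x - ?A u\<bar> < e/2 \<and> \<bar>?B x - ?B u\<bar> < e/2"
      using r0 r1 r2 by (auto simp: r_def dist_real_def mem_ball subset_iff dist_commute)
    \<comment> \<open>The summand 1 keeps \<open>K\<close> positive when both directions vanish;
      with \<open>d = r / (2 * K)\<close> the whole parallelogram stays within r/2 of
      \<open>u\<close>.\<close>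
    define K where "K = norm v + norm w + 1"
    have den: "K > 0" unfolding K_def by (smt (verit) norm_ge_zero)
    define d where "d = r / (2 * K)"
    have d: "d > 0" using r den by (simp add: d_def)
    have near: "dist (u + s *\<^sub>R v + t *\<^sub>R w) u < r" if "0 \<le> s" "s \<le> d" "0 \<le> t" "t \<le> d" for s t
    proof -
      have "dist (u + s *\<^sub>R v + t *\<^sub>R w) u \<le> s * norm v + t * norm w"
        using norm_triangle_ineq[of "s *\<^sub>R v" "t *\<^sub>R w"] that by (simp add: dist_norm add.assoc)
      also have "\<dots> \<le> d * norm v + d * norm w" using that by (intro add_mono mult_right_mono) auto
      also have "\<dots> \<le> d * K" using d by (simp add: K_def algebra_simps)
      also have "\<dots> = r / 2" using den by (simp add: d_def)
      finally show ?thesis using r by simp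
    qed
    obtain s t where 1: "0 < s" "s < d" "0 < t" "t < d"
      "g (u + d *\<^sub>R v + d *\<^sub>R w) - g (u + d *\<^sub>R v) - g (u + d *\<^sub>R w) + g u = d * (d * ?A (u + s *\<^sub>R v + t *\<^sub>R w))"
      using second_difference[OF d Sg, of u v w] near r(2) by blast
    have near': "u + s *\<^sub>R w + t *\<^sub>R v \<in> S" if "0 \<le> s" "s \<le> d" "0 \<le> t" "t \<le> d" for s t
      using near[of t s] r(2) that by (simp add: add.commute add.left_commute)
    obtain s' t' where 2: "0 < s'" "s' < d" "0 < t'" "t' < d"
      "g (u + d *\<^sub>R w + d *\<^sub>R v) - g (u + d *\<^sub>R w) - g (u + d *\<^sub>R v) + g u = d * (d * ?B (u + s' *\<^sub>R w + t' *\<^sub>R v))"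
      using second_difference[OF d Sg near'] by blast
    have "u + d *\<^sub>R w + d *\<^sub>R v = u + d *\<^sub>R v + d *\<^sub>R w" by simp
    then have "d * (d * ?A (u + s *\<^sub>R v + t *\<^sub>R w)) = d * (d * ?B (u + s' *\<^sub>R w + t' *\<^sub>R v))"
      using 1(5) 2(5) by (simp only:)
    then have "?A (u + s *\<^sub>R v + t *\<^sub>R w) = ?B (u + s' *\<^sub>R w + t' *\<^sub>R v)" using d by simp
    moreover have "u + s' *\<^sub>R w + t' *\<^sub>R v = u + t' *\<^sub>R v + s' *\<^sub>R w" by simp
    ultimately show ?thesis
      using r(2)[OF near[of s t]] r(2)[OF near[of t' s']] 1 2 by (auto simp: abs_if split: if_splits)
  qed
  then have "\<bar>?A u - ?B u\<bar> \<le> 0" by (rule field_le_epsilon) auto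
  then show ?thesis by simp
qed

lemma D2_symmetric:
  fixes f :: "'a::real_normed_vector \<Rightarrow> 'b::real_inner"
  assumes S: "open S" and Sf: "smooth_on S f" and u: "u \<in> S"
  shows "D (\<lambda>u. D f u v) u w = D (\<lambda>u. D f u w) u v"
proof -
  have inner_D: "D (\<lambda>u. F u \<bullet> b) x v = D F x v \<bullet> b" if "smooth_on S F" "x \<in> S"
    for F :: "'a \<Rightarrow> 'b" and b x v
    by (rule fun_cong[OF frechet_derivative_at[OF has_derivative_inner_left[OF smooth_on_has_derivative[OF that]], symmetric]])
  have "D (\<lambda>u. D f u v) u w \<bullet> b = D (\<lambda>u. D f u w) u v \<bullet> b" for b
  proof -
    have tr: "D (\<lambda>u. D (\<lambda>u. f u \<bullet> b) u v) u w = D (\<lambda>u. D f u v \<bullet> b) u w" for v w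
    proof (rule fun_cong[OF frechet_derivative_transform_within_open[OF _ S u]])
      show "(\<lambda>u. D (\<lambda>u. f u \<bullet> b) u v) differentiable at u"
        using smooth_on_has_derivative[OF smooth_on_D[OF smooth_on_bounded_linear[OF S bounded_linear_inner_left Sf]] u]
        by (auto simp: differentiable_def)
    qed (use inner_D[OF Sf] in auto)
    have eq: "D (\<lambda>u. D f u v) u w \<bullet> b = D (\<lambda>u. D (\<lambda>u. f u \<bullet> b) u v) u w" for v w
      unfolding tr by (rule inner_D[OF smooth_on_D[OF Sf] u, symmetric])
    show ?thesis
      unfolding eq by (rule D2_symmetric_real[OF S smooth_on_bounded_linear[OF S bounded_linear_inner_left Sf] u])
  qed
  then have "(D (\<lambda>u. D f u v) u w - D (\<lambda>u. D f u w) u v) \<bullet> b = 0" for b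
    by (simp add: inner_diff_left)
  then have "D (\<lambda>u. D f u v) u w - D (\<lambda>u. D f u w) u v = 0"
    by (rule inner_eq_zero_iff[THEN iffD1])
  then show ?thesis by simp
qed

text \<open>Product rule for the pairing of derivative and direction: one summand differentiates
  \<open>D f\<close> with the direction frozen at \<open>\<xi> u\<close>, the other differentiates
  the direction.\<close>

lemma has_derivative_D_field:
  fixes f :: "'a::euclidean_space \<Rightarrow> 'b::real_normed_vector"
  assumes "open S" "smooth_on S f" "smooth_on S \<xi>" "u \<in> S"
  shows "((\<lambda>u. D f u (\<xi> u)) has_derivative
     (\<lambda>v. D (\<lambda>u'. D f u' (\<xi> u)) u v + D f u (D \<xi> u v))) (at u)"
proof -
  note d\<xi> = smooth_on_has_derivative[OF assms(3,4)]
  note df = smooth_on_has_derivative[OF smooth_on_D[OF assms(2)] assms(4)]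
  have "((\<lambda>u. \<Sum>b\<in>Basis. (\<xi> u \<bullet> b) *\<^sub>R D f u b) has_derivative
    (\<lambda>v. \<Sum>b\<in>Basis. (\<xi> u \<bullet> b) *\<^sub>R D (\<lambda>u. D f u b) u v + (D \<xi> u v \<bullet> b) *\<^sub>R D f u b)) (at u)"
    by (rule has_derivative_sum, rule has_derivative_scaleR[OF has_derivative_inner_left[OF d\<xi>] df])
  moreover have "(\<Sum>b\<in>Basis. (\<xi> u \<bullet> b) *\<^sub>R D (\<lambda>u. D f u b) u v + (D \<xi> u v \<bullet> b) *\<^sub>R D f u b)
     = D (\<lambda>u'. D f u' (\<xi> u)) u v + D f u (D \<xi> u v)" for v
  proof -
    have "((\<lambda>u'. \<Sum>b\<in>Basis. (\<xi> u \<bullet> b) *\<^sub>R D f u' b) has_derivative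
      (\<lambda>v. \<Sum>b\<in>Basis. (\<xi> u \<bullet> b) *\<^sub>R D (\<lambda>u. D f u b) u v)) (at u)"
      by (rule has_derivative_sum, rule has_derivative_scaleR_right[OF df])
    then have "((\<lambda>u'. D f u' (\<xi> u)) has_derivative
      (\<lambda>v. \<Sum>b\<in>Basis. (\<xi> u \<bullet> b) *\<^sub>R D (\<lambda>u. D f u b) u v)) (at u)"
      by (rule has_derivative_transform_within_open[OF _ assms(1,4)])
        (rule D_expand[OF assms(2), symmetric])
    then have "D (\<lambda>u'. D f u' (\<xi> u)) u v = (\<Sum>b\<in>Basis. (\<xi> u \<bullet> b) *\<^sub>R D (\<lambda>u. D f u b) u v)"
      by (simp add: frechet_derivative_at[symmetric])
    then show ?thesis by (simp add: sum.distrib D_expand[OF assms(2,4), of "D \<xi> u v", symmetric])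
  qed
  ultimately have "((\<lambda>u. \<Sum>b\<in>Basis. (\<xi> u \<bullet> b) *\<^sub>R D f u b) has_derivative
     (\<lambda>v. D (\<lambda>u'. D f u' (\<xi> u)) u v + D f u (D \<xi> u v))) (at u)" by simp
  then show ?thesis
    by (rule has_derivative_transform_within_open[OF _ assms(1,4)]) (rule D_expand[OF assms(2), symmetric])
qed

lemma D_D_field:
  fixes f :: "'a::euclidean_space \<Rightarrow> 'b::real_normed_vector"
  assumes "open S" "smooth_on S f" "smooth_on S \<xi>" "u \<in> S"
  shows "D (\<lambda>u. D f u (\<xi> u)) u v = D (\<lambda>u'. D f u' (\<xi> u)) u v + D f u (D \<xi> u v)"
  by (rule fun_cong[OF frechet_derivative_at[OF has_derivative_D_field[OF assms], symmetric]])

text \<open>The second derivatives cancel by symmetry and leave the derivative along the Lie bracket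
  of the two fields. Applied to \<open>x\<close>, \<open>X\<close> and \<open>S\<close>, this
  supplies the integrability conditions behind the structure equations.\<close>

lemma D_commutator:
  fixes f :: "'a::euclidean_space \<Rightarrow> 'b::real_inner"
  assumes "open S" "smooth_on S f" "smooth_on S \<xi>" "smooth_on S s" "u \<in> S"
  shows "D (\<lambda>u. D f u (\<xi> u)) u (s u) - D (\<lambda>u. D f u (s u)) u (\<xi> u)
    = D f u (D \<xi> u (s u) - D s u (\<xi> u))"
proof -
  have "linear (D f u)"
    using smooth_on_has_derivative[OF assms(2,5)] by (simp add: bounded_linear.linear has_derivative_bounded_linear)
  then show ?thesis
    using D_D_field[OF assms(1,2,3,5), of "s u"] D_D_field[OF assms(1,2,4,5), of "\<xi> u"]
      D2_symmetric[OF assms(1,2,5), of "\<xi> u" "s u"] by (simp add: linear_diff)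
qed

text \<open>Gronwall's argument: under this bound the squared norm, multiplied by exp(-2Ct), does
  not increase.\<close>

lemma linear_growth_zero:
  fixes \<phi> :: "real \<Rightarrow> 'a::real_inner"
  assumes ab: "a \<le> b" and C: "\<And>t. t \<in> {a..b} \<Longrightarrow> norm (\<phi>' t) \<le> C * norm (\<phi> t)"
    and d: "\<And>t. t \<in> {a..b} \<Longrightarrow> (\<phi> has_vector_derivative \<phi>' t) (at t)"
    and a: "\<phi> a = 0"
  shows "\<phi> b = 0"
proof -
  let ?\<psi> = "\<lambda>t. (\<phi> t \<bullet> \<phi> t) * exp (- 2 * C * t)"
  have "?\<psi> b \<le> ?\<psi> a"
  proof (rule DERIV_nonpos_imp_nonincreasing[of a b ?\<psi>, OF ab])
    fix t assume "a \<le> t" "t \<le> b"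
    then have t: "t \<in> {a..b}" by simp
    have "((\<lambda>t. \<phi> t \<bullet> \<phi> t) has_real_derivative 2 * (\<phi> t \<bullet> \<phi>' t)) (at t)"
      unfolding has_field_derivative_def
      by (rule has_derivative_eq_rhs[OF has_derivative_inner[OF d[OF t, unfolded has_vector_derivative_def]
            d[OF t, unfolded has_vector_derivative_def]]])
        (simp add: fun_eq_iff inner_commute[of "\<phi>' t"])
    then have "(?\<psi> has_real_derivative (2 * (\<phi> t \<bullet> \<phi>' t) - 2 * C * (\<phi> t \<bullet> \<phi> t)) * exp (- 2 * C * t)) (at t)"
      by (auto intro!: derivative_eq_intros simp: algebra_simps)
    moreover have "2 * (\<phi> t \<bullet> \<phi>' t) - 2 * C * (\<phi> t \<bullet> \<phi> t) \<le> 0"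
    proof -
      have "\<phi> t \<bullet> \<phi>' t \<le> norm (\<phi> t) * norm (\<phi>' t)" by (rule norm_cauchy_schwarz)
      also have "\<dots> \<le> norm (\<phi> t) * (C * norm (\<phi> t))" by (rule mult_left_mono[OF C[OF t]]) simp
      finally show ?thesis by (simp add: dot_square_norm power2_eq_square algebra_simps)
    qed
    ultimately show "\<exists>y. (?\<psi> has_real_derivative y) (at t) \<and> y \<le> 0"
      by (meson exp_ge_zero mult_nonpos_nonneg)
  qed
  then have "(\<phi> b \<bullet> \<phi> b) * exp (- 2 * C * b) \<le> 0" using a by simp
  then have "\<phi> b \<bullet> \<phi> b \<le> 0" by (simp add: mult_le_0_iff)
  then show ?thesis by (meson inner_eq_zero_iff inner_ge_zero order_antisym)
qed

text \<open>Times before \<open>t0\<close> are reached by reversing time. The bound may depend on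
  the compact subinterval, so coefficients may blow up at the ends of \<open>I\<close>.\<close>

lemma linear_growth_zero_interval:
  fixes \<phi> :: "real \<Rightarrow> 'a::real_inner"
  assumes I: "is_interval I" and t0: "t0 \<in> I" and t: "t \<in> I"
    and C: "\<And>a b. {a..b} \<subseteq> I \<Longrightarrow> \<exists>C. \<forall>t\<in>{a..b}. norm (\<phi>' t) \<le> C * norm (\<phi> t)"
    and d: "\<And>t. t \<in> I \<Longrightarrow> (\<phi> has_vector_derivative \<phi>' t) (at t)"
    and a: "\<phi> t0 = 0"
  shows "\<phi> t = 0"
proof (cases "t0 \<le> t")
  case True
  have sub: "{t0..t} \<subseteq> I" using mem_is_interval_1_I[OF I t0 t] by auto
  from C[OF sub] obtain c where c: "\<forall>t\<in>{t0..t}. norm (\<phi>' t) \<le> c * norm (\<phi> t)" by blast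
  show ?thesis
  proof (rule linear_growth_zero[OF True, where \<phi>' = \<phi>' and C = c])
    show "norm (\<phi>' s) \<le> c * norm (\<phi> s)" "(\<phi> has_vector_derivative \<phi>' s) (at s)"
      if "s \<in> {t0..t}" for s
      using c d sub that by blast+
  qed fact
next
  case False
  have sub: "{t..t0} \<subseteq> I" using mem_is_interval_1_I[OF I t t0] by auto
  from C[OF sub] obtain c where c: "\<forall>t\<in>{t..t0}. norm (\<phi>' t) \<le> c * norm (\<phi> t)" by blast
  have "\<phi> (- (- t)) = 0"
  proof (rule linear_growth_zero[where a = "- t0" and b = "- t" and \<phi> = "\<lambda>s. \<phi> (- s)"
        and \<phi>' = "\<lambda>s. - \<phi>' (- s)" and C = c])
    show "- t0 \<le> - t" "\<phi> (- (- t0)) = 0" using False a by auto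
    fix s assume s: "s \<in> {-t0..-t}"
    show "norm (- \<phi>' (- s)) \<le> c * norm (\<phi> (- s))" using c s by simp
    have "(\<phi> has_vector_derivative \<phi>' (- s)) (at (- s))"
      by (rule d, rule subsetD[OF sub]) (use s in auto)
    then have "(\<phi> \<circ> uminus has_vector_derivative (-1) *\<^sub>R \<phi>' (- s)) (at s)"
      by (intro vector_diff_chain_at) (auto intro!: derivative_eq_intros)
    then show "((\<lambda>s. \<phi> (- s)) has_vector_derivative - \<phi>' (- s)) (at s)" by (simp add: o_def)
  qed
  then show ?thesis by simp
qed

section \<open>The flat scalar product\<close>

lemma ip_add_left: "ip \<epsilon> (x + y) z = ip \<epsilon> x z + ip \<epsilon> y z"
  and ip_add_right: "ip \<epsilon> z (x + y) = ip \<epsilon> z x + ip \<epsilon> z y"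
  and ip_diff_left: "ip \<epsilon> (x - y) z = ip \<epsilon> x z - ip \<epsilon> y z"
  and ip_diff_right: "ip \<epsilon> z (x - y) = ip \<epsilon> z x - ip \<epsilon> z y"
  and ip_minus_left: "ip \<epsilon> (- x) z = - ip \<epsilon> x z"
  and ip_minus_right: "ip \<epsilon> z (- x) = - ip \<epsilon> z x"
  and ip_scaleR_left: "ip \<epsilon> (c *\<^sub>R x) z = c * ip \<epsilon> x z"
  and ip_scaleR_right: "ip \<epsilon> z (c *\<^sub>R x) = c * ip \<epsilon> z x"
  and ip_zero_left: "ip \<epsilon> 0 z = 0"
  and ip_zero_right: "ip \<epsilon> z 0 = 0"
  by (simp_all add: ip_def algebra_simps inner_left_distrib inner_right_distrib inner_diff_left inner_diff_right)

lemmas ip_simps = ip_add_left ip_add_right ip_diff_left ip_diff_right ip_minus_left ip_minus_right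
  ip_scaleR_left ip_scaleR_right ip_zero_left ip_zero_right

lemma ip_commute: "ip \<epsilon> x y = ip \<epsilon> y x"
  by (simp add: ip_def inner_commute mult.commute)

lemma bounded_bilinear_ip: "bounded_bilinear (ip \<epsilon> :: 'n::finite amb \<Rightarrow> _)"
proof -
  have "bilinear (ip \<epsilon> :: 'n amb \<Rightarrow> _)"
    by (auto simp: bilinear_def linear_iff ip_simps)
  then show ?thesis by (simp add: bilinear_conv_bounded_bilinear)
qed

lemma ip_e_last: "ip \<epsilon> x e_last = snd (snd x)"
  by (simp add: ip_def e_last_def)

lemma ip_e_last_e_last: "ip \<epsilon> e_last e_last = 1"
  by (simp add: ip_def e_last_def)

lemma Q_part_eq: "Q_part x = x - ip \<epsilon> x e_last *\<^sub>R e_last"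
  by (simp add: Q_part_def e_last_def ip_def prod_eq_iff)

lemma linear_Q_part: "linear Q_part"
  by (auto simp: linear_iff Q_part_def)

lemma bounded_linear_Q_part: "bounded_linear (Q_part :: 'n::finite amb \<Rightarrow> _)"
  using linear_Q_part linear_conv_bounded_linear by blast

lemma ip_Q_part_e_last: "ip \<epsilon> (Q_part x) e_last = 0"
  by (simp add: ip_def e_last_def Q_part_def)

lemma ip_nondegenerate:
  assumes "\<epsilon> \<in> {-1, 1}" "\<And>y. ip \<epsilon> x y = 0"
  shows "x = 0"
proof -
  obtain a b t where x: "x = (a, b, t)" by (cases x)
  \<comment> \<open>Adjusting the sign of the first coordinate turns the product with
    \<open>x\<close> into its Euclidean squared norm.\<close>
  have "ip \<epsilon> x (\<epsilon> * a, b, t) = (\<epsilon> * \<epsilon>) * a\<^sup>2 + b \<bullet> b + t\<^sup>2" by (simp add: x ip_def power2_eq_square)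
  also have "\<epsilon> * \<epsilon> = 1" using assms(1) by auto
  finally have "a\<^sup>2 + b \<bullet> b + t\<^sup>2 = 0" using assms(2) by simp
  moreover have "a\<^sup>2 \<ge> 0" "b \<bullet> b \<ge> 0" "t\<^sup>2 \<ge> 0" by auto
  ultimately have "a\<^sup>2 = 0" "b \<bullet> b = 0" "t\<^sup>2 = 0" by linarith+
  then show ?thesis by (simp add: x zero_prod_def)
qed

lemma ip_eqI:
  assumes "\<epsilon> \<in> {-1, 1}" "\<And>y. ip \<epsilon> x y = ip \<epsilon> x' y"
  shows "x = x'"
  using ip_nondegenerate[OF assms(1), of "x - x'"] assms(2) by (simp add: ip_simps)

lemma QR_iff:
  "p \<in> QR \<epsilon> \<longleftrightarrow> ip \<epsilon> (Q_part p) (Q_part p) = \<epsilon> \<and> (\<epsilon> = -1 \<longrightarrow> fst p > 0)"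
  by (cases p) (auto simp: QR_def ip_def Q_part_def power2_eq_square)

text \<open>The complement of a timelike vector is spacelike, by Cauchy-Schwarz; for
  \<open>\<epsilon> = 1\<close> the product is Euclidean. So, even in the Lorentzian case, the
  metric of the surface and its normal spaces are positive definite.\<close>

lemma tangent_QR_positive:
  assumes "\<epsilon> \<in> {-1, 1}" "ip \<epsilon> (Q_part p) (Q_part p) = \<epsilon>" "ip \<epsilon> v (Q_part p) = 0" "v \<noteq> 0"
  shows "ip \<epsilon> v v > 0"
proof -
  obtain a b t where v: "v = (a, b, t)" by (cases v)
  obtain a' b' t' where p: "p = (a', b', t')" by (cases p)
  consider "\<epsilon> = 1" | "\<epsilon> = -1" using assms(1) by auto
  then show ?thesis
  proof cases
    case 1
    have "a\<^sup>2 + b \<bullet> b + t\<^sup>2 \<noteq> 0"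
    proof
      assume 0: "a\<^sup>2 + b \<bullet> b + t\<^sup>2 = 0"
      moreover have "a\<^sup>2 \<ge> 0" "b \<bullet> b \<ge> 0" "t\<^sup>2 \<ge> 0" by auto
      ultimately have "a\<^sup>2 = 0" "b \<bullet> b = 0" "t\<^sup>2 = 0" by linarith+
      then show False using assms(4) by (simp add: v zero_prod_def)
    qed
    moreover have "a\<^sup>2 + b \<bullet> b + t\<^sup>2 \<ge> 0" by simp
    ultimately have "a\<^sup>2 + b \<bullet> b + t\<^sup>2 > 0" by linarith
    moreover have "ip \<epsilon> v v = a\<^sup>2 + b \<bullet> b + t\<^sup>2" using 1 by (simp add: v ip_def power2_eq_square)
    ultimately show ?thesis by simp
  next
    case 2
    have 1: "a'\<^sup>2 = 1 + b' \<bullet> b'" and ab: "a * a' = b \<bullet> b'"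
      using assms(2,3) 2 by (simp_all add: v p ip_def Q_part_def power2_eq_square)
    have cs: "(b \<bullet> b')\<^sup>2 \<le> (b \<bullet> b) * (b' \<bullet> b')"
      using Cauchy_Schwarz_ineq[of b b'] by simp
    have "ip \<epsilon> v v = b \<bullet> b + t\<^sup>2 - a\<^sup>2" using 2 by (simp add: v ip_def power2_eq_square)
    moreover have False if le: "b \<bullet> b + t\<^sup>2 - a\<^sup>2 \<le> 0"
    proof -
      have "a\<^sup>2 * (1 + b' \<bullet> b') \<le> (b \<bullet> b) * (b' \<bullet> b')"
        using cs unfolding ab[symmetric] by (simp add: power_mult_distrib 1)
      also have "\<dots> \<le> a\<^sup>2 * (b' \<bullet> b')"
        by (rule mult_right_mono) (use le zero_le_power2[of t] in linarith, simp)
      finally have "a\<^sup>2 \<le> 0" by (simp add: algebra_simps)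
      then have "a\<^sup>2 = 0" by simp
      moreover have "b \<bullet> b \<ge> 0" "t\<^sup>2 \<ge> 0" by auto
      ultimately have "a\<^sup>2 = 0" "b \<bullet> b = 0" "t\<^sup>2 = 0" using le by linarith+
      then show False using assms(4) by (simp add: v zero_prod_def)
    qed
    ultimately show ?thesis by fastforce
  qed
qed

lemma has_derivative_ip:
  assumes "(F has_derivative F') (at u)" "(G has_derivative G') (at u)"
  shows "((\<lambda>u. ip \<epsilon> (F u) (G u)) has_derivative (\<lambda>v. ip \<epsilon> (F u) (G' v) + ip \<epsilon> (F' v) (G u))) (at u)"
  by (rule bounded_bilinear.FDERIV[OF bounded_bilinear_ip assms])

lemma D_ip:
  assumes "smooth_on U F" "smooth_on U G" "u \<in> U"
  shows "D (\<lambda>u. ip \<epsilon> (F u) (G u)) u v = ip \<epsilon> (F u) (D G u v) + ip \<epsilon> (D F u v) (G u)"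
  by (rule fun_cong[OF frechet_derivative_at[OF has_derivative_ip[OF
          smooth_on_has_derivative[OF assms(1,3)] smooth_on_has_derivative[OF assms(2,3)]], symmetric]])

text \<open>The source of most coefficients in the structure equations: a scalar product that is
  constant on the surface gives a linear relation between derivatives.\<close>

lemma D_ip_const:
  assumes "open U" "smooth_on U F" "smooth_on U G" "u \<in> U" "\<And>u. u \<in> U \<Longrightarrow> ip \<epsilon> (F u) (G u) = c"
  shows "ip \<epsilon> (F u) (D G u v) + ip \<epsilon> (D F u v) (G u) = 0"
proof -
  have "D (\<lambda>u. ip \<epsilon> (F u) (G u)) u = D (\<lambda>u. c) u"
    by (rule frechet_derivative_transform_within_open[OF _ assms(1,4)])
      (use has_derivative_ip[OF smooth_on_has_derivative[OF assms(2,4)] smooth_on_has_derivative[OF assms(3,4)]]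
       assms(5) in \<open>auto simp: differentiable_def\<close>)
  then show ?thesis using D_ip[OF assms(2,3,4), of \<epsilon> v] by simp
qed

lemma smooth_on_ip: "open U \<Longrightarrow> smooth_on U F \<Longrightarrow> smooth_on U G \<Longrightarrow> smooth_on U (\<lambda>u. ip \<epsilon> (F u) (G u))"
  by (rule smooth_on_bilinear[OF _ bounded_bilinear_ip])

section \<open>The second fundamental form in a chart\<close>

lemma vec2_eq: "(w :: real^2) = w $ 1 *\<^sub>R axis 1 1 + w $ 2 *\<^sub>R axis 2 1"
  by (simp add: vec_eq_iff forall_2 axis_def)

locale class_A_chart =
  fixes \<epsilon> :: real and x :: "real^2 \<Rightarrow> 'n::finite amb" and U :: "(real^2) set"
  assumes eps: "\<epsilon> \<in> {-1, 1}"
    and open_U: "open U"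
    and smooth_x: "smooth_on U x"
    and inj_D: "u \<in> U \<Longrightarrow> inj (D x u)"
    and in_QR: "u \<in> U \<Longrightarrow> x u \<in> QR \<epsilon>"
    and T_nonzero: "u \<in> U \<Longrightarrow> T_field \<epsilon> x u \<noteq> 0"
    and T_eigen: "u \<in> U \<Longrightarrow> \<zeta> \<in> normal_space \<epsilon> x u \<Longrightarrow>
      \<exists>c. shape_op \<epsilon> x u \<zeta> (T_field \<epsilon> x u) = c *\<^sub>R T_field \<epsilon> x u"
    and parallel_H: "u \<in> U \<Longrightarrow> normal_conn \<epsilon> x (mean_curv \<epsilon> x) u w = 0"
begin

abbreviation bp :: "'n amb \<Rightarrow> 'n amb \<Rightarrow> real" (infixl "\<odot>" 70) where
  "y \<odot> z \<equiv> ip \<epsilon> y z"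

abbreviation e :: "'n amb" where "e \<equiv> e_last"

definition q :: "real^2 \<Rightarrow> 'n amb" where "q u = Q_part (x u)"
definition dh :: "real^2 \<Rightarrow> real^2 \<Rightarrow> real" where "dh u w = D x u w \<odot> e"
text \<open>The coordinate pair of the height differential turned by a quarter, which spans the
  kernel of that differential. The formula is smooth on the whole chart, but its direction depends
  on the orientation of the coordinates.\<close>

definition r :: "real^2 \<Rightarrow> real^2" where
  "r u = dh u (axis 1 1) *\<^sub>R axis 2 1 - dh u (axis 2 1) *\<^sub>R axis 1 1"
definition \<xi> :: "real^2 \<Rightarrow> real^2" where
  "\<xi> u = (D x u (r u) \<odot> D x u (r u)) powr (-1/2) *\<^sub>R r u"
definition X :: "real^2 \<Rightarrow> 'n amb" where "X u = D x u (\<xi> u)"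
text \<open>The gradient of the height for the Euclidean metric of the coordinates, not for the
  induced one. It only has to be transverse to the level curves; the definition of \<open>s\<close>
  removes its part along \<open>X\<close>.\<close>

definition g0 :: "real^2 \<Rightarrow> real^2" where
  "g0 u = dh u (axis 1 1) *\<^sub>R axis 1 1 + dh u (axis 2 1) *\<^sub>R axis 2 1"

text \<open>With these fields \<open>X\<close> is a horizontal unit vector and \<open>S = T / |T|\<^sup>2\<close>,
  so that the height has derivative 1 along \<open>s\<close>.\<close>

definition s :: "real^2 \<Rightarrow> real^2" where
  "s u = (dh u (g0 u)) powr (-1) *\<^sub>R (g0 u - (D x u (g0 u) \<odot> X u) *\<^sub>R \<xi> u)"
definition S :: "real^2 \<Rightarrow> 'n amb" where "S u = D x u (s u)"
text \<open>Equal to 1/|T|^2, because \<open>T\<close> is \<open>s\<close> divided by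
  \<open>\<tau>\<close> (\<open>T_field_eq\<close>).\<close>

definition \<tau> :: "real^2 \<Rightarrow> real" where "\<tau> u = S u \<odot> S u"
definition W :: "real^2 \<Rightarrow> 'n amb" where "W u = D X u (\<xi> u)"
definition B :: "real^2 \<Rightarrow> 'n amb" where "B u = D S u (s u)"
definition H :: "real^2 \<Rightarrow> 'n amb" where "H = mean_curv \<epsilon> x"

lemma eps_sq: "\<epsilon> * \<epsilon> = 1" using eps by auto

lemma linear_D: "smooth_on U F \<Longrightarrow> u \<in> U \<Longrightarrow> linear (D F u)"
  using smooth_on_has_derivative[of U F u] has_derivative_bounded_linear bounded_linear.linear by blast

lemma smooth_q: "smooth_on U q"
  unfolding q_def by (rule smooth_on_bounded_linear[OF open_U bounded_linear_Q_part smooth_x])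

lemma D_q: "u \<in> U \<Longrightarrow> D q u w = D x u w - (D x u w \<odot> e) *\<^sub>R e"
  using fun_cong[OF frechet_derivative_at[OF bounded_linear.has_derivative[OF bounded_linear_Q_part
          smooth_on_has_derivative[OF smooth_x, of u]]], of w]
  by (simp add: q_def[abs_def] Q_part_eq[of _ \<epsilon>, symmetric])

lemma q_q: "u \<in> U \<Longrightarrow> q u \<odot> q u = \<epsilon>"
  using in_QR by (simp add: QR_iff q_def)

lemma q_e: "q u \<odot> e = 0"
  by (simp add: q_def ip_Q_part_e_last)

lemma Dx_q: assumes "u \<in> U" shows "D x u w \<odot> q u = 0"
proof -
  have "q u \<odot> D q u w + D q u w \<odot> q u = 0"
    by (rule D_ip_const[OF open_U smooth_q smooth_q assms q_q])
  then show ?thesis using q_e[of u] by (simp add: D_q[OF assms] ip_simps ip_commute[of _ "q u"] )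
qed

lemma tangent_pos: "u \<in> U \<Longrightarrow> v \<odot> q u = 0 \<Longrightarrow> v \<noteq> 0 \<Longrightarrow> v \<odot> v > 0"
  using tangent_QR_positive[OF eps, of "x u" v] q_q by (simp add: q_def)

lemma Dx_eq_0: "u \<in> U \<Longrightarrow> D x u w = 0 \<longleftrightarrow> w = 0"
  using inj_D linear_injective_0[OF linear_D[OF smooth_x]] linear_0[OF linear_D[OF smooth_x]] by metis

lemma Dx_pos: "u \<in> U \<Longrightarrow> w \<noteq> 0 \<Longrightarrow> D x u w \<odot> D x u w > 0"
  using tangent_pos Dx_q Dx_eq_0 by blast

text \<open>Two candidates differ by a tangent vector orthogonal to the whole tangent plane, which
  is zero because the induced metric is definite. This settles the definite description in
  \<open>tan_part\<close>.\<close>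

lemma tan_part_eqI:
  assumes u: "u \<in> U" and w: "\<And>h. (v - D x u w) \<odot> D x u h = 0"
  shows "tan_part \<epsilon> x u v = w"
  unfolding tan_part_def
proof (rule the_equality)
  fix w' assume w': "\<forall>h. (v - D x u w') \<odot> D x u h = 0"
  have "D x u (w - w') \<odot> D x u (w - w') = (v - D x u w') \<odot> D x u (w - w') - (v - D x u w) \<odot> D x u (w - w')"
    by (simp add: linear_diff[OF linear_D[OF smooth_x u]] ip_simps)
  also have "\<dots> = 0" using w w' by simp
  finally show "w' = w" using Dx_pos[OF u, of "w - w'"] by fastforce
qed (use w in blast)

lemma dh_vec: "u \<in> U \<Longrightarrow> dh u w = w $ 1 * dh u (axis 1 1) + w $ 2 * dh u (axis 2 1)"
  unfolding dh_def
  by (subst (1) vec2_eq) (simp add: linear_add[OF linear_D[OF smooth_x]] linear_scale[OF linear_D[OF smooth_x]] ip_simps)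

text \<open>Otherwise \<open>e\<close> would be normal to the surface and \<open>T\<close> would
  vanish, against class A.\<close>

lemma dh_axis_nz:
  assumes u: "u \<in> U" shows "dh u (axis 1 1) \<noteq> 0 \<or> dh u (axis 2 1) \<noteq> 0"
proof (rule ccontr)
  assume "\<not> ?thesis"
  then have "dh u w = 0" for w using dh_vec[OF u, of w] by simp
  then have "tan_part \<epsilon> x u e = 0"
    by (intro tan_part_eqI[OF u]) (simp add: linear_0[OF linear_D[OF smooth_x u]] dh_def ip_commute[of _ e])
  then show False using T_nonzero[OF u] by (simp add: T_field_def)
qed

lemma r_nz: "u \<in> U \<Longrightarrow> r u \<noteq> 0"
  using dh_axis_nz[of u] by (auto simp: r_def vec_eq_iff forall_2 axis_def)

lemma dh_r: "u \<in> U \<Longrightarrow> dh u (r u) = 0"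
  by (subst dh_vec) (simp_all add: r_def axis_def)

lemma dh_eq_0: assumes u: "u \<in> U" "dh u w = 0" shows "\<exists>k. w = k *\<^sub>R r u"
proof (cases "dh u (axis 1 1) = 0")
  case True
  then show ?thesis using dh_vec[OF u(1), of w] u dh_axis_nz[OF u(1)]
    by (intro exI[of _ "- w $ 1 / dh u (axis 2 1)"]) (simp add: r_def vec_eq_iff forall_2 axis_def)
next
  case False
  have "w $ 1 = - (w $ 2) * dh u (axis 2 1) / dh u (axis 1 1)"
    using dh_vec[OF u(1), of w] u False by (simp add: field_simps)
  then show ?thesis using False
    by (intro exI[of _ "w $ 2 / dh u (axis 1 1)"]) (simp add: r_def vec_eq_iff forall_2 axis_def)
qed

lemma dh_g0: "u \<in> U \<Longrightarrow> dh u (g0 u) > 0"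
  using dh_axis_nz[of u] by (subst dh_vec) (auto simp: g0_def axis_def not_sum_power2_lt_zero
      sum_power2_gt_zero_iff[unfolded power2_eq_square])

lemma smooth_dh: "smooth_on U (\<lambda>u. dh u w)"
  unfolding dh_def by (rule smooth_on_ip[OF open_U smooth_on_D[OF smooth_x] smooth_on_const[OF open_U]])

lemma smooth_r: "smooth_on U r"
  unfolding r_def
  by (rule smooth_on_diff[OF open_U smooth_on_scaleR[OF open_U smooth_dh smooth_on_const[OF open_U]]
        smooth_on_scaleR[OF open_U smooth_dh smooth_on_const[OF open_U]]])

lemma smooth_g0: "smooth_on U g0"
  unfolding g0_def
  by (rule smooth_on_add[OF open_U smooth_on_scaleR[OF open_U smooth_dh smooth_on_const[OF open_U]]
        smooth_on_scaleR[OF open_U smooth_dh smooth_on_const[OF open_U]]])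

lemma smooth_xi: "smooth_on U \<xi>"
  unfolding \<xi>_def
  by (rule smooth_on_scaleR[OF open_U smooth_on_powr[OF open_U Dx_pos[OF _ r_nz]
          smooth_on_ip[OF open_U smooth_on_D_field[OF open_U smooth_x smooth_r] smooth_on_D_field[OF open_U smooth_x smooth_r]]] smooth_r])

lemma smooth_X: "smooth_on U X"
  unfolding X_def by (rule smooth_on_D_field[OF open_U smooth_x smooth_xi])

lemma smooth_s: "smooth_on U s"
  unfolding s_def
proof (rule smooth_on_scaleR[OF open_U smooth_on_powr[OF open_U dh_g0]])
  show "smooth_on U (\<lambda>u. dh u (g0 u))"
    unfolding dh_def
    by (rule smooth_on_ip[OF open_U smooth_on_D_field[OF open_U smooth_x smooth_g0] smooth_on_const[OF open_U]])
  show "smooth_on U (\<lambda>u. g0 u - (D x u (g0 u) \<odot> X u) *\<^sub>R \<xi> u)"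
    by (rule smooth_on_diff[OF open_U smooth_g0 smooth_on_scaleR[OF open_U
          smooth_on_ip[OF open_U smooth_on_D_field[OF open_U smooth_x smooth_g0] smooth_X] smooth_xi]])
qed

lemma smooth_S: "smooth_on U S"
  unfolding S_def by (rule smooth_on_D_field[OF open_U smooth_x smooth_s])

lemma smooth_W: "smooth_on U W"
  unfolding W_def by (rule smooth_on_D_field[OF open_U smooth_X smooth_xi])

lemma smooth_B: "smooth_on U B"
  unfolding B_def by (rule smooth_on_D_field[OF open_U smooth_S smooth_s])

lemma X_X: assumes "u \<in> U" shows "X u \<odot> X u = 1"
proof -
  let ?\<rho> = "D x u (r u) \<odot> D x u (r u)"
  have pos: "?\<rho> > 0" by (rule Dx_pos[OF assms r_nz[OF assms]])
  have "X u \<odot> X u = ?\<rho> powr (-1/2) * (?\<rho> powr (-1/2) * ?\<rho>)"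
    by (simp add: X_def \<xi>_def linear_scale[OF linear_D[OF smooth_x assms]] ip_simps)
  also have "\<dots> = ?\<rho> powr (-1/2) * (?\<rho> powr (-1/2) * ?\<rho> powr 1)" using pos by simp
  also have "\<dots> = 1" using pos by (simp only: powr_add[symmetric]) simp
  finally show ?thesis .
qed

lemma dh_xi: assumes "u \<in> U" shows "dh u (\<xi> u) = 0"
  using dh_r[OF assms] unfolding \<xi>_def dh_def by (simp add: linear_scale[OF linear_D[OF smooth_x assms]] ip_simps)

lemma X_e: "u \<in> U \<Longrightarrow> X u \<odot> e = 0"
  using dh_xi by (simp add: dh_def X_def)

lemma X_q: "u \<in> U \<Longrightarrow> X u \<odot> q u = 0" unfolding X_def by (rule Dx_q)
lemma S_q: "u \<in> U \<Longrightarrow> S u \<odot> q u = 0" unfolding S_def by (rule Dx_q)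

lemma S_eq:
  assumes "u \<in> U"
  shows "S u = (dh u (g0 u)) powr (-1) *\<^sub>R (D x u (g0 u) - (D x u (g0 u) \<odot> X u) *\<^sub>R X u)"
  unfolding S_def s_def X_def using linear_D[OF smooth_x assms] by (simp add: linear_scale linear_diff)

lemma S_X: "u \<in> U \<Longrightarrow> S u \<odot> X u = 0"
  by (simp add: S_eq ip_simps X_X)

lemma S_e: assumes "u \<in> U" shows "S u \<odot> e = 1"
proof -
  have "S u \<odot> e = (dh u (g0 u)) powr (-1) * dh u (g0 u)"
    using assms by (simp add: S_eq ip_simps X_e dh_def)
  also have "\<dots> = (dh u (g0 u)) powr (-1) * dh u (g0 u) powr 1" using dh_g0[OF assms] by simp
  also have "\<dots> = 1" using dh_g0[OF assms] by (simp only: powr_add[symmetric]) simp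
  finally show ?thesis .
qed

lemma tau_pos: assumes "u \<in> U" shows "\<tau> u > 0"
proof -
  have "S u \<noteq> 0" using S_e[OF assms] by (auto simp: ip_simps)
  then show ?thesis unfolding \<tau>_def using tangent_pos[OF assms S_q[OF assms]] by blast
qed

text \<open>The coefficients in the frame \<open>S\<close>, \<open>X\<close> are read off by pairing
  with \<open>e\<close> and \<open>X\<close>: \<open>X\<close> is horizontal and
  \<open>S \<odot> e = 1\<close>, so \<open>e\<close> is dual to \<open>S\<close> without any factor
  \<open>\<tau>\<close>.\<close>

lemma Dx_expand:
  assumes u: "u \<in> U"
  shows "D x u w = (D x u w \<odot> e) *\<^sub>R S u + (D x u w \<odot> X u) *\<^sub>R X u"
    and "w = dh u w *\<^sub>R s u + (D x u w \<odot> X u) *\<^sub>R \<xi> u"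
proof -
  note lin = linear_D[OF smooth_x u]
  have nz: "(D x u (r u) \<odot> D x u (r u)) powr (-1/2) \<noteq> 0" using Dx_pos[OF u r_nz[OF u]] by simp
  have "dh u (w - dh u w *\<^sub>R s u) = 0"
    using S_e[OF u] by (simp add: dh_def S_def linear_diff[OF lin] linear_scale[OF lin] ip_simps)
  then obtain k where "w - dh u w *\<^sub>R s u = k *\<^sub>R r u" using dh_eq_0[OF u] by blast
  then have w: "w = dh u w *\<^sub>R s u + (k / (D x u (r u) \<odot> D x u (r u)) powr (-1/2)) *\<^sub>R \<xi> u"
    (is "_ = _ + ?k *\<^sub>R _") using nz by (simp add: \<xi>_def algebra_simps)
  have 1: "D x u w = dh u w *\<^sub>R S u + ?k *\<^sub>R X u"
    unfolding S_def X_def by (subst w) (simp add: linear_add[OF lin] linear_scale[OF lin])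
  then have k: "?k = D x u w \<odot> X u" by (simp add: ip_simps S_X[OF u] X_X[OF u])
  show "D x u w = (D x u w \<odot> e) *\<^sub>R S u + (D x u w \<odot> X u) *\<^sub>R X u"
    using 1 unfolding k by (simp add: dh_def)
  show "w = dh u w *\<^sub>R s u + (D x u w \<odot> X u) *\<^sub>R \<xi> u"
    using w unfolding k .
qed

lemma D_q_s: "u \<in> U \<Longrightarrow> D q u (s u) = S u - e"
  by (simp add: D_q S_def[symmetric] S_e)

lemma D_q_xi: "u \<in> U \<Longrightarrow> D q u (\<xi> u) = X u"
  by (simp add: D_q X_def[symmetric] X_e)

text \<open>Orthogonal projection to the normal space inside \<open>QR \<epsilon>\<close>. Written
  in the frame it is visibly linear and smooth, whereas \<open>nor_part\<close> rests on a definite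
  description; \<open>\<epsilon>\<close> stands for the inverse of
  \<open>q u \<odot> q u\<close>.\<close>

definition nrm :: "real^2 \<Rightarrow> 'n amb \<Rightarrow> 'n amb" where
  "nrm u y = y - (\<epsilon> * (y \<odot> q u)) *\<^sub>R q u - (y \<odot> X u) *\<^sub>R X u - (y \<odot> S u / \<tau> u) *\<^sub>R S u"

lemma linear_nrm: "linear (nrm u)"
  unfolding linear_iff nrm_def by (simp add: ip_simps algebra_simps add_divide_distrib)

lemma nrm_orth:
  assumes "u \<in> U"
  shows "nrm u y \<odot> q u = 0" "nrm u y \<odot> X u = 0" "nrm u y \<odot> S u = 0"
    and "q u \<odot> nrm u y = 0" "X u \<odot> nrm u y = 0" "S u \<odot> nrm u y = 0"
    and "nrm u y \<odot> D x u w = 0"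
proof -
  have \<tau>: "S u \<odot> S u = \<tau> u" "\<tau> u \<noteq> 0" using tau_pos[OF assms] by (auto simp: \<tau>_def)
  have sym: "X u \<odot> S u = 0" "q u \<odot> X u = 0" "q u \<odot> S u = 0"
    using S_X X_q S_q assms by (simp_all add: ip_commute)
  show 1: "nrm u y \<odot> q u = 0" "nrm u y \<odot> X u = 0" "nrm u y \<odot> S u = 0"
    using eps_sq by (simp_all add: nrm_def ip_simps S_X X_q S_q q_q X_X assms sym \<tau> mult.commute mult.left_commute)
  then show "q u \<odot> nrm u y = 0" "X u \<odot> nrm u y = 0" "S u \<odot> nrm u y = 0"
    by (simp_all add: ip_commute)
  show "nrm u y \<odot> D x u w = 0"
    by (subst Dx_expand(1)[OF assms]) (simp add: ip_simps 1)
qed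

lemma nrm_Dx: assumes "u \<in> U" shows "nrm u (D x u w) = 0"
proof -
  have \<tau>: "S u \<odot> S u = \<tau> u" "\<tau> u \<noteq> 0" using tau_pos[OF assms] by (auto simp: \<tau>_def)
  have sym: "X u \<odot> S u = 0" using S_X assms by (simp add: ip_commute)
  have "nrm u (S u) = 0" "nrm u (X u) = 0"
    using assms \<tau> sym by (simp_all add: nrm_def S_q X_q S_X X_X)
  then show ?thesis
    by (subst Dx_expand(1)[OF assms]) (simp add: linear_add[OF linear_nrm] linear_scale[OF linear_nrm])
qed

lemma nrm_eq_0:
  "nrm u y = 0 \<Longrightarrow> y = (\<epsilon> * (y \<odot> q u)) *\<^sub>R q u + (y \<odot> X u) *\<^sub>R X u + (y \<odot> S u / \<tau> u) *\<^sub>R S u"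
  by (simp add: nrm_def algebra_simps)

text \<open>The argument has the shape produced by \<open>cov_deriv\<close>, so this carries
  \<open>second_ff\<close> and \<open>normal_conn\<close> over to \<open>nrm\<close>.\<close>

lemma nor_part_proj:
  assumes "u \<in> U"
  shows "nor_part \<epsilon> x u (y - (\<epsilon> * (y \<odot> q u)) *\<^sub>R q u) = nrm u y"
proof -
  let ?v = "y - (\<epsilon> * (y \<odot> q u)) *\<^sub>R q u"
  have Dw: "D x u ((y \<odot> X u) *\<^sub>R \<xi> u + (y \<odot> S u / \<tau> u) *\<^sub>R s u) = (y \<odot> X u) *\<^sub>R X u + (y \<odot> S u / \<tau> u) *\<^sub>R S u"
    using linear_D[OF smooth_x assms] by (simp add: X_def S_def linear_add linear_scale)
  have "tan_part \<epsilon> x u ?v = (y \<odot> X u) *\<^sub>R \<xi> u + (y \<odot> S u / \<tau> u) *\<^sub>R s u"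
  proof (rule tan_part_eqI[OF assms])
    fix h
    have "?v - D x u ((y \<odot> X u) *\<^sub>R \<xi> u + (y \<odot> S u / \<tau> u) *\<^sub>R s u) = nrm u y"
      unfolding Dw by (simp add: nrm_def)
    then show "(?v - D x u ((y \<odot> X u) *\<^sub>R \<xi> u + (y \<odot> S u / \<tau> u) *\<^sub>R s u)) \<odot> D x u h = 0"
      using nrm_orth(7)[OF assms] by simp
  qed
  then show ?thesis unfolding nor_part_def by (simp add: Dw nrm_def)
qed

lemma T_field_eq: assumes "u \<in> U" shows "T_field \<epsilon> x u = (1 / \<tau> u) *\<^sub>R s u"
  unfolding T_field_def
proof (rule tan_part_eqI[OF assms])
  fix h
  have \<tau>: "S u \<odot> S u = \<tau> u" "\<tau> u \<noteq> 0" using tau_pos[OF assms] by (auto simp: \<tau>_def)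
  show "(e - D x u ((1 / \<tau> u) *\<^sub>R s u)) \<odot> D x u h = 0"
    using assms \<tau> S_e[OF assms] X_e[OF assms] S_X[OF assms]
    by (subst Dx_expand(1)[OF assms])
      (simp add: linear_scale[OF linear_D[OF smooth_x assms]] S_def[symmetric] ip_simps ip_commute[of _ e])
qed

section \<open>The second fundamental form and the mean curvature in the frame\<close>

definition D2 :: "real^2 \<Rightarrow> real^2 \<Rightarrow> real^2 \<Rightarrow> 'n amb" where
  "D2 u v w = D (\<lambda>u'. D x u' w) u v"

lemma D2_sym: "u \<in> U \<Longrightarrow> D2 u v w = D2 u w v"
  unfolding D2_def by (rule D2_symmetric[OF open_U smooth_x])

lemma D2_linear: assumes "u \<in> U" shows "linear (\<lambda>v. D2 u v w)" "linear (D2 u v)"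
proof -
  show 1: "linear (\<lambda>v. D2 u v w)" for w
    unfolding D2_def by (rule linear_D[OF smooth_on_D[OF smooth_x] assms])
  have "D2 u v = (\<lambda>w. D2 u w v)" using D2_sym[OF assms] by blast
  then show "linear (D2 u v)" using 1[of v] by simp
qed

lemma second_ff_eq: "u \<in> U \<Longrightarrow> second_ff \<epsilon> x u v w = nrm u (D2 u v w)"
  unfolding second_ff_def cov_deriv_def using nor_part_proj by (simp add: D2_def q_def)

text \<open>Tensoriality: differentiating the coefficients \<open>\<xi>\<close> only adds a tangent
  vector, which \<open>nrm\<close> annihilates.\<close>

lemma nrm_D_X: "u \<in> U \<Longrightarrow> nrm u (D X u v) = nrm u (D2 u v (\<xi> u))"
  using D_D_field[OF open_U smooth_x smooth_xi, of u v] nrm_Dx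
  by (simp add: X_def[abs_def] D2_def linear_add[OF linear_nrm])

lemma nrm_D_S: "u \<in> U \<Longrightarrow> nrm u (D S u v) = nrm u (D2 u v (s u))"
  using D_D_field[OF open_U smooth_x smooth_s, of u v] nrm_Dx
  by (simp add: S_def[abs_def] D2_def linear_add[OF linear_nrm])

text \<open>The use of class A. Let N be the second fundamental form on \<open>T\<close> and
  \<open>X\<close>. Its own shape operator, applied to \<open>T\<close> and paired with
  \<open>X\<close>, gives <N,N>, and also 0, because \<open>T\<close> is an eigenvector orthogonal
  to \<open>X\<close>. Normal spaces being definite, N = 0.\<close>

lemma nrm_D_s_X: assumes u: "u \<in> U" shows "nrm u (D X u (s u)) = 0"
proof -
  let ?T = "T_field \<epsilon> x u"
  define II where "II w = nrm u (D2 u ?T w)" for w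
  define N where "N = II (\<xi> u)"
  have linII: "linear II"
    unfolding II_def by (rule linear_compose[OF D2_linear(2)[OF u] linear_nrm, unfolded o_def])
  have \<tau>: "S u \<odot> S u = \<tau> u" "\<tau> u \<noteq> 0" using tau_pos[OF u] by (auto simp: \<tau>_def)
  note lin = linear_D[OF smooth_x u]
  have XS: "X u \<odot> S u = 0" using S_X[OF u] by (simp add: ip_commute)
  \<comment> \<open>The shape operator on \<open>T\<close> in the orthogonal frame \<open>X\<close>,
    \<open>S\<close>; dividing by \<open>\<tau>\<close> accounts for the square norm of
    \<open>S\<close>.\<close>
  define a0 where "a0 = (II (\<xi> u) \<odot> N) *\<^sub>R \<xi> u + (II (s u) \<odot> N / \<tau> u) *\<^sub>R s u"
  have Da0: "D x u a0 = (II (\<xi> u) \<odot> N) *\<^sub>R X u + (II (s u) \<odot> N / \<tau> u) *\<^sub>R S u"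
    by (simp add: a0_def X_def S_def linear_add[OF lin] linear_scale[OF lin])
  have a0: "induced_metric \<epsilon> x u a0 w = ip \<epsilon> (second_ff \<epsilon> x u ?T w) N" for w
  proof -
    have "II w = dh u w *\<^sub>R II (s u) + (D x u w \<odot> X u) *\<^sub>R II (\<xi> u)"
      by (subst Dx_expand(2)[OF u, of w]) (simp add: linear_add[OF linII] linear_scale[OF linII])
    then have "II w \<odot> N = dh u w * (II (s u) \<odot> N) + (D x u w \<odot> X u) * (II (\<xi> u) \<odot> N)"
      by (simp add: ip_simps)
    moreover have "D x u a0 \<odot> D x u w = dh u w * (II (s u) \<odot> N) + (D x u w \<odot> X u) * (II (\<xi> u) \<odot> N)"
      unfolding Da0 using \<tau> XS S_X[OF u] X_X[OF u]
      by (subst (1) Dx_expand(1)[OF u]) (simp add: ip_simps dh_def algebra_simps)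
    ultimately show ?thesis by (simp add: induced_metric_def second_ff_eq[OF u] II_def)
  qed
  have "shape_op \<epsilon> x u N ?T = a0"
    unfolding shape_op_def
  proof (rule the_equality)
    fix a assume a: "\<forall>w. induced_metric \<epsilon> x u a w = ip \<epsilon> (second_ff \<epsilon> x u ?T w) N"
    have "D x u (a - a0) \<odot> D x u (a - a0) = D x u a \<odot> D x u (a - a0) - D x u a0 \<odot> D x u (a - a0)"
      by (simp add: linear_diff[OF lin] ip_simps)
    also have "\<dots> = 0" using a a0 by (simp add: induced_metric_def)
    finally show "a = a0" using Dx_pos[OF u, of "a - a0"] by fastforce
  qed (use a0 in blast)
  moreover have "N \<in> normal_space \<epsilon> x u"
    using nrm_orth[OF u] by (simp add: N_def II_def normal_space_def tangent_QR_def q_def[symmetric])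
  ultimately obtain c where "a0 = c *\<^sub>R ?T" using T_eigen[OF u] by metis
  then have "D x u a0 \<odot> X u = 0"
    using S_X[OF u] by (simp add: T_field_eq[OF u] linear_scale[OF lin] S_def[symmetric] ip_simps)
  then have "N \<odot> N = 0"
    unfolding Da0 using S_X[OF u] X_X[OF u] by (simp add: ip_simps N_def)
  moreover have "N \<odot> q u = 0" using nrm_orth[OF u] by (simp add: N_def II_def)
  ultimately have "N = 0" using tangent_pos[OF u] by fastforce
  then have "nrm u (D2 u (s u) (\<xi> u)) = 0"
    using \<tau> unfolding N_def II_def T_field_eq[OF u]
    by (simp add: linear_scale[OF D2_linear(1)[OF u]] linear_scale[OF linear_nrm])
  then show ?thesis by (simp add: nrm_D_X[OF u])
qed

text \<open>The trace is taken over the orthonormal frame consisting of \<open>X\<close> and of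
  \<open>S\<close> divided by the root of \<open>\<tau>\<close>.\<close>

lemma H_eq: assumes u: "u \<in> U" shows "H u = (1/2) *\<^sub>R (nrm u (W u) + (1 / \<tau> u) *\<^sub>R nrm u (B u))"
proof -
  note lin = linear_D[OF smooth_x u]
  have \<tau>: "S u \<odot> S u = \<tau> u" "\<tau> u \<noteq> 0" using tau_pos[OF u] by (auto simp: \<tau>_def)
  \<comment> \<open>The inverse of a metric is the sum of the tensor squares of an orthonormal
    frame, here in coordinates.\<close>
  define M :: "real^2^2" where "M = (\<chi> i j. \<xi> u $ i * \<xi> u $ j + s u $ i * s u $ j / \<tau> u)"
  have Xv: "X u = \<xi> u $ 1 *\<^sub>R D x u (axis 1 1) + \<xi> u $ 2 *\<^sub>R D x u (axis 2 1)"
    unfolding X_def by (subst (1) vec2_eq[of "\<xi> u"]) (simp add: linear_add[OF lin] linear_scale[OF lin])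
  have Sv: "S u = s u $ 1 *\<^sub>R D x u (axis 1 1) + s u $ 2 *\<^sub>R D x u (axis 2 1)"
    unfolding S_def by (subst (1) vec2_eq[of "s u"]) (simp add: linear_add[OF lin] linear_scale[OF lin])
  have "M ** gram \<epsilon> x u = mat 1"
  proof -
    have "(M ** gram \<epsilon> x u) $ i $ k = (mat 1 :: real^2^2) $ i $ k" for i k
    proof -
      have "(M ** gram \<epsilon> x u) $ i $ k = \<xi> u $ i * (X u \<odot> D x u (axis k 1)) + s u $ i * (S u \<odot> D x u (axis k 1)) / \<tau> u"
        by (simp add: matrix_matrix_mult_def M_def gram_def induced_metric_def sum_2 Xv Sv ip_simps
            algebra_simps add_divide_distrib)
      also have "S u \<odot> D x u (axis k 1) = \<tau> u * dh u (axis k 1)"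
        by (subst Dx_expand(1)[OF u]) (simp add: ip_simps \<tau> S_X[OF u] dh_def)
      also have "\<xi> u $ i * (X u \<odot> D x u (axis k 1)) + s u $ i * (\<tau> u * dh u (axis k 1)) / \<tau> u
        = (dh u (axis k 1) *\<^sub>R s u + (D x u (axis k 1) \<odot> X u) *\<^sub>R \<xi> u) $ i"
        using \<tau> by (simp add: ip_commute[of _ "X u"])
      also have "\<dots> = axis k 1 $ i" using Dx_expand(2)[OF u, of "axis k 1"] by simp
      finally show ?thesis by (simp add: mat_def axis_def)
    qed
    then show ?thesis by (simp add: vec_eq_iff)
  qed
  then have MG: "M ** gram \<epsilon> x u = mat 1" "gram \<epsilon> x u ** M = mat 1"
    by (simp_all add: matrix_left_right_inverse)
  then have "gram \<epsilon> x u ** matrix_inv (gram \<epsilon> x u) = mat 1"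
    unfolding matrix_inv_def by (rule_tac someI2[of _ M]) auto
  then have M: "matrix_inv (gram \<epsilon> x u) = M"
    using MG(1) by (metis matrix_mul_assoc matrix_mul_lid matrix_mul_rid)
  let ?I = "\<lambda>i j. nrm u (D2 u (axis i 1) (axis j 1))"
  have quad: "nrm u (D2 u w w) = w $ 1 *\<^sub>R w $ 1 *\<^sub>R ?I 1 1 + w $ 1 *\<^sub>R w $ 2 *\<^sub>R ?I 1 2
     + w $ 2 *\<^sub>R w $ 1 *\<^sub>R ?I 2 1 + w $ 2 *\<^sub>R w $ 2 *\<^sub>R ?I 2 2" for w
    by (subst (1 2) vec2_eq[of w])
      (simp add: linear_add[OF D2_linear(1)[OF u]] linear_add[OF D2_linear(2)[OF u]] linear_scale[OF D2_linear(1)[OF u]]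
        linear_scale[OF D2_linear(2)[OF u]] linear_add[OF linear_nrm] linear_scale[OF linear_nrm] scaleR_add_right
        D2_sym[OF u, of "axis 2 1" "axis 1 1"] mult.commute)
  have "H u = (1/2) *\<^sub>R (nrm u (D2 u (\<xi> u) (\<xi> u)) + (1 / \<tau> u) *\<^sub>R nrm u (D2 u (s u) (s u)))"
    unfolding H_def mean_curv_def M second_ff_eq[OF u] quad[of "\<xi> u"] quad[of "s u"]
    by (simp add: sum_2 M_def algebra_simps scaleR_add_left)
  then show ?thesis by (simp add: W_def B_def nrm_D_X[OF u] nrm_D_S[OF u])
qed

end

section \<open>Structure equations\<close>

context class_A_chart
begin

lemma S_S: "S u \<odot> S u = \<tau> u" by (simp add: \<tau>_def)

lemma X_S: "u \<in> U \<Longrightarrow> X u \<odot> S u = 0" using S_X by (simp add: ip_commute)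

text \<open>Pairing with \<open>e\<close> isolates the \<open>S\<close> coefficient, since
  \<open>q\<close> and \<open>X\<close> are orthogonal to \<open>e\<close>. Products with the
  constant vector \<open>e\<close> are also the easiest to differentiate.\<close>

lemma nrm_eq_0_e:
  assumes u: "u \<in> U" and y: "nrm u y = 0"
  shows "y = (\<epsilon> * (y \<odot> q u)) *\<^sub>R q u + (y \<odot> X u) *\<^sub>R X u + (y \<odot> e) *\<^sub>R S u"
    and "y \<odot> S u = (y \<odot> e) * \<tau> u"
proof -
  have "y \<odot> e = (y \<odot> S u / \<tau> u)"
    by (subst nrm_eq_0[OF y]) (simp add: ip_simps S_e[OF u] X_e[OF u] q_e)
  then show "y = (\<epsilon> * (y \<odot> q u)) *\<^sub>R q u + (y \<odot> X u) *\<^sub>R X u + (y \<odot> e) *\<^sub>R S u"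
    "y \<odot> S u = (y \<odot> e) * \<tau> u"
    using nrm_eq_0[OF y] tau_pos[OF u] by simp_all
qed

lemma D_e_const:
  assumes "smooth_on U F" "u \<in> U" "\<And>u. u \<in> U \<Longrightarrow> F u \<odot> e = c"
  shows "D F u v \<odot> e = 0"
  using D_ip_const[OF open_U assms(1) smooth_on_const[OF open_U] assms(2,3), of v]
  by (simp add: ip_simps)

text \<open>Class A removes the normal component; the others vanish by differentiating the constant
  products of \<open>X\<close> with itself, \<open>q\<close> and \<open>e\<close>.\<close>

lemma D_s_X: assumes u: "u \<in> U" shows "D X u (s u) = 0"
proof -
  have "X u \<odot> D X u (s u) + D X u (s u) \<odot> X u = 0"
    by (rule D_ip_const[OF open_U smooth_X smooth_X u X_X])
  then have 1: "D X u (s u) \<odot> X u = 0" by (simp add: ip_commute)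
  have "X u \<odot> D q u (s u) + D X u (s u) \<odot> q u = 0"
    by (rule D_ip_const[OF open_U smooth_X smooth_q u X_q])
  then have 2: "D X u (s u) \<odot> q u = 0" using X_e[OF u] X_S[OF u] by (simp add: D_q_s[OF u] ip_simps)
  show ?thesis
    using nrm_eq_0_e(1)[OF u nrm_D_s_X[OF u]] 1 2 D_e_const[OF smooth_X u X_e, of "s u"] by simp
qed

lemma W_q: assumes u: "u \<in> U" shows "W u \<odot> q u = -1"
  using D_ip_const[OF open_U smooth_X smooth_q u X_q, of "\<xi> u"]
  by (simp add: W_def D_q_xi[OF u] X_X[OF u])

lemma W_X: assumes u: "u \<in> U" shows "W u \<odot> X u = 0"
  using D_ip_const[OF open_U smooth_X smooth_X u X_X, of "\<xi> u"]
  by (simp add: W_def ip_commute)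

lemma X_W: "u \<in> U \<Longrightarrow> X u \<odot> W u = 0" using W_X by (simp add: ip_commute)

lemma W_e: assumes u: "u \<in> U" shows "W u \<odot> e = 0"
  unfolding W_def by (rule D_e_const[OF smooth_X u X_e])

lemma B_e: assumes u: "u \<in> U" shows "B u \<odot> e = 0"
  unfolding B_def by (rule D_e_const[OF smooth_S u S_e])

lemma B_q: assumes u: "u \<in> U" shows "B u \<odot> q u = 1 - \<tau> u"
  using D_ip_const[OF open_U smooth_S smooth_q u S_q, of "s u"]
  by (simp add: B_def D_q_s[OF u] S_S S_e[OF u] ip_simps)

lemma B_X: assumes u: "u \<in> U" shows "B u \<odot> X u = 0"
  using D_ip_const[OF open_U smooth_S smooth_X u S_X, of "s u"]
  by (simp add: B_def D_s_X[OF u] ip_simps)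

text \<open>As \<open>X\<close> is constant along \<open>s\<close>, commuting derivatives of
  \<open>x\<close> shows that the derivative of \<open>S\<close> along \<open>\<xi>\<close> is minus
  the image of the bracket. It is thus tangent, and it is horizontal because
  \<open>S \<odot> e\<close> is constant; \<open>S \<odot> X = 0\<close> gives the factor.\<close>

lemma D_xi_S_bracket:
  assumes u: "u \<in> U"
  shows "D S u (\<xi> u) = - (W u \<odot> S u) *\<^sub>R X u"
    and "D \<xi> u (s u) - D s u (\<xi> u) = (W u \<odot> S u) *\<^sub>R \<xi> u"
proof -
  let ?b = "D \<xi> u (s u) - D s u (\<xi> u)"
  have b: "D x u ?b = - D S u (\<xi> u)"
    using D_commutator[OF open_U smooth_x smooth_xi smooth_s u]
    by (simp add: X_def[abs_def, symmetric] S_def[abs_def, symmetric] D_s_X[OF u])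
  have "nrm u (D S u (\<xi> u)) = 0"
    using nrm_Dx[OF u, of ?b] unfolding b by (simp add: linear_neg[OF linear_nrm])
  moreover have "D S u (\<xi> u) \<odot> q u = 0"
    using Dx_q[OF u, of ?b] unfolding b by (simp add: ip_simps)
  moreover have "D S u (\<xi> u) \<odot> e = 0" by (rule D_e_const[OF smooth_S u S_e])
  moreover have "D S u (\<xi> u) \<odot> X u = - (W u \<odot> S u)"
    using D_ip_const[OF open_U smooth_S smooth_X u S_X, of "\<xi> u"]
    by (simp add: W_def[symmetric] ip_commute)
  ultimately show 1: "D S u (\<xi> u) = - (W u \<odot> S u) *\<^sub>R X u"
    using nrm_eq_0_e(1)[OF u, of "D S u (\<xi> u)"] by simp
  have "D x u (?b - (W u \<odot> S u) *\<^sub>R \<xi> u) = 0"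
    using linear_D[OF smooth_x u] b 1 by (simp only: linear_diff linear_scale X_def) simp
  then show "?b = (W u \<odot> S u) *\<^sub>R \<xi> u" using Dx_eq_0[OF u] by simp
qed

text \<open>Commuting \<open>s\<close> and \<open>\<xi>\<close> on \<open>X\<close>: the derivative
  of \<open>X\<close> along \<open>s\<close> is zero, so only the bracket term survives.\<close>

lemma D_s_W: assumes u: "u \<in> U" shows "D W u (s u) = (W u \<odot> S u) *\<^sub>R W u"
proof -
  have "D (\<lambda>u. D X u (s u)) u = D (\<lambda>u. 0) u"
    by (rule frechet_derivative_transform_within_open[OF _ open_U u])
      (use smooth_on_has_derivative[OF smooth_on_D_field[OF open_U smooth_X smooth_s] u] D_s_X
       in \<open>auto simp: differentiable_def\<close>)
  then have "D W u (s u) = D X u ((W u \<odot> S u) *\<^sub>R \<xi> u)"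
    using D_commutator[OF open_U smooth_X smooth_xi smooth_s u]
    by (simp add: W_def[abs_def, symmetric] D_xi_S_bracket(2)[OF u])
  then show ?thesis by (simp add: linear_scale[OF linear_D[OF smooth_X u]] W_def)
qed

text \<open>The same commutation for \<open>S\<close> shows that this derivative is a multiple of
  \<open>X\<close>.\<close>

lemma D_xi_B: assumes u: "u \<in> U" shows "D B u (\<xi> u) = - (B u \<odot> W u) *\<^sub>R X u"
proof -
  let ?f = "\<lambda>u. - (W u \<odot> S u)"
  have smf: "smooth_on U ?f" by (rule smooth_on_minus[OF open_U smooth_on_ip[OF open_U smooth_W smooth_S]])
  have "D (\<lambda>u. D S u (\<xi> u)) u = D (\<lambda>u. ?f u *\<^sub>R X u) u"
    by (rule frechet_derivative_transform_within_open[OF _ open_U u])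
      (use smooth_on_has_derivative[OF smooth_on_D_field[OF open_U smooth_S smooth_xi] u] D_xi_S_bracket(1)
       in \<open>auto simp: differentiable_def\<close>)
  also have "\<dots> = (\<lambda>v. ?f u *\<^sub>R D X u v + D ?f u v *\<^sub>R X u)"
    by (rule frechet_derivative_at[symmetric], rule has_derivative_scaleR)
      (rule smooth_on_has_derivative[OF smf u] smooth_on_has_derivative[OF smooth_X u])+
  finally have "D (\<lambda>u. D S u (\<xi> u)) u (s u) = D ?f u (s u) *\<^sub>R X u" by (simp add: D_s_X[OF u])
  moreover have "D (\<lambda>u. D S u (\<xi> u)) u (s u) - D B u (\<xi> u) = D S u ((W u \<odot> S u) *\<^sub>R \<xi> u)"
    using D_commutator[OF open_U smooth_S smooth_xi smooth_s u]
    by (simp add: B_def[abs_def, symmetric] D_xi_S_bracket(2)[OF u])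
  ultimately have k: "D B u (\<xi> u) = (D ?f u (s u) + (W u \<odot> S u) * (W u \<odot> S u)) *\<^sub>R X u" (is "_ = ?k *\<^sub>R _")
    by (simp add: linear_scale[OF linear_D[OF smooth_S u]] D_xi_S_bracket(1)[OF u] algebra_simps)
  \<comment> \<open>The factor contains a derivative of \<open>W \<odot> S\<close>; its value is
    obtained by differentiating \<open>B \<odot> X = 0\<close> along \<open>\<xi>\<close>.\<close>
  have "B u \<odot> W u + D B u (\<xi> u) \<odot> X u = 0"
    using D_ip_const[OF open_U smooth_B smooth_X u B_X, of "\<xi> u"] by (simp add: W_def)
  then have "?k = - (B u \<odot> W u)" unfolding k by (simp add: ip_simps X_X[OF u])
  then show ?thesis using k by simp
qed

section \<open>The mean curvature vector and its derivatives\<close>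

lemma H_orth:
  assumes u: "u \<in> U"
  shows "H u \<odot> q u = 0" "H u \<odot> X u = 0" "H u \<odot> S u = 0"
  using nrm_orth[OF u] by (simp_all add: H_eq[OF u] ip_simps)

text \<open>The \<open>q\<close> coefficient collects \<open>W \<odot> q = -1\<close> and
  \<open>B \<odot> q = 1 - \<tau>\<close>. The projection gives some coefficient k of
  \<open>S\<close>; pairing with \<open>e\<close>, to which \<open>q\<close>, \<open>W\<close> and
  \<open>B\<close> are orthogonal, identifies it.\<close>

lemma two_H_eq:
  assumes u: "u \<in> U"
  shows "2 *\<^sub>R H u = W u + (1 / \<tau> u) *\<^sub>R B u + (\<epsilon> * (2 - 1 / \<tau> u)) *\<^sub>R q u + (2 * (H u \<odot> e)) *\<^sub>R S u"
proof -
  have \<tau>: "\<tau> u \<noteq> 0" using tau_pos[OF u] by simp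
  define k where "k = - (W u \<odot> S u) / \<tau> u - (B u \<odot> S u) / (\<tau> u * \<tau> u)"
  have 1: "2 *\<^sub>R H u = W u + (1 / \<tau> u) *\<^sub>R B u + (\<epsilon> * (2 - 1 / \<tau> u)) *\<^sub>R q u + k *\<^sub>R S u"
    using \<tau> by (simp add: H_eq[OF u] nrm_def W_q[OF u] B_q[OF u] W_X[OF u] B_X[OF u] k_def
        scaleR_diff_right scaleR_diff_left scaleR_add_left scaleR_add_right diff_divide_distrib algebra_simps)
      (simp add: scaleR_add_left[symmetric])
  have "2 * (H u \<odot> e) = (2 *\<^sub>R H u) \<odot> e" by (simp add: ip_simps)
  also have "\<dots> = k" unfolding 1 by (simp add: ip_simps W_e[OF u] B_e[OF u] q_e S_e[OF u])
  finally show ?thesis using 1 by simp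
qed

text \<open>Solving for \<open>B\<close> is what closes the system along \<open>s\<close>: the
  derivative of \<open>S\<close> is expressed by the state, with coefficients that are polynomial
  because \<open>\<tau>\<close> has been multiplied out.\<close>

lemma B_eq:
  assumes u: "u \<in> U"
  shows "B u = (\<tau> u) *\<^sub>R (2 *\<^sub>R H u - W u) - (2 * \<tau> u * (H u \<odot> e)) *\<^sub>R S u - (\<epsilon> * (2 * \<tau> u - 1)) *\<^sub>R q u"
  using tau_pos[OF u] unfolding two_H_eq[OF u] by (simp add: algebra_simps)

lemma smooth_inv_tau: "smooth_on U (\<lambda>u. 1 / \<tau> u)"
proof (rule smooth_on_cong[OF open_U])
  show "smooth_on U (\<lambda>u. \<tau> u powr (-1))"
    unfolding \<tau>_def using tau_pos
    by (intro smooth_on_powr open_U smooth_on_ip smooth_S) (simp add: \<tau>_def)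
qed (use tau_pos in \<open>auto simp: powr_minus_divide intro!: abs_of_pos\<close>)

lemma smooth_nrm: assumes "smooth_on U F" shows "smooth_on U (\<lambda>u. nrm u (F u))"
proof -
  have "smooth_on U (\<lambda>u. (\<epsilon> * (F u \<odot> q u)) *\<^sub>R q u)"
    by (intro smooth_on_scaleR smooth_on_mult smooth_on_const smooth_on_ip open_U assms smooth_q)
  moreover have "smooth_on U (\<lambda>u. (F u \<odot> X u) *\<^sub>R X u)"
    by (intro smooth_on_scaleR smooth_on_ip open_U assms smooth_X)
  moreover have "smooth_on U (\<lambda>u. ((F u \<odot> S u) * (1 / \<tau> u)) *\<^sub>R S u)"
    by (intro smooth_on_scaleR smooth_on_mult smooth_on_ip smooth_inv_tau open_U assms smooth_S)
  ultimately have "smooth_on U (\<lambda>u. F u - (\<epsilon> * (F u \<odot> q u)) *\<^sub>R q u - (F u \<odot> X u) *\<^sub>R X u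
     - ((F u \<odot> S u) * (1 / \<tau> u)) *\<^sub>R S u)"
    by (intro smooth_on_diff open_U assms)
  then show ?thesis by (simp add: nrm_def)
qed

lemma smooth_H: "smooth_on U H"
proof (rule smooth_on_cong[OF open_U])
  show "smooth_on U (\<lambda>u. (1/2) *\<^sub>R (nrm u (W u) + (1 / \<tau> u) *\<^sub>R nrm u (B u)))"
    by (rule smooth_on_scaleR[OF open_U smooth_on_const[OF open_U] smooth_on_add[OF open_U smooth_nrm[OF smooth_W]
        smooth_on_scaleR[OF open_U smooth_inv_tau smooth_nrm[OF smooth_B]]]])
qed (simp add: H_eq)

lemma nrm_D_H: "u \<in> U \<Longrightarrow> nrm u (D H u w) = 0"
  using parallel_H[of u w] nor_part_proj[of u "D H u w"]
  by (simp add: normal_conn_def cov_deriv_def H_def[symmetric] q_def)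

text \<open>Parallelism leaves components along \<open>q\<close>, \<open>X\<close>,
  \<open>S\<close>. They follow from the orthogonality of \<open>H\<close> to these vectors, whose
  derivatives along \<open>\<xi>\<close> are \<open>X\<close>, \<open>W\<close> and a multiple of
  \<open>X\<close>.\<close>

lemma D_xi_H: assumes u: "u \<in> U" shows "D H u (\<xi> u) = - (H u \<odot> W u) *\<^sub>R X u"
proof -
  let ?y = "D H u (\<xi> u)"
  have "H u \<odot> X u + ?y \<odot> q u = 0"
    using D_ip_const[OF open_U smooth_H smooth_q u H_orth(1), of "\<xi> u"] by (simp add: D_q_xi[OF u])
  then have 1: "?y \<odot> q u = 0" by (simp add: H_orth[OF u])
  have "H u \<odot> W u + ?y \<odot> X u = 0"
    using D_ip_const[OF open_U smooth_H smooth_X u H_orth(2), of "\<xi> u"] by (simp add: W_def)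
  then have 2: "?y \<odot> X u = - (H u \<odot> W u)" by simp
  have "?y \<odot> S u = 0"
    using D_ip_const[OF open_U smooth_H smooth_S u H_orth(3), of "\<xi> u"]
    by (simp add: D_xi_S_bracket(1)[OF u] ip_simps H_orth[OF u])
  then have "?y \<odot> e = 0" using nrm_eq_0_e(2)[OF u nrm_D_H[OF u], of "\<xi> u"] tau_pos[OF u] by simp
  then show ?thesis using nrm_eq_0_e(1)[OF u nrm_D_H[OF u], of "\<xi> u"] by (simp add: 1 2)
qed

lemma H_B: assumes u: "u \<in> U" shows "H u \<odot> B u = \<tau> u * (2 * (H u \<odot> H u) - H u \<odot> W u)"
  by (subst B_eq[OF u]) (simp add: ip_simps H_orth[OF u] algebra_simps)

text \<open>Along \<open>s\<close> the derivative of \<open>S\<close> is \<open>B\<close>, so the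
  \<open>S\<close> component is -<H,B> divided by \<open>\<tau>\<close>; \<open>H_B\<close>
  expresses it by \<open>H\<close> and \<open>W\<close>.\<close>

lemma D_s_H:
  assumes u: "u \<in> U"
  shows "D H u (s u) = (\<epsilon> * (H u \<odot> e)) *\<^sub>R q u - (2 * (H u \<odot> H u) - H u \<odot> W u) *\<^sub>R S u"
proof -
  let ?y = "D H u (s u)"
  have "H u \<odot> (S u - e) + ?y \<odot> q u = 0"
    using D_ip_const[OF open_U smooth_H smooth_q u H_orth(1), of "s u"] by (simp add: D_q_s[OF u])
  then have 1: "?y \<odot> q u = H u \<odot> e" by (simp add: H_orth[OF u] ip_simps)
  have 2: "?y \<odot> X u = 0"
    using D_ip_const[OF open_U smooth_H smooth_X u H_orth(2), of "s u"] by (simp add: D_s_X[OF u] ip_simps)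
  have "H u \<odot> B u + ?y \<odot> S u = 0"
    using D_ip_const[OF open_U smooth_H smooth_S u H_orth(3), of "s u"] by (simp add: B_def)
  then have "\<tau> u * (?y \<odot> e + (2 * (H u \<odot> H u) - H u \<odot> W u)) = 0"
    using nrm_eq_0_e(2)[OF u nrm_D_H[OF u], of "s u"] by (simp add: H_B[OF u] algebra_simps)
  then have "?y \<odot> e = - (2 * (H u \<odot> H u) - H u \<odot> W u)" using tau_pos[OF u] by simp
  then show ?thesis using nrm_eq_0_e(1)[OF u nrm_D_H[OF u], of "s u"] by (simp add: 1 2 scaleR_diff_left)
qed

text \<open>\<open>B_eq\<close> expresses \<open>\<tau> u *\<^sub>R W u\<close> by \<open>H\<close>,
  \<open>B\<close>, \<open>S\<close>, \<open>q\<close>. Along \<open>\<xi>\<close> these four have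
  derivatives proportional to \<open>X\<close> and the scalar coefficients are constant, so the
  derivative of \<open>W\<close> is a multiple of \<open>X\<close>; \<open>W \<odot> X = 0\<close>
  gives the factor. This makes the plane of \<open>X\<close> and \<open>W\<close> invariant along
  level curves.\<close>

lemma D_xi_W: assumes u: "u \<in> U" shows "D W u (\<xi> u) = - (W u \<odot> W u) *\<^sub>R X u"
proof -
  note d = smooth_on_has_derivative[OF _ u]
  have \<tau>0: "D \<tau> u (\<xi> u) = 0"
    using D_ip[OF smooth_S smooth_S u, of \<epsilon> "\<xi> u"] by (simp add: \<tau>_def[abs_def] D_xi_S_bracket(1)[OF u] ip_simps S_X[OF u] X_S[OF u])
  have He0: "D (\<lambda>u. H u \<odot> e) u (\<xi> u) = 0"
    using D_ip[OF smooth_H smooth_on_const[OF open_U] u, of \<epsilon> e "\<xi> u"]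
    by (simp add: D_xi_H[OF u] ip_simps X_e[OF u])
  have sm\<tau>: "smooth_on U \<tau>" unfolding \<tau>_def by (rule smooth_on_ip[OF open_U smooth_S smooth_S])
  have smHe: "smooth_on U (\<lambda>u. H u \<odot> e)" by (rule smooth_on_ip[OF open_U smooth_H smooth_on_const[OF open_U]])
  let ?G = "\<lambda>u. \<tau> u *\<^sub>R W u"
  have G: "?G u = (2 * \<tau> u) *\<^sub>R H u - B u - (2 * \<tau> u * (H u \<odot> e)) *\<^sub>R S u - (\<epsilon> * (2 * \<tau> u - 1)) *\<^sub>R q u"
    if "u \<in> U" for u by (subst B_eq[OF that]) (simp add: algebra_simps)
  have der: "(?G has_derivative (\<lambda>v. ((2 * \<tau> u) *\<^sub>R D H u v + (2 * D \<tau> u v) *\<^sub>R H u) - D B u v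
     - ((2 * \<tau> u * (H u \<odot> e)) *\<^sub>R D S u v
        + (2 * \<tau> u * D (\<lambda>u. H u \<odot> e) u v + 2 * D \<tau> u v * (H u \<odot> e)) *\<^sub>R S u)
     - ((\<epsilon> * (2 * \<tau> u - 1)) *\<^sub>R D q u v + (\<epsilon> * (2 * D \<tau> u v - 0)) *\<^sub>R q u))) (at u)"
    by (rule has_derivative_transform_within_open[OF _ open_U u G[symmetric]])
      (intro has_derivative_diff has_derivative_scaleR has_derivative_mult has_derivative_mult_right
        has_derivative_const d smooth_H smooth_B smooth_S smooth_q sm\<tau> smHe)
  have "((\<lambda>u. \<tau> u *\<^sub>R W u) has_derivative (\<lambda>v. \<tau> u *\<^sub>R D W u v + D \<tau> u v *\<^sub>R W u)) (at u)"
    by (intro has_derivative_scaleR d sm\<tau> smooth_W)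
  from fun_cong[OF has_derivative_unique[OF this der], of "\<xi> u"]
  have "\<exists>k. \<tau> u *\<^sub>R D W u (\<xi> u) = k *\<^sub>R X u"
    unfolding \<tau>0 He0 D_xi_H[OF u] D_xi_B[OF u] D_xi_S_bracket(1)[OF u] D_q_xi[OF u]
    by (auto intro!: exI simp: scaleR_add_left[symmetric] scaleR_diff_left[symmetric])
  then obtain k where k: "\<tau> u *\<^sub>R D W u (\<xi> u) = k *\<^sub>R X u" by blast
  have "D W u (\<xi> u) = (1 / \<tau> u) *\<^sub>R (\<tau> u *\<^sub>R D W u (\<xi> u))" using tau_pos[OF u] by simp
  also have "\<dots> = (k / \<tau> u) *\<^sub>R X u" unfolding k by simp
  finally have k': "D W u (\<xi> u) = (k / \<tau> u) *\<^sub>R X u" .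
  have "W u \<odot> W u + D W u (\<xi> u) \<odot> X u = 0"
    using D_ip_const[OF open_U smooth_W smooth_X u W_X, of "\<xi> u"] by (simp add: W_def[symmetric])
  then have "k / \<tau> u = - (W u \<odot> W u)" unfolding k' by (simp add: ip_simps X_X[OF u])
  then show ?thesis using k' by simp
qed

end

section \<open>The profile equation and its symmetries\<close>

lemma linear_growth_zero_continuous:
  fixes \<phi> :: "real \<Rightarrow> 'a::real_inner"
  assumes I: "is_interval I" and t0: "t0 \<in> I" and t: "t \<in> I"
    and C: "\<And>t. t \<in> I \<Longrightarrow> norm (\<phi>' t) \<le> C t * norm (\<phi> t)" and cont: "continuous_on I C"
    and d: "\<And>t. t \<in> I \<Longrightarrow> (\<phi> has_vector_derivative \<phi>' t) (at t)"
    and a: "\<phi> t0 = 0"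
  shows "\<phi> t = 0"
proof (rule linear_growth_zero_interval[OF I t0 t _ d a])
  fix a b assume ab: "{a..b} \<subseteq> I"
  have "bounded (C ` {a..b})"
    by (rule compact_imp_bounded[OF compact_continuous_image[OF continuous_on_subset[OF cont ab] compact_Icc]])
  then obtain M where M: "\<And>s. s \<in> {a..b} \<Longrightarrow> \<bar>C s\<bar> \<le> M"
    unfolding bounded_iff by (metis image_eqI real_norm_def)
  have "norm (\<phi>' s) \<le> M * norm (\<phi> s)" if "s \<in> {a..b}" for s
  proof -
    have "norm (\<phi>' s) \<le> C s * norm (\<phi> s)" using C ab that by blast
    also have "\<dots> \<le> M * norm (\<phi> s)" using M[OF that] by (intro mult_right_mono) auto
    finally show ?thesis .
  qed
  then show "\<exists>M. \<forall>s\<in>{a..b}. norm (\<phi>' s) \<le> M * norm (\<phi> s)" by blast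
qed

text \<open>The class contains the polynomial maps: it is closed under sums, pairs and bilinear
  operations, so \<open>profile_field\<close> is treated by following its formula. The constant may
  be negative, hence the absolute values in the estimates.\<close>

definition lipschitz_on_balls :: "('a::real_normed_vector \<Rightarrow> 'b::real_normed_vector) \<Rightarrow> bool" where
  "lipschitz_on_balls F \<longleftrightarrow>
     (\<forall>R. \<exists>C. \<forall>x y. norm x \<le> R \<longrightarrow> norm y \<le> R \<longrightarrow> norm (F x - F y) \<le> C * norm (x - y))"

lemma lipschitz_on_balls_const: "lipschitz_on_balls (\<lambda>x. c)"
  unfolding lipschitz_on_balls_def by (intro allI exI[of _ 0]) simp

lemma lipschitz_on_balls_linear:
  assumes "bounded_linear F" shows "lipschitz_on_balls F"
proof -
  obtain C where "\<And>x. norm (F x) \<le> norm x * C" using bounded_linear.bounded[OF assms] by blast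
  then have "norm (F x - F y) \<le> C * norm (x - y)" for x y
    using linear_diff[OF bounded_linear.linear[OF assms]] by (metis mult.commute)
  then show ?thesis unfolding lipschitz_on_balls_def by blast
qed

lemma lipschitz_on_balls_add:
  assumes "lipschitz_on_balls F" "lipschitz_on_balls G"
  shows "lipschitz_on_balls (\<lambda>x. F x + G x)"
  unfolding lipschitz_on_balls_def
proof
  fix R
  obtain C where C: "\<And>x y. norm x \<le> R \<Longrightarrow> norm y \<le> R \<Longrightarrow> norm (F x - F y) \<le> C * norm (x - y)"
    using assms(1) unfolding lipschitz_on_balls_def by blast
  obtain C' where C': "\<And>x y. norm x \<le> R \<Longrightarrow> norm y \<le> R \<Longrightarrow> norm (G x - G y) \<le> C' * norm (x - y)"
    using assms(2) unfolding lipschitz_on_balls_def by blast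
  have "norm (F x + G x - (F y + G y)) \<le> (C + C') * norm (x - y)" if "norm x \<le> R" "norm y \<le> R" for x y
  proof -
    have eq: "F x + G x - (F y + G y) = (F x - F y) + (G x - G y)" by simp
    show ?thesis
      unfolding eq distrib_right
      by (rule order_trans[OF norm_triangle_ineq add_mono[OF C[OF that] C'[OF that]]])
  qed
  then show "\<exists>C. \<forall>x y. norm x \<le> R \<longrightarrow> norm y \<le> R \<longrightarrow> norm (F x + G x - (F y + G y)) \<le> C * norm (x - y)"
    by blast
qed

lemma lipschitz_on_balls_bilinear:
  fixes F :: "'a::real_normed_vector \<Rightarrow> 'b::real_normed_vector"
  assumes B: "bounded_bilinear B" and F: "lipschitz_on_balls F" and G: "lipschitz_on_balls G"
  shows "lipschitz_on_balls (\<lambda>x. B (F x) (G x))"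
  unfolding lipschitz_on_balls_def
proof
  fix R
  obtain K where K: "K \<ge> 0" "\<And>a b. norm (B a b) \<le> norm a * norm b * K"
    using bounded_bilinear.nonneg_bounded[OF B] by blast
  obtain C where C: "\<And>x y. norm x \<le> R \<Longrightarrow> norm y \<le> R \<Longrightarrow> norm (F x - F y) \<le> C * norm (x - y)"
    using F unfolding lipschitz_on_balls_def by blast
  obtain C' where C': "\<And>x y. norm x \<le> R \<Longrightarrow> norm y \<le> R \<Longrightarrow> norm (G x - G y) \<le> C' * norm (x - y)"
    using G unfolding lipschitz_on_balls_def by blast
  define M where "M = norm (F 0) + \<bar>C\<bar> * R"
  define M' where "M' = norm (G 0) + \<bar>C'\<bar> * R"
  have M: "norm (F x) \<le> M" if "norm x \<le> R" for x
  proof -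
    have "norm (F x - F 0) \<le> C * norm x" using C[of x 0] that norm_ge_zero[of x] by auto
    also have "\<dots> \<le> \<bar>C\<bar> * R" using that by (intro mult_mono) auto
    finally show ?thesis using norm_triangle_sub[of "F x" "F 0"] by (simp add: M_def)
  qed
  have M': "norm (G x) \<le> M'" if "norm x \<le> R" for x
  proof -
    have "norm (G x - G 0) \<le> C' * norm x" using C'[of x 0] that norm_ge_zero[of x] by auto
    also have "\<dots> \<le> \<bar>C'\<bar> * R" using that by (intro mult_mono) auto
    finally show ?thesis using norm_triangle_sub[of "G x" "G 0"] by (simp add: M'_def)
  qed
  have "norm (B (F x) (G x) - B (F y) (G y)) \<le> (\<bar>C\<bar> * M' * K + M * \<bar>C'\<bar> * K) * norm (x - y)"
    if R: "norm x \<le> R" "norm y \<le> R" for x y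
  proof -
    have M0: "M \<ge> 0" "M' \<ge> 0" using M[OF R(1)] M'[OF R(1)] norm_ge_zero order_trans by blast+
    have "B (F x) (G x) - B (F y) (G y) = B (F x - F y) (G x) + B (F y) (G x - G y)"
      by (simp add: bounded_bilinear.diff_left[OF B] bounded_bilinear.diff_right[OF B])
    then have "norm (B (F x) (G x) - B (F y) (G y)) \<le> norm (B (F x - F y) (G x)) + norm (B (F y) (G x - G y))"
      by (metis norm_triangle_ineq)
    also have "\<dots> \<le> norm (F x - F y) * norm (G x) * K + norm (F y) * norm (G x - G y) * K"
      by (intro add_mono K)
    also have "\<dots> \<le> (\<bar>C\<bar> * norm (x - y)) * M' * K + M * (\<bar>C'\<bar> * norm (x - y)) * K"
    proof (intro add_mono mult_right_mono mult_mono)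
      show "norm (F x - F y) \<le> \<bar>C\<bar> * norm (x - y)"
        by (rule order_trans[OF C[OF R]], rule mult_right_mono) auto
      show "norm (G x - G y) \<le> \<bar>C'\<bar> * norm (x - y)"
        by (rule order_trans[OF C'[OF R]], rule mult_right_mono) auto
    qed (use M M' R K M0 in auto)
    finally show ?thesis by (simp add: algebra_simps)
  qed
  then show "\<exists>C. \<forall>x y. norm x \<le> R \<longrightarrow> norm y \<le> R \<longrightarrow> norm (B (F x) (G x) - B (F y) (G y)) \<le> C * norm (x - y)"
    by blast
qed

lemma lipschitz_on_balls_diff:
  assumes "lipschitz_on_balls F" "lipschitz_on_balls G"
  shows "lipschitz_on_balls (\<lambda>x. F x - G x)"
  using lipschitz_on_balls_add[OF assms(1) lipschitz_on_balls_bilinear[OF bounded_bilinear_scaleR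
        lipschitz_on_balls_const[of "-1"] assms(2)]] by simp

lemma bounded_linear_Pair_left: "bounded_linear (\<lambda>x. (x, 0))"
  and bounded_linear_Pair_right: "bounded_linear (\<lambda>x. (0, x))"
  by (intro bounded_linear_Pair bounded_linear_ident bounded_linear_zero)+

lemma lipschitz_on_balls_Pair:
  assumes F: "lipschitz_on_balls F" and G: "lipschitz_on_balls G"
  shows "lipschitz_on_balls (\<lambda>x. (F x, G x))"
  unfolding lipschitz_on_balls_def
proof
  fix R
  obtain C where C: "\<And>x y. norm x \<le> R \<Longrightarrow> norm y \<le> R \<Longrightarrow> norm (F x - F y) \<le> C * norm (x - y)"
    using F unfolding lipschitz_on_balls_def by blast
  obtain C' where C': "\<And>x y. norm x \<le> R \<Longrightarrow> norm y \<le> R \<Longrightarrow> norm (G x - G y) \<le> C' * norm (x - y)"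
    using G unfolding lipschitz_on_balls_def by blast
  have "norm ((F x, G x) - (F y, G y)) \<le> (C + C') * norm (x - y)" if "norm x \<le> R" "norm y \<le> R" for x y
    using norm_Pair_le[of "F x - F y" "G x - G y"] C[OF that] C'[OF that] by (simp add: distrib_right)
  then show "\<exists>C. \<forall>x y. norm x \<le> R \<longrightarrow> norm y \<le> R \<longrightarrow> norm ((F x, G x) - (F y, G y)) \<le> C * norm (x - y)"
    by blast
qed

lemma Ck_on_Pair:
  assumes S: "open S" and "Ck_on k S f" "Ck_on k S g"
  shows "Ck_on k S (\<lambda>x. (f x, g x))"
  using Ck_on_add[OF S Ck_on_bounded_linear[OF S bounded_linear_Pair_left assms(2)]
      Ck_on_bounded_linear[OF S bounded_linear_Pair_right assms(3)]] by simp

text \<open>A state collects the values of \<open>(q, S, W, H)\<close> along an integral curve of \<open>s\<close>,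
  and \<open>profile_field\<close> is the polynomial vector field that this curve integrates.\<close>

type_synonym 'n state = "'n amb \<times> 'n amb \<times> 'n amb \<times> 'n amb"

abbreviation pq :: "'n::finite state \<Rightarrow> 'n amb" where "pq Y \<equiv> fst Y"
abbreviation pS :: "'n::finite state \<Rightarrow> 'n amb" where "pS Y \<equiv> fst (snd Y)"
abbreviation pW :: "'n::finite state \<Rightarrow> 'n amb" where "pW Y \<equiv> fst (snd (snd Y))"
abbreviation pH :: "'n::finite state \<Rightarrow> 'n amb" where "pH Y \<equiv> snd (snd (snd Y))"

definition profile_field :: "real \<Rightarrow> 'n::finite state \<Rightarrow> 'n state" where
  "profile_field \<epsilon> Y =
    (pS Y - e_last,
     ip \<epsilon> (pS Y) (pS Y) *\<^sub>R (2 *\<^sub>R pH Y - pW Y)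
       - (2 * ip \<epsilon> (pS Y) (pS Y) * ip \<epsilon> (pH Y) e_last) *\<^sub>R pS Y
       - (\<epsilon> * (2 * ip \<epsilon> (pS Y) (pS Y) - 1)) *\<^sub>R pq Y,
     ip \<epsilon> (pW Y) (pS Y) *\<^sub>R pW Y,
     (\<epsilon> * ip \<epsilon> (pH Y) e_last) *\<^sub>R pq Y
       - (2 * ip \<epsilon> (pH Y) (pH Y) - ip \<epsilon> (pH Y) (pW Y)) *\<^sub>R pS Y)"

lemma bounded_linear_state:
  "bounded_linear (pq :: 'n::finite state \<Rightarrow> _)" "bounded_linear (pS :: 'n::finite state \<Rightarrow> _)"
  "bounded_linear (pW :: 'n::finite state \<Rightarrow> _)" "bounded_linear (pH :: 'n::finite state \<Rightarrow> _)"
  by (intro bounded_linear_fst bounded_linear_snd bounded_linear_fst_comp bounded_linear_snd_comp)+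

lemma lipschitz_profile_field: "lipschitz_on_balls (profile_field \<epsilon>)"
  unfolding profile_field_def
  by (intro lipschitz_on_balls_Pair lipschitz_on_balls_diff lipschitz_on_balls_const
    lipschitz_on_balls_bilinear[OF bounded_bilinear_scaleR] lipschitz_on_balls_bilinear[OF bounded_bilinear_mult]
    lipschitz_on_balls_bilinear[OF bounded_bilinear_ip] lipschitz_on_balls_linear bounded_linear_state)

lemma Ck_on_diff: "open S \<Longrightarrow> Ck_on k S f \<Longrightarrow> Ck_on k S g \<Longrightarrow> Ck_on k S (\<lambda>x. f x - g x)"
  unfolding diff_conv_add_uminus
  by (rule Ck_on_add, assumption, assumption,
      rule Ck_on_bounded_linear[OF _ bounded_linear_minus[OF bounded_linear_ident]])

lemma Ck_on_profile_field:
  assumes S: "open S" and Y: "Ck_on k S Y"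
  shows "Ck_on k S (\<lambda>t. profile_field \<epsilon> (Y t))"
  unfolding profile_field_def
  by (intro Ck_on_Pair[OF S] Ck_on_diff[OF S] Ck_on_const[OF S]
    Ck_on_bilinear[OF S bounded_bilinear_scaleR] Ck_on_bilinear[OF S bounded_bilinear_mult]
    Ck_on_bilinear[OF S bounded_bilinear_ip]
    Ck_on_bounded_linear[OF S bounded_linear_state(1) Y] Ck_on_bounded_linear[OF S bounded_linear_state(2) Y]
    Ck_on_bounded_linear[OF S bounded_linear_state(3) Y] Ck_on_bounded_linear[OF S bounded_linear_state(4) Y])

definition profile_solution :: "real \<Rightarrow> real set \<Rightarrow> (real \<Rightarrow> 'n::finite state) \<Rightarrow> bool" where
  "profile_solution \<epsilon> I Y \<longleftrightarrow> (\<forall>t\<in>I. (Y has_vector_derivative profile_field \<epsilon> (Y t)) (at t))"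

lemma profile_solution_continuous: "profile_solution \<epsilon> I Y \<Longrightarrow> continuous_on I Y"
  unfolding profile_solution_def
  by (auto intro!: continuous_at_imp_continuous_on has_vector_derivative_continuous)

text \<open>Over a compact interval both solutions stay in one ball, where the field is Lipschitz;
  so their difference has linear growth and vanishes with its value at \<open>t0\<close>.\<close>

lemma profile_solution_unique:
  assumes I: "is_interval I" and t0: "t0 \<in> I" and t: "t \<in> I"
    and Y: "profile_solution \<epsilon> I Y" and Z: "profile_solution \<epsilon> I Z" and eq: "Y t0 = Z t0"
  shows "Y t = Z t"
proof -
  have "(\<lambda>t. Y t - Z t) t = 0"
  proof (rule linear_growth_zero_interval[OF I t0 t])
    show "((\<lambda>t. Y t - Z t) has_vector_derivative profile_field \<epsilon> (Y t) - profile_field \<epsilon> (Z t)) (at t)"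
      if "t \<in> I" for t
      using Y Z that by (auto simp: profile_solution_def intro: has_vector_derivative_diff)
    show "Y t0 - Z t0 = 0" using eq by simp
    fix a b assume ab: "{a..b} \<subseteq> I"
    have "bounded (Y ` {a..b})" "bounded (Z ` {a..b})"
      using profile_solution_continuous[OF Y] profile_solution_continuous[OF Z] ab
      by (auto intro!: compact_imp_bounded compact_continuous_image intro: continuous_on_subset)
    then obtain R R' where R: "\<And>s. s \<in> {a..b} \<Longrightarrow> norm (Y s) \<le> R" "\<And>s. s \<in> {a..b} \<Longrightarrow> norm (Z s) \<le> R'"
      unfolding bounded_iff by (metis image_eqI)
    obtain C where C: "\<And>x y. norm x \<le> max R R' \<Longrightarrow> norm y \<le> max R R' \<Longrightarrow>
        norm (profile_field \<epsilon> x - profile_field \<epsilon> y :: 'a state) \<le> C * norm (x - y)"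
      using lipschitz_profile_field unfolding lipschitz_on_balls_def by blast
    have "norm (profile_field \<epsilon> (Y s) - profile_field \<epsilon> (Z s)) \<le> C * norm (Y s - Z s)" if "s \<in> {a..b}" for s
      by (rule C) (use R(1)[OF that] R(2)[OF that] in auto)
    then show "\<exists>C. \<forall>s\<in>{a..b}. norm (profile_field \<epsilon> (Y s) - profile_field \<epsilon> (Z s)) \<le> C * norm (Y s - Z s)"
      by blast
  qed
  then show ?thesis by simp
qed

text \<open>Bootstrapping: the derivative is a polynomial in the solution and inherits its
  differentiability class.\<close>

lemma profile_solution_smooth:
  assumes I: "open I" and Y: "profile_solution \<epsilon> I Y"
  shows "smooth_on I Y"
  unfolding smooth_on_def
proof
  fix k show "Ck_on k I Y"
  proof (induction k)
    case 0
    then show ?case using profile_solution_continuous[OF Y] by simp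
  next
    case (Suc k)
    show ?case
    proof (rule Ck_on_SucI[OF I])
      show "(Y has_derivative (\<lambda>v. v *\<^sub>R profile_field \<epsilon> (Y t))) (at t)" if "t \<in> I" for t
        using Y that by (simp add: profile_solution_def has_vector_derivative_def)
      show "Ck_on k I (\<lambda>t. v *\<^sub>R profile_field \<epsilon> (Y t))" for v
        by (rule Ck_on_bilinear[OF I bounded_bilinear_scaleR Ck_on_const[OF I] Ck_on_profile_field[OF I Suc]])
    qed
  qed
qed

section \<open>Linear isometries fixing a set pointwise, and their action on states\<close>

definition isometries_fixing :: "real \<Rightarrow> 'n::finite amb set \<Rightarrow> ('n amb \<Rightarrow> 'n amb) set" where
  "isometries_fixing \<epsilon> K = {L. linear L \<and> (\<forall>x y. ip \<epsilon> (L x) (L y) = ip \<epsilon> x y) \<and> (\<forall>y\<in>K. L y = y)}"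

lemma isometries_fixingI:
  assumes "linear L" "\<And>x y. ip \<epsilon> (L x) (L y) = ip \<epsilon> x y" "\<And>y. y \<in> K \<Longrightarrow> L y = y"
  shows "L \<in> isometries_fixing \<epsilon> K"
  unfolding isometries_fixing_def using assms by blast

lemma isometries_fixingD:
  assumes "L \<in> isometries_fixing \<epsilon> K"
  shows "linear L" "ip \<epsilon> (L x) (L y) = ip \<epsilon> x y" "y \<in> K \<Longrightarrow> L y = y"
  using assms unfolding isometries_fixing_def by blast+

lemma isometries_fixing_id: "(\<lambda>x. x) \<in> isometries_fixing \<epsilon> K"
  by (rule isometries_fixingI) (simp_all add: linear_iff)

lemma isometries_fixing_comp:
  assumes "L \<in> isometries_fixing \<epsilon> K" "L' \<in> isometries_fixing \<epsilon> K"
  shows "L \<circ> L' \<in> isometries_fixing \<epsilon> K"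
  by (rule isometries_fixingI)
    (simp_all add: linear_compose isometries_fixingD[OF assms(1)] isometries_fixingD[OF assms(2)])

lemma isometries_fixing_inverse:
  assumes eps: "\<epsilon> \<in> {-1, 1}" and L: "L \<in> isometries_fixing \<epsilon> K"
  obtains L' where "L' \<in> isometries_fixing \<epsilon> K" "\<And>x. L' (L x) = x" "\<And>x. L (L' x) = x"
proof -
  note lin = isometries_fixingD(1)[OF L] and iso = isometries_fixingD(2)[OF L]
    and fx = isometries_fixingD(3)[OF L]
  have "x = 0" if "L x = 0" for x
    by (rule ip_nondegenerate[OF eps]) (metis iso ip_zero_left that)
  then have "inj L" using linear_injective_0[OF lin] by blast
  then obtain L' where L': "linear L'" "\<And>x. L' (L x) = x" "\<And>x. L (L' x) = x"
    using linear_injective_isomorphism[OF lin] by blast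
  have "L' \<in> isometries_fixing \<epsilon> K"
    by (rule isometries_fixingI[OF L'(1)]) (use L' iso fx in metis)+
  then show thesis using that L' by blast
qed

definition map_state :: "('n::finite amb \<Rightarrow> 'n amb) \<Rightarrow> 'n state \<Rightarrow> 'n state" where
  "map_state L Y = (L (pq Y), L (pS Y), L (pW Y), L (pH Y))"

lemma map_state_comp: "map_state L (map_state L' Y) = map_state (L \<circ> L') Y"
  by (simp add: map_state_def)

lemma map_state_cancel: "(\<And>x. L' (L x) = x) \<Longrightarrow> map_state L' (map_state L Y) = Y"
  by (simp add: map_state_def)

lemma map_state_id: "map_state (\<lambda>x. x) Y = Y"
  by (simp add: map_state_def)

text \<open>The field is assembled from scalar products, linear combinations and
  \<open>e_last\<close>, all respected by an isometry that fixes \<open>e_last\<close>.\<close>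

lemma profile_field_equivariant:
  assumes L: "L \<in> isometries_fixing \<epsilon> K" and e: "e_last \<in> K"
  shows "profile_field \<epsilon> (map_state L Y) = map_state L (profile_field \<epsilon> Y)"
proof -
  note lin = isometries_fixingD(1)[OF L] and iso = isometries_fixingD(2)[OF L]
    and Le = isometries_fixingD(3)[OF L e]
  have "ip \<epsilon> (L x) e_last = ip \<epsilon> x e_last" for x using iso[of x e_last] by (simp add: Le)
  then show ?thesis
    by (simp add: profile_field_def map_state_def iso Le linear_diff[OF lin] linear_scale[OF lin])
qed

lemma profile_solution_map_state:
  assumes L: "L \<in> isometries_fixing \<epsilon> K" and e: "e_last \<in> K" and Y: "profile_solution \<epsilon> I Y"
  shows "profile_solution \<epsilon> I (\<lambda>t. map_state L (Y t))"
proof -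
  note lin = isometries_fixingD(1)[OF L]
  have "linear (map_state L)"
    unfolding linear_iff map_state_def by (simp add: linear_add[OF lin] linear_scale[OF lin])
  then have "bounded_linear (map_state L)" by (simp add: linear_conv_bounded_linear)
  then show ?thesis
    using Y bounded_linear.has_vector_derivative unfolding profile_solution_def profile_field_equivariant[OF L e]
    by blast
qed

text \<open>The map is \<open>1 + b R + c R\<^sup>2\<close> for the infinitesimal rotation \<open>R v = \<langle>v, X\<rangle> W - \<langle>v, W\<rangle> X\<close>;
  since \<open>R\<^sup>3 = - \<kappa> R\<close>, the condition on \<open>b\<close> and \<open>c\<close> says that it is an isometry. This form covers elliptic, parabolic
  and hyperbolic rotations at once.\<close>

lemma rotation_isometry:
  assumes XX: "ip \<epsilon> X X = 1" and XW: "ip \<epsilon> X W = 0" and WW: "ip \<epsilon> W W = \<kappa>" and bc: "2 * c = b\<^sup>2 + \<kappa> * c\<^sup>2"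
    and K: "\<And>y. y \<in> K \<Longrightarrow> ip \<epsilon> y X = 0 \<and> ip \<epsilon> y W = 0"
  shows "(\<lambda>v. v + (b * ip \<epsilon> v X - c * ip \<epsilon> v W) *\<^sub>R W - (b * ip \<epsilon> v W + c * \<kappa> * ip \<epsilon> v X) *\<^sub>R X)
    \<in> isometries_fixing \<epsilon> K" (is "?L \<in> _")
proof -
  have "linear ?L" unfolding linear_iff by (simp add: ip_simps algebra_simps)
  moreover have "ip \<epsilon> (?L v) (?L w) = ip \<epsilon> v w" for v w
  proof -
    let ?a = "ip \<epsilon> v X" and ?d = "ip \<epsilon> v W" and ?a' = "ip \<epsilon> w X" and ?d' = "ip \<epsilon> w W"
    have "ip \<epsilon> (?L v) (?L w) = ip \<epsilon> v w + (b\<^sup>2 + \<kappa> * c\<^sup>2 - 2 * c) * (?d * ?d' + \<kappa> * ?a * ?a')"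
      by (simp add: ip_simps XX XW WW ip_commute[of _ W X] ip_commute[of _ X w] ip_commute[of _ W w]
          algebra_simps power2_eq_square)
    then show ?thesis using bc by simp
  qed
  moreover have "?L y = y" if "y \<in> K" for y using K[OF that] by simp
  ultimately show ?thesis by (rule isometries_fixingI)
qed

section \<open>Adapted coordinates\<close>

context class_A_chart
begin

definition ht :: "real^2 \<Rightarrow> real" where "ht u = snd (snd (x u))"
text \<open>The orthogonal complement of the rotation plane; unlike \<open>X\<close>, it does not
  depend on the sign choice contained in \<open>\<xi>\<close>.\<close>

definition K :: "real^2 \<Rightarrow> 'n amb set" where "K u = {y. y \<odot> X u = 0 \<and> y \<odot> W u = 0}"
definition Y :: "real^2 \<Rightarrow> 'n state" where "Y u = (q u, S u, W u, H u)"

lemma ht_eq: "ht u = x u \<odot> e" by (simp add: ht_def ip_e_last)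

lemma x_eq: "x u = q u + ht u *\<^sub>R e" by (simp add: q_def Q_part_eq[of "x u" \<epsilon>] ht_eq)

lemma e_in_K: "u \<in> U \<Longrightarrow> e \<in> K u"
  using X_e W_e by (simp add: K_def ip_commute)

text \<open>Biduality for the plane of \<open>X\<close> and \<open>W\<close>, valid also when the
  plane is degenerate: any \<open>y\<close> is corrected to an element of \<open>K\<close> by
  multiples of \<open>X\<close> and \<open>q\<close>, because \<open>q\<close> pairs to 0 with
  \<open>X\<close> and to -1 with \<open>W\<close>.\<close>

lemma perp_K:
  assumes u: "u \<in> U" and z: "\<And>y. y \<in> K u \<Longrightarrow> y \<odot> z = 0"
  shows "z = (z \<odot> X u) *\<^sub>R X u - (z \<odot> q u) *\<^sub>R W u"
proof (rule ip_eqI[OF eps])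
  fix y
  have sym: "q u \<odot> X u = 0" "q u \<odot> W u = -1" using X_q[OF u] W_q[OF u] by (simp_all add: ip_commute)
  have "y - (y \<odot> X u) *\<^sub>R X u + (y \<odot> W u) *\<^sub>R q u \<in> K u"
    by (simp add: K_def ip_simps sym X_X[OF u] X_W[OF u])
  from z[OF this] show "z \<odot> y = ((z \<odot> X u) *\<^sub>R X u - (z \<odot> q u) *\<^sub>R W u) \<odot> y"
    by (simp add: ip_simps ip_commute[of _ z] ip_commute[of _ _ y] algebra_simps)
qed

lemma Y_profile_field: "u \<in> U \<Longrightarrow> (D q u (s u), D S u (s u), D W u (s u), D H u (s u)) = profile_field \<epsilon> (Y u)"
  by (simp add: profile_field_def Y_def D_q_s B_def[symmetric] B_eq D_s_W D_s_H S_S)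

text \<open>The height is constant along \<open>\<xi>\<close> and has derivative 1 along
  \<open>s\<close>. The second coordinate is constant along \<open>s\<close>, as \<open>X\<close>
  is, and has derivative \<open>W u \<odot> q u1\<close> along \<open>\<xi>\<close>, which is -1 at
  \<open>u1\<close>. Hence the inverse map straightens both families of curves.\<close>

definition \<Psi> :: "real^2 \<Rightarrow> real^2 \<Rightarrow> real^2" where
  "\<Psi> u1 u = ht u *\<^sub>R axis 1 1 + (X u \<odot> q u1) *\<^sub>R axis 2 1"

lemma smooth_ht: "smooth_on U ht"
  unfolding ht_eq by (rule smooth_on_ip[OF open_U smooth_x smooth_on_const[OF open_U]])

lemma D_ht: assumes u: "u \<in> U" shows "D ht u v = dh u v"
  using D_ip[OF smooth_x smooth_on_const[OF open_U] u, of \<epsilon> e v]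
  by (simp add: ht_eq[abs_def] dh_def ip_simps)

lemma smooth_Psi: "smooth_on U (\<Psi> u1)"
  unfolding \<Psi>_def
  by (intro smooth_on_add smooth_on_scaleR smooth_ht smooth_on_const open_U smooth_on_ip smooth_X)

lemma D_Psi: assumes u: "u \<in> U"
  shows "D (\<Psi> u1) u v = dh u v *\<^sub>R axis 1 1 + (D X u v \<odot> q u1) *\<^sub>R axis 2 1"
proof -
  have "(\<Psi> u1 has_derivative (\<lambda>v. (D ht u v) *\<^sub>R axis 1 1 + (X u \<odot> 0 + D X u v \<odot> q u1) *\<^sub>R axis 2 1)) (at u)"
    unfolding \<Psi>_def[abs_def]
    by (rule has_derivative_add has_derivative_scaleR_left has_derivative_ip smooth_on_has_derivative[OF _ u]
        smooth_ht smooth_X has_derivative_const)+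
  from fun_cong[OF frechet_derivative_at[OF this], of v] show ?thesis by (simp add: D_ht[OF u] ip_simps)
qed

lemma vec2_components: "(a *\<^sub>R axis 1 1 + b *\<^sub>R axis 2 1 :: real^2) $ 1 = a" "(a *\<^sub>R axis 1 1 + b *\<^sub>R axis 2 1 :: real^2) $ 2 = b"
  by (simp_all add: axis_def)

lemma vec2_eqD:
  assumes "a *\<^sub>R axis 1 1 + b *\<^sub>R axis 2 1 = (c *\<^sub>R axis 1 1 + d *\<^sub>R axis 2 1 :: real^2)"
  shows "a = c" "b = d"
  using assms vec2_components by metis+

text \<open>Coordinates in which the lines of constant second coordinate are integral curves of \<open>s\<close>
  parametrized by the height, and the lines of constant height are integral curves of a multiple of \<open>\<xi>\<close>.\<close>

lemma coordinates:
  assumes u1: "u1 \<in> U"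
  obtains \<delta> G N where "\<delta> > 0" "open N" "u1 \<in> N" "N \<subseteq> U"
    "\<And>t \<theta>. \<bar>t - ht u1\<bar> < \<delta> \<Longrightarrow> \<bar>\<theta>\<bar> < \<delta> \<Longrightarrow> G t \<theta> \<in> N \<and> ht (G t \<theta>) = t"
    "\<And>u. u \<in> N \<Longrightarrow> \<bar>ht u - ht u1\<bar> < \<delta> \<and> (\<exists>\<theta>. \<bar>\<theta>\<bar> < \<delta> \<and> u = G (ht u) \<theta>)"
    "G (ht u1) 0 = u1"
    "\<And>t \<theta>. \<bar>t - ht u1\<bar> < \<delta> \<Longrightarrow> \<bar>\<theta>\<bar> < \<delta> \<Longrightarrow>
       ((\<lambda>t. G t \<theta>) has_vector_derivative s (G t \<theta>)) (at t) \<and>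
       (G t has_vector_derivative (1 / (W (G t \<theta>) \<odot> q u1)) *\<^sub>R \<xi> (G t \<theta>)) (at \<theta>)"
    "\<And>u. u \<in> N \<Longrightarrow> W u \<odot> q u1 \<noteq> 0"
proof -
  define F' where "F' u = Blinfun (D (\<Psi> u1) u)" for u
  have bl: "bounded_linear (D (\<Psi> u1) u)" if "u \<in> U" for u
    using smooth_on_has_derivative[OF smooth_Psi that] has_derivative_bounded_linear by blast
  then have F': "blinfun_apply (F' u) = D (\<Psi> u1) u" if "u \<in> U" for u
    unfolding F'_def using that by (simp add: bounded_linear_Blinfun_apply)
  have der: "(\<Psi> u1 has_derivative blinfun_apply (F' u)) (at u)" if "u \<in> U" for u
    using smooth_on_has_derivative[OF smooth_Psi that] by (simp add: F'[OF that])
  have cont: "continuous_on U F'"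
  proof (rule continuous_on_blinfun_componentwise)
    fix i :: "real^2"
    show "continuous_on U (\<lambda>u. blinfun_apply (F' u) i)"
      by (rule continuous_on_eq[OF smooth_on_continuous[OF smooth_on_D[OF smooth_Psi, of u1 i]]]) (simp add: F')
  qed
  \<comment> \<open>The inverse of the derivative of \<open>\<Psi> u1\<close> at \<open>u1\<close>;
    the minus sign comes from \<open>W u1 \<odot> q u1 = -1\<close>.\<close>
  define inv0 where "inv0 = Blinfun (\<lambda>w::real^2. w $ 1 *\<^sub>R s u1 - w $ 2 *\<^sub>R \<xi> u1)"
  have "bounded_linear (\<lambda>w::real^2. w $ 1 *\<^sub>R s u1 - w $ 2 *\<^sub>R \<xi> u1)"
    by (intro bounded_linear_sub bounded_linear_scaleR_left[THEN bounded_linear_compose] bounded_linear_vec_nth)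
  then have inv0: "blinfun_apply inv0 = (\<lambda>w. w $ 1 *\<^sub>R s u1 - w $ 2 *\<^sub>R \<xi> u1)"
    unfolding inv0_def by (rule bounded_linear_Blinfun_apply)
  have "inv0 o\<^sub>L F' u1 = id_blinfun"
  proof (rule blinfun_eqI)
    fix v
    have "D X u1 v = dh u1 v *\<^sub>R D X u1 (s u1) + (D x u1 v \<odot> X u1) *\<^sub>R D X u1 (\<xi> u1)"
      using linear_D[OF smooth_X u1] by (subst Dx_expand(2)[OF u1, of v]) (simp add: linear_add linear_scale)
    then have "D X u1 v \<odot> q u1 = - (D x u1 v \<odot> X u1)"
      using D_s_X[OF u1] W_q[OF u1] by (simp add: ip_simps W_def[symmetric])
    then have "(D (\<Psi> u1) u1 v) $ 1 *\<^sub>R s u1 - (D (\<Psi> u1) u1 v) $ 2 *\<^sub>R \<xi> u1 = v"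
      unfolding D_Psi[OF u1] vec2_components using Dx_expand(2)[OF u1, of v] by simp
    then show "blinfun_apply (inv0 o\<^sub>L F' u1) v = blinfun_apply id_blinfun v"
      by (simp add: inv0 F'[OF u1])
  qed
  from inverse_function_theorem[OF open_U der cont u1 this]
  obtain U' V g g' where U': "open U'" "U' \<subseteq> U" "u1 \<in> U'" and V: "open V" "\<Psi> u1 u1 \<in> V"
    and hom: "homeomorphism U' V (\<Psi> u1) g" and dg: "\<And>y. y \<in> V \<Longrightarrow> (g has_derivative (g' y)) (at y)"
    and g': "\<And>y. y \<in> V \<Longrightarrow> g' y = inv (blinfun_apply (F' (g y)))"
    and bij: "\<And>y. y \<in> V \<Longrightarrow> bij (blinfun_apply (F' (g y)))" by blast
  let ?p = "\<lambda>t \<theta>. t *\<^sub>R axis 1 1 + \<theta> *\<^sub>R axis 2 1 :: real^2"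
  have Psi1: "\<Psi> u1 u1 = ?p (ht u1) 0" using X_q[OF u1] by (simp add: \<Psi>_def)
  obtain d where d: "d > 0" "ball (\<Psi> u1 u1) d \<subseteq> V" using V openE by blast
  \<comment> \<open>Both coordinate deviations stay below \<open>d / 2\<close>, so the triangle
    inequality puts the box inside the ball.\<close>
  define \<delta> where "\<delta> = d / 2"
  have box: "?p t \<theta> \<in> V" if "\<bar>t - ht u1\<bar> < \<delta>" "\<bar>\<theta>\<bar> < \<delta>" for t \<theta>
  proof -
    have "dist (?p (ht u1) 0) (?p t \<theta>) = norm ((ht u1 - t) *\<^sub>R axis 1 1 + (- \<theta>) *\<^sub>R axis 2 1 :: real^2)"
      by (simp add: dist_norm algebra_simps)
    also have "\<dots> \<le> \<bar>ht u1 - t\<bar> + \<bar>\<theta>\<bar>"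
      by (rule order_trans[OF norm_triangle_ineq]) (simp add: norm_axis_1)
    also have "\<dots> < d" using that unfolding \<delta>_def abs_minus_commute[of "ht u1"] by linarith
    finally show ?thesis using d(2) Psi1 by auto
  qed
  define G where "G t \<theta> = g (?p t \<theta>)" for t \<theta>
  define N where "N = {u \<in> U'. \<bar>ht u - ht u1\<bar> < \<delta> \<and> \<bar>X u \<odot> q u1\<bar> < \<delta>}"
  have sub: "N \<subseteq> U" using U' by (auto simp: N_def)
  have GU': "G t \<theta> \<in> U'" and GPsi: "\<Psi> u1 (G t \<theta>) = ?p t \<theta>" if "?p t \<theta> \<in> V" for t \<theta>
    using hom that by (auto simp: homeomorphism_def G_def)
  have Ght: "ht (G t \<theta>) = t" and GX: "X (G t \<theta>) \<odot> q u1 = \<theta>" if "?p t \<theta> \<in> V" for t \<theta>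
    using GPsi[OF that] vec2_eqD by (auto simp: \<Psi>_def)
  have Dxi: "D (\<Psi> u1) u (\<xi> u) = ?p 0 (W u \<odot> q u1)" if "u \<in> U" for u
    by (simp add: D_Psi[OF that] dh_xi[OF that] W_def)
  have Ds: "D (\<Psi> u1) u (s u) = ?p 1 0" if "u \<in> U" for u
    using S_e[OF that] by (simp add: D_Psi[OF that] D_s_X[OF that] ip_simps dh_def S_def)
  have NG: "\<bar>ht u - ht u1\<bar> < \<delta>" "\<bar>X u \<odot> q u1\<bar> < \<delta>" "u = G (ht u) (X u \<odot> q u1)" if "u \<in> N" for u
  proof -
    show "\<bar>ht u - ht u1\<bar> < \<delta>" "\<bar>X u \<odot> q u1\<bar> < \<delta>" using that by (auto simp: N_def)
    have "u \<in> U'" using that by (simp add: N_def)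
    then show "u = G (ht u) (X u \<odot> q u1)" using hom by (simp add: homeomorphism_def G_def \<Psi>_def[symmetric])
  qed
  have GN: "G t \<theta> \<in> N" if "\<bar>t - ht u1\<bar> < \<delta>" "\<bar>\<theta>\<bar> < \<delta>" for t \<theta>
    using that box[OF that] GU' Ght GX by (simp add: N_def)
  \<comment> \<open>The derivative of \<open>\<Psi> u1\<close> is bijective throughout the box and
    sends \<open>\<xi>\<close> to this number times the second axis vector.\<close>
  have Wnz: "W u \<odot> q u1 \<noteq> 0" if "u \<in> N" for u
  proof
    assume 0: "W u \<odot> q u1 = 0"
    have u: "u \<in> U" using that sub by blast
    let ?y = "?p (ht u) (X u \<odot> q u1)"
    have y: "?y \<in> V" using box NG[OF that] by blast
    have "inj (D (\<Psi> u1) u)" using bij[OF y] NG(3)[OF that] F'[OF u] by (simp add: G_def bij_is_inj)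
    moreover have "D (\<Psi> u1) u (\<xi> u) = D (\<Psi> u1) u 0"
      using 0 linear_0[OF linear_D[OF smooth_Psi u]] by (simp add: Dxi[OF u])
    ultimately have "\<xi> u = 0" by (simp add: inj_def)
    then have "X u = 0" using linear_0[OF linear_D[OF smooth_x u]] by (simp add: X_def)
    then show False using X_X[OF u] by (simp add: ip_simps)
  qed
  have der': "((\<lambda>t. G t \<theta>) has_vector_derivative s (G t \<theta>)) (at t)"
    "(G t has_vector_derivative (1 / (W (G t \<theta>) \<odot> q u1)) *\<^sub>R \<xi> (G t \<theta>)) (at \<theta>)"
    if tt: "\<bar>t - ht u1\<bar> < \<delta>" "\<bar>\<theta>\<bar> < \<delta>" for t \<theta>
  proof -
    let ?u = "G t \<theta>"
    have y: "?p t \<theta> \<in> V" by (rule box[OF tt])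
    have u: "?u \<in> U" using GN[OF tt] sub by blast
    have inj: "inj (D (\<Psi> u1) ?u)" using bij[OF y] F'[OF u] by (simp add: G_def bij_is_inj)
    have inv: "g' (?p t \<theta>) (D (\<Psi> u1) ?u v) = v" for v
      using inj g'[OF y] F'[OF u] by (simp add: G_def inv_f_f)
    have 1: "g' (?p t \<theta>) (axis 1 1) = s ?u" using inv[of "s ?u"] by (simp add: Ds[OF u])
    have "g' (?p t \<theta>) (axis 2 1) = g' (?p t \<theta>) (D (\<Psi> u1) ?u ((1 / (W ?u \<odot> q u1)) *\<^sub>R \<xi> ?u))"
      using Wnz[OF GN[OF tt]] by (simp add: linear_scale[OF linear_D[OF smooth_Psi u]] Dxi[OF u])
    then have 2: "g' (?p t \<theta>) (axis 2 1) = (1 / (W ?u \<odot> q u1)) *\<^sub>R \<xi> ?u" by (simp only: inv)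
    have lin: "linear (g' (?p t \<theta>))"
      using dg[OF y] has_derivative_bounded_linear bounded_linear.linear by blast
    have p1: "((\<lambda>t. ?p t \<theta>) has_derivative (\<lambda>h. h *\<^sub>R axis 1 1 + 0)) (at t)"
      by (rule has_derivative_add[OF has_derivative_scaleR_left[OF has_derivative_ident] has_derivative_const])
    have p2: "(?p t has_derivative (\<lambda>h. 0 + h *\<^sub>R axis 2 1)) (at \<theta>)"
      by (rule has_derivative_add[OF has_derivative_const has_derivative_scaleR_left[OF has_derivative_ident]])
    show "((\<lambda>t. G t \<theta>) has_vector_derivative s (G t \<theta>)) (at t)"
      using has_derivative_compose[OF p1 dg[OF y]]
      unfolding has_vector_derivative_def by (simp add: G_def[abs_def] linear_scale[OF lin] 1[unfolded G_def])
    show "(G t has_vector_derivative (1 / (W (G t \<theta>) \<odot> q u1)) *\<^sub>R \<xi> (G t \<theta>)) (at \<theta>)"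
      using has_derivative_compose[OF p2 dg[OF y]]
      unfolding has_vector_derivative_def by (simp add: G_def[abs_def] linear_scale[OF lin] 2[unfolded G_def])
  qed
  show thesis
  proof (rule that[of \<delta> N G])
    show "\<delta> > 0" using d by (simp add: \<delta>_def)
    show "open N"
    proof -
      have "continuous_on U' (\<lambda>u. (ht u, X u \<odot> q u1))"
        by (intro continuous_on_Pair continuous_on_subset[OF smooth_on_continuous U'(2)] smooth_ht
            smooth_on_ip open_U smooth_X smooth_on_const)
      then have "open (U' \<inter> (\<lambda>u. (ht u, X u \<odot> q u1)) -` ({ht u1 - \<delta><..<ht u1 + \<delta>} \<times> {-\<delta><..<\<delta>}))"
        by (intro continuous_open_preimage open_Times U' open_greaterThanLessThan)
      moreover have "N = U' \<inter> (\<lambda>u. (ht u, X u \<odot> q u1)) -` ({ht u1 - \<delta><..<ht u1 + \<delta>} \<times> {-\<delta><..<\<delta>})"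
        unfolding N_def by auto
      ultimately show ?thesis by simp
    qed
    show "u1 \<in> N" using U' d X_q[OF u1] by (simp add: N_def \<delta>_def)
    then show "G (ht u1) 0 = u1" using NG(3)[of u1] X_q[OF u1] by simp
    show "N \<subseteq> U" by (rule sub)
    show "G t \<theta> \<in> N \<and> ht (G t \<theta>) = t" if "\<bar>t - ht u1\<bar> < \<delta>" "\<bar>\<theta>\<bar> < \<delta>" for t \<theta>
      using GN[OF that] Ght[OF box[OF that]] by simp
    show "\<bar>ht u - ht u1\<bar> < \<delta> \<and> (\<exists>\<theta>. \<bar>\<theta>\<bar> < \<delta> \<and> u = G (ht u) \<theta>)" if "u \<in> N" for u
      using NG[OF that] by blast
    show "((\<lambda>t. G t \<theta>) has_vector_derivative s (G t \<theta>)) (at t) \<and>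
       (G t has_vector_derivative (1 / (W (G t \<theta>) \<odot> q u1)) *\<^sub>R \<xi> (G t \<theta>)) (at \<theta>)"
      if "\<bar>t - ht u1\<bar> < \<delta>" "\<bar>\<theta>\<bar> < \<delta>" for t \<theta>
      using der'[OF that] by blast
    show "W u \<odot> q u1 \<noteq> 0" if "u \<in> N" for u by (rule Wnz[OF that])
  qed
qed

end

locale class_A_box = class_A_chart \<epsilon> x U
  for \<epsilon> :: real and x :: "real^2 \<Rightarrow> 'n::finite amb" and U +
  fixes u1 :: "real^2" and \<delta> :: real and G :: "real \<Rightarrow> real \<Rightarrow> real^2" and N :: "(real^2) set"
  assumes delta: "\<delta> > 0" and open_N: "open N" and u1_N: "u1 \<in> N" and N_U: "N \<subseteq> U"
    and G_N: "\<And>t \<theta>. \<bar>t - ht u1\<bar> < \<delta> \<Longrightarrow> \<bar>\<theta>\<bar> < \<delta> \<Longrightarrow> G t \<theta> \<in> N \<and> ht (G t \<theta>) = t"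
    and N_G: "\<And>u. u \<in> N \<Longrightarrow> \<bar>ht u - ht u1\<bar> < \<delta> \<and> (\<exists>\<theta>. \<bar>\<theta>\<bar> < \<delta> \<and> u = G (ht u) \<theta>)"
    and G_u1: "G (ht u1) 0 = u1"
    and G_deriv: "\<And>t \<theta>. \<bar>t - ht u1\<bar> < \<delta> \<Longrightarrow> \<bar>\<theta>\<bar> < \<delta> \<Longrightarrow>
       ((\<lambda>t. G t \<theta>) has_vector_derivative s (G t \<theta>)) (at t) \<and>
       (G t has_vector_derivative (1 / (W (G t \<theta>) \<odot> q u1)) *\<^sub>R \<xi> (G t \<theta>)) (at \<theta>)"
    and W_q1: "\<And>u. u \<in> N \<Longrightarrow> W u \<odot> q u1 \<noteq> 0"
begin

definition J :: "real set" where "J = {ht u1 - \<delta><..<ht u1 + \<delta>}"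
definition c :: "real \<Rightarrow> real^2" where "c t = G t 0"

lemma J_iff: "t \<in> J \<longleftrightarrow> \<bar>t - ht u1\<bar> < \<delta>" by (auto simp: J_def)

lemma interval_J: "is_interval J" "open J" "is_interval {-\<delta><..<\<delta>}" by (simp_all add: J_def is_interval_oo)

lemma G_U: "t \<in> J \<Longrightarrow> \<theta> \<in> {-\<delta><..<\<delta>} \<Longrightarrow> G t \<theta> \<in> U" using G_N N_U by (auto simp: J_iff abs_less_iff)

lemma s_line:
  assumes F: "smooth_on U F" and t: "t \<in> J" "\<theta> \<in> {-\<delta><..<\<delta>}"
  shows "((\<lambda>t. F (G t \<theta>)) has_vector_derivative D F (G t \<theta>) (s (G t \<theta>))) (at t)"
proof -
  have "((\<lambda>t. G t \<theta>) has_derivative (\<lambda>h. h *\<^sub>R s (G t \<theta>))) (at t)"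
    using G_deriv[of t \<theta>] t by (auto simp: has_vector_derivative_def J_iff abs_less_iff)
  from has_derivative_compose[OF this smooth_on_has_derivative[OF F G_U[OF t]]]
  show ?thesis
    unfolding has_vector_derivative_def by (simp add: linear_scale[OF linear_D[OF F G_U[OF t]]])
qed

lemma xi_line:
  assumes F: "smooth_on U F" and t: "t \<in> J" "\<theta> \<in> {-\<delta><..<\<delta>}"
  shows "((\<lambda>\<theta>. F (G t \<theta>)) has_vector_derivative (1 / (W (G t \<theta>) \<odot> q u1)) *\<^sub>R D F (G t \<theta>) (\<xi> (G t \<theta>))) (at \<theta>)"
proof -
  let ?k = "1 / (W (G t \<theta>) \<odot> q u1)"
  have "(G t has_derivative (\<lambda>h. h *\<^sub>R (?k *\<^sub>R \<xi> (G t \<theta>)))) (at \<theta>)"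
    using G_deriv[of t \<theta>] t by (auto simp: has_vector_derivative_def J_iff abs_less_iff)
  from has_derivative_compose[OF this smooth_on_has_derivative[OF F G_U[OF t]]]
  show ?thesis
    unfolding has_vector_derivative_def by (simp add: linear_scale[OF linear_D[OF F G_U[OF t]]])
qed

lemma xi_const:
  fixes F :: "real^2 \<Rightarrow> 'b::real_inner"
  assumes F: "smooth_on U F" and F0: "\<And>u. u \<in> U \<Longrightarrow> D F u (\<xi> u) = 0"
    and t: "t \<in> J" "\<theta> \<in> {-\<delta><..<\<delta>}" "\<theta>' \<in> {-\<delta><..<\<delta>}"
  shows "F (G t \<theta>) = F (G t \<theta>')"
proof -
  have "(\<lambda>\<theta>. F (G t \<theta>) - F (G t \<theta>')) \<theta> = 0"
  proof (rule linear_growth_zero_continuous[OF interval_J(3) t(3,2), where C = "\<lambda>_. 0" and \<phi>' = "\<lambda>_. 0"])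
    show "((\<lambda>\<theta>. F (G t \<theta>) - F (G t \<theta>')) has_vector_derivative 0) (at \<theta>)" if "\<theta> \<in> {-\<delta><..<\<delta>}" for \<theta>
      using has_vector_derivative_diff[OF xi_line[OF F t(1) that] has_vector_derivative_const] F0[OF G_U[OF t(1) that]]
      by simp
  qed simp_all
  then show ?thesis by simp
qed

lemma X_s_line:
  assumes t: "t \<in> J" "t' \<in> J" "\<theta> \<in> {-\<delta><..<\<delta>}"
  shows "X (G t \<theta>) = X (G t' \<theta>)"
proof -
  have "(\<lambda>t. X (G t \<theta>) - X (G t' \<theta>)) t = 0"
  proof (rule linear_growth_zero_continuous[OF interval_J(1) t(2,1), where C = "\<lambda>_. 0" and \<phi>' = "\<lambda>_. 0"])
    show "((\<lambda>t. X (G t \<theta>) - X (G t' \<theta>)) has_vector_derivative 0) (at t)" if "t \<in> J" for t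
      using has_vector_derivative_diff[OF s_line[OF smooth_X that t(3)] has_vector_derivative_const] D_s_X[OF G_U[OF that t(3)]]
      by simp
  qed simp_all
  then show ?thesis by simp
qed

text \<open>Along \<open>s\<close> the vector \<open>X\<close> is constant and the derivative of
  \<open>W\<close> is a multiple of \<open>W\<close>, so \<open>y \<odot> W\<close> solves a scalar
  linear equation and stays zero.\<close>

lemma K_s_line:
  assumes t: "t \<in> J" "t' \<in> J" "\<theta> \<in> {-\<delta><..<\<delta>}"
  shows "K (G t \<theta>) \<subseteq> K (G t' \<theta>)"
proof
  fix y assume y: "y \<in> K (G t \<theta>)"
  have sm: "smooth_on U (\<lambda>u. y \<odot> W u)" by (rule smooth_on_ip[OF open_U smooth_on_const[OF open_U] smooth_W])
  have "(\<lambda>t. y \<odot> W (G t \<theta>)) t' = 0"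
  proof (rule linear_growth_zero_continuous[OF interval_J(1) t(1,2), where C = "\<lambda>t. \<bar>W (G t \<theta>) \<odot> S (G t \<theta>)\<bar>"
        and \<phi>' = "\<lambda>t. (W (G t \<theta>) \<odot> S (G t \<theta>)) * (y \<odot> W (G t \<theta>))"])
    show "((\<lambda>t. y \<odot> W (G t \<theta>)) has_vector_derivative (W (G t \<theta>) \<odot> S (G t \<theta>)) * (y \<odot> W (G t \<theta>))) (at t)"
      if "t \<in> J" for t
      using s_line[OF sm that t(3)] D_ip[OF smooth_on_const[OF open_U] smooth_W G_U[OF that t(3)], of \<epsilon> y "s (G t \<theta>)"]
      by (simp add: D_s_W[OF G_U[OF that t(3)]] ip_simps)
    have smc: "smooth_on U (\<lambda>u. W u \<odot> S u)" by (rule smooth_on_ip[OF open_U smooth_W smooth_S])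
    show "continuous_on J (\<lambda>t. \<bar>W (G t \<theta>) \<odot> S (G t \<theta>)\<bar>)"
      using s_line[OF smc _ t(3)]
      by (intro continuous_on_rabs continuous_at_imp_continuous_on ballI) (rule has_vector_derivative_continuous)
  qed (use y in \<open>auto simp: K_def abs_mult\<close>)
  then show "y \<in> K (G t' \<theta>)" using y X_s_line[OF t] by (simp add: K_def)
qed

text \<open>Along \<open>\<xi>\<close> the derivatives of \<open>X\<close> and \<open>W\<close> are
  \<open>W\<close> and a multiple of \<open>X\<close>, so the two products with \<open>y\<close>
  solve a homogeneous linear system.\<close>

lemma K_xi_line:
  assumes t: "t \<in> J" "\<theta> \<in> {-\<delta><..<\<delta>}" "\<theta>' \<in> {-\<delta><..<\<delta>}"
  shows "K (G t \<theta>) \<subseteq> K (G t \<theta>')"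
proof
  fix y assume y: "y \<in> K (G t \<theta>)"
  have sm: "smooth_on U (\<lambda>u. y \<odot> W u)" "smooth_on U (\<lambda>u. y \<odot> X u)"
    by (rule smooth_on_ip[OF open_U smooth_on_const[OF open_U]], rule smooth_W smooth_X)+
  let ?k = "\<lambda>\<theta>. 1 / (W (G t \<theta>) \<odot> q u1)" and ?\<kappa> = "\<lambda>\<theta>. W (G t \<theta>) \<odot> W (G t \<theta>)"
  have cont: "continuous_on {-\<delta><..<\<delta>} (\<lambda>\<theta>. F (G t \<theta>))" if "smooth_on U F" for F :: "real^2 \<Rightarrow> real"
    using xi_line[OF that t(1)] by (intro continuous_at_imp_continuous_on ballI) (rule has_vector_derivative_continuous)
  have "(\<lambda>\<theta>. (y \<odot> X (G t \<theta>), y \<odot> W (G t \<theta>))) \<theta>' = 0"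
  proof (rule linear_growth_zero_continuous[OF interval_J(3) t(2,3), where C = "\<lambda>\<theta>. \<bar>?k \<theta>\<bar> * (1 + \<bar>?\<kappa> \<theta>\<bar>)"
        and \<phi>' = "\<lambda>\<theta>. ?k \<theta> *\<^sub>R (y \<odot> W (G t \<theta>), - (?\<kappa> \<theta> * (y \<odot> X (G t \<theta>))))"])
    fix \<theta> assume th: "\<theta> \<in> {-\<delta><..<\<delta>}"
    note u = G_U[OF t(1) th]
    have X: "D (\<lambda>u. y \<odot> X u) (G t \<theta>) (\<xi> (G t \<theta>)) = y \<odot> W (G t \<theta>)"
      using D_ip[OF smooth_on_const[OF open_U] smooth_X u, of \<epsilon> y "\<xi> (G t \<theta>)"] by (simp add: W_def ip_simps)
    have W: "D (\<lambda>u. y \<odot> W u) (G t \<theta>) (\<xi> (G t \<theta>)) = - (?\<kappa> \<theta> * (y \<odot> X (G t \<theta>)))"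
      using D_ip[OF smooth_on_const[OF open_U] smooth_W u, of \<epsilon> y "\<xi> (G t \<theta>)"] by (simp add: D_xi_W[OF u] ip_simps)
    show "((\<lambda>\<theta>. (y \<odot> X (G t \<theta>), y \<odot> W (G t \<theta>))) has_vector_derivative
        ?k \<theta> *\<^sub>R (y \<odot> W (G t \<theta>), - (?\<kappa> \<theta> * (y \<odot> X (G t \<theta>))))) (at \<theta>)"
      using has_vector_derivative_Pair[OF xi_line[OF sm(2) t(1) th] xi_line[OF sm(1) t(1) th]] by (simp add: X W)
    let ?a = "y \<odot> X (G t \<theta>)" and ?b = "y \<odot> W (G t \<theta>)"
    have 1: "\<bar>?a\<bar> \<le> norm (?a, ?b)" "\<bar>?b\<bar> \<le> norm (?a, ?b)"
      using norm_fst_le[of ?a ?b] norm_snd_le[of ?b ?a] by simp_all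
    have "norm (?b, - (?\<kappa> \<theta> * ?a)) \<le> \<bar>?b\<bar> + \<bar>?\<kappa> \<theta>\<bar> * \<bar>?a\<bar>"
      using norm_Pair_le[of ?b "- (?\<kappa> \<theta> * ?a)"] by (simp add: abs_mult)
    also have "\<dots> \<le> norm (?a, ?b) + \<bar>?\<kappa> \<theta>\<bar> * norm (?a, ?b)"
      by (rule add_mono[OF 1(2) mult_left_mono[OF 1(1) abs_ge_zero]])
    finally have "norm (?b, - (?\<kappa> \<theta> * ?a)) \<le> (1 + \<bar>?\<kappa> \<theta>\<bar>) * norm (?a, ?b)" by (simp add: distrib_right)
    from mult_left_mono[OF this abs_ge_zero[of "?k \<theta>"]]
    show "norm (?k \<theta> *\<^sub>R (?b, - (?\<kappa> \<theta> * ?a))) \<le> \<bar>?k \<theta>\<bar> * (1 + \<bar>?\<kappa> \<theta>\<bar>) * norm (?a, ?b)"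
      unfolding norm_scaleR mult.assoc .
  next
    show "continuous_on {-\<delta><..<\<delta>} (\<lambda>\<theta>. \<bar>?k \<theta>\<bar> * (1 + \<bar>?\<kappa> \<theta>\<bar>))"
      using W_q1 G_N t(1)
      by (intro continuous_on_mult continuous_on_rabs continuous_on_divide continuous_on_add continuous_on_const cont
          smooth_on_ip[OF open_U] smooth_on_const[OF open_U] smooth_W ballI) (auto simp: J_iff abs_less_iff)
    show "(y \<odot> X (G t \<theta>), y \<odot> W (G t \<theta>)) = 0" using y by (simp add: K_def zero_prod_def)
  qed
  then show "y \<in> K (G t \<theta>')" by (simp add: K_def zero_prod_def)
qed

lemma N_eq: assumes "u \<in> N" obtains \<theta> where "ht u \<in> J" "\<theta> \<in> {-\<delta><..<\<delta>}" "u = G (ht u) \<theta>"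
proof -
  obtain \<theta> where "\<bar>ht u - ht u1\<bar> < \<delta>" "\<bar>\<theta>\<bar> < \<delta>" "u = G (ht u) \<theta>" using N_G[OF assms] by blast
  then show thesis by (intro that[of \<theta>]) (simp_all add: J_iff abs_less_iff minus_less_iff)
qed

lemma zero_I: "0 \<in> {-\<delta><..<\<delta>}" and t1_J: "ht u1 \<in> J" using delta by (auto simp: J_iff)

lemma u1_U: "u1 \<in> U" using u1_N N_U by blast

lemma c_U: "t \<in> J \<Longrightarrow> c t \<in> U" using G_U zero_I by (simp add: c_def)

lemma c_N: "t \<in> J \<Longrightarrow> c t \<in> N" "t \<in> J \<Longrightarrow> ht (c t) = t"
  using G_N[of t 0] delta by (auto simp: c_def J_iff)

lemma K_c: "t \<in> J \<Longrightarrow> K (c t) = K u1"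
  using K_s_line[OF t1_J _ zero_I, of t] K_s_line[OF _ t1_J zero_I, of t] by (auto simp: c_def G_u1)

lemma X_c: "t \<in> J \<Longrightarrow> X (c t) = X u1"
  using X_s_line[OF _ t1_J zero_I] by (simp add: c_def G_u1)

lemma K_const: assumes "u \<in> N" shows "K u = K u1"
proof -
  obtain \<theta> where u: "ht u \<in> J" "\<theta> \<in> {-\<delta><..<\<delta>}" "u = G (ht u) \<theta>" using N_eq[OF assms] .
  have "K u = K (c (ht u))"
    using K_xi_line[OF u(1,2) zero_I] K_xi_line[OF u(1) zero_I u(2)] u(3) by (simp add: c_def)
  then show ?thesis using K_c[OF u(1)] by simp
qed

lemma solution_c: "profile_solution \<epsilon> J (\<lambda>t. Y (c t))"
  unfolding profile_solution_def
proof
  fix t assume t: "t \<in> J"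
  note l = s_line[OF _ t zero_I, folded c_def]
  show "((\<lambda>t. Y (c t)) has_vector_derivative profile_field \<epsilon> (Y (c t))) (at t)"
    unfolding Y_profile_field[OF c_U[OF t], symmetric] unfolding Y_def
    by (intro has_vector_derivative_Pair l smooth_q smooth_S smooth_W smooth_H)
qed

section \<open>Isometries between points of equal height\<close>

lemma perp_c:
  assumes t: "t \<in> J" and z: "\<And>y. y \<in> K u1 \<Longrightarrow> y \<odot> z = 0"
  shows "z = (z \<odot> X u1) *\<^sub>R X u1 - (z \<odot> q (c t)) *\<^sub>R W (c t)"
  using perp_K[OF c_U[OF t], of z] z by (simp add: K_c[OF t] X_c[OF t])

text \<open>Splitting \<open>z\<close> along \<open>X\<close> and \<open>W\<close> turns the norm
  condition into the equation of a conic. It is exactly the relation that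
  \<open>rotation_isometry\<close> demands of its two parameters.\<close>

lemma perp_norm:
  assumes t: "t \<in> J" and z: "\<And>y. y \<in> K u1 \<Longrightarrow> y \<odot> z = 0"
    and n: "(q (c t) + z) \<odot> (q (c t) + z) = \<epsilon>"
  shows "2 * (- (z \<odot> q (c t))) = (z \<odot> X u1)\<^sup>2 + (W (c t) \<odot> W (c t)) * (- (z \<odot> q (c t)))\<^sup>2"
proof -
  note u = c_U[OF t]
  define b where "b = z \<odot> X u1"
  define d where "d = z \<odot> q (c t)"
  have zz: "z = b *\<^sub>R X (c t) - d *\<^sub>R W (c t)" unfolding b_def d_def X_c[OF t] by (rule perp_c[OF t z])
  have "z \<odot> z = (b *\<^sub>R X (c t) - d *\<^sub>R W (c t)) \<odot> (b *\<^sub>R X (c t) - d *\<^sub>R W (c t))"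
    by (rule arg_cong2[OF zz zz])
  then have "z \<odot> z = b\<^sup>2 + (W (c t) \<odot> W (c t)) * d\<^sup>2"
    by (simp add: X_X[OF u] W_X[OF u] X_W[OF u] ip_simps power2_eq_square)
  moreover have "z \<odot> z + 2 * (z \<odot> q (c t)) = 0"
    using n q_q[OF u] by (simp add: ip_simps ip_commute[of _ "q (c t)" z])
  ultimately show ?thesis unfolding b_def d_def by simp
qed

text \<open>Moving along \<open>\<xi>\<close> changes \<open>q\<close> in the direction of
  \<open>X\<close>, to which \<open>y\<close> stays orthogonal because \<open>K\<close> is constant.
  So points of equal height differ by a vector of the rotation plane.\<close>

lemma q_diff_perp:
  assumes u: "u \<in> N" and y: "y \<in> K u1"
  shows "y \<odot> (q u - q (c (ht u))) = 0"
proof -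
  obtain \<theta> where th: "ht u \<in> J" "\<theta> \<in> {-\<delta><..<\<delta>}" "u = G (ht u) \<theta>" using N_eq[OF u] .
  have sm: "smooth_on U (\<lambda>u. y \<odot> q u)" by (rule smooth_on_ip[OF open_U smooth_on_const[OF open_U] smooth_q])
  have "(\<lambda>\<theta>. y \<odot> q (G (ht u) \<theta>) - y \<odot> q (c (ht u))) \<theta> = 0"
  proof (rule linear_growth_zero_continuous[OF interval_J(3) zero_I th(2), where C = "\<lambda>_. 0" and \<phi>' = "\<lambda>_. 0"])
    fix \<theta> assume \<theta>: "\<theta> \<in> {-\<delta><..<\<delta>}"
    have "y \<odot> X (G (ht u) \<theta>) = 0"
      using y K_const[of "G (ht u) \<theta>"] G_N[of "ht u" \<theta>] th(1) \<theta> by (auto simp: K_def J_iff abs_less_iff)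
    then have "D (\<lambda>u. y \<odot> q u) (G (ht u) \<theta>) (\<xi> (G (ht u) \<theta>)) = 0"
      using D_ip[OF smooth_on_const[OF open_U] smooth_q G_U[OF th(1) \<theta>], of \<epsilon> y "\<xi> (G (ht u) \<theta>)"]
      by (simp add: D_q_xi[OF G_U[OF th(1) \<theta>]] ip_simps)
    then show "((\<lambda>\<theta>. y \<odot> q (G (ht u) \<theta>) - y \<odot> q (c (ht u))) has_vector_derivative 0) (at \<theta>)"
      using has_vector_derivative_diff[OF xi_line[OF sm th(1) \<theta>] has_vector_derivative_const] by simp
  qed (simp_all add: c_def)
  then show ?thesis using th(3) by (simp add: ip_simps)
qed

lemma xi_const_N:
  fixes F :: "real^2 \<Rightarrow> 'b::real_inner"
  assumes "smooth_on U F" "\<And>u. u \<in> U \<Longrightarrow> D F u (\<xi> u) = 0" "u \<in> N"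
  shows "F u = F (c (ht u))"
  using N_eq[OF assms(3)] xi_const[OF assms(1,2) _ _ zero_I] unfolding c_def by metis

lemma D_xi_coefficients:
  assumes u: "u \<in> U"
  shows "D (\<lambda>u. W u \<odot> W u) u (\<xi> u) = 0" "D (\<lambda>u. W u \<odot> S u) u (\<xi> u) = 0" "D (\<lambda>u. H u \<odot> W u) u (\<xi> u) = 0"
  using D_ip[OF smooth_W smooth_W u] D_ip[OF smooth_W smooth_S u] D_ip[OF smooth_H smooth_W u]
  by (simp_all add: D_xi_W[OF u] D_xi_S_bracket(1)[OF u] D_xi_H[OF u] ip_simps X_W[OF u] W_X[OF u] X_S[OF u] H_orth(2)[OF u])

lemma smooth_coefficients:
  "smooth_on U (\<lambda>u. W u \<odot> W u)" "smooth_on U (\<lambda>u. W u \<odot> S u)" "smooth_on U (\<lambda>u. H u \<odot> W u)"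
  by (intro smooth_on_ip open_U smooth_W smooth_S smooth_H)+

text \<open>Since \<open>q\<close> has derivative \<open>X\<close> along \<open>\<xi>\<close>, the
  combination \<open>F u + k u *\<^sub>R q u\<close> is constant on level curves. Used for
  \<open>S\<close>, \<open>W\<close> and \<open>H\<close>, which therefore change by multiples of
  the change of \<open>q\<close>.\<close>

lemma linked_const:
  assumes F: "smooth_on U F" and k: "smooth_on U k"
    and DF: "\<And>u. u \<in> U \<Longrightarrow> D F u (\<xi> u) = - k u *\<^sub>R X u" and Dk: "\<And>u. u \<in> U \<Longrightarrow> D k u (\<xi> u) = 0"
    and u: "u \<in> N"
  shows "F u = F (c (ht u)) - k (c (ht u)) *\<^sub>R (q u - q (c (ht u)))" "k u = k (c (ht u))"
proof -
  show kc: "k u = k (c (ht u))" by (rule xi_const_N[OF k Dk u])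
  have "F u + k u *\<^sub>R q u = F (c (ht u)) + k (c (ht u)) *\<^sub>R q (c (ht u))"
  proof (rule xi_const_N[OF _ _ u])
    show "smooth_on U (\<lambda>u. F u + k u *\<^sub>R q u)"
      by (intro smooth_on_add smooth_on_scaleR open_U F k smooth_q)
    fix u assume u: "u \<in> U"
    have "((\<lambda>u. F u + k u *\<^sub>R q u) has_derivative (\<lambda>v. D F u v + (k u *\<^sub>R D q u v + D k u v *\<^sub>R q u))) (at u)"
      by (intro has_derivative_add has_derivative_scaleR smooth_on_has_derivative[OF _ u] F k smooth_q)
    from fun_cong[OF frechet_derivative_at[OF this], of "\<xi> u"]
    show "D (\<lambda>u. F u + k u *\<^sub>R q u) u (\<xi> u) = 0" by (simp add: DF[OF u] Dk[OF u] D_q_xi[OF u])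
  qed
  then show "F u = F (c (ht u)) - k (c (ht u)) *\<^sub>R (q u - q (c (ht u)))"
    unfolding kc by (simp add: algebra_simps)
qed

text \<open>The rotation is chosen to carry the \<open>q\<close> of the curve to \<open>q u\<close>,
  a displacement by z. A vector v orthogonal to \<open>X\<close> is moved by -<v,W> z, and this is
  precisely the law of \<open>linked_const\<close>, whose factors \<open>k\<close> are the products
  with \<open>W\<close>.\<close>

lemma level_isometry:
  assumes u: "u \<in> N"
  shows "\<exists>L\<in>isometries_fixing \<epsilon> (K u1). Y u = map_state L (Y (c (ht u)))"
proof -
  have t: "ht u \<in> J" using N_eq[OF u] by blast
  let ?t = "ht u"
  note v = c_U[OF t]
  define z where "z = q u - q (c ?t)"
  define b where "b = z \<odot> X u1"
  define d where "d = - (z \<odot> q (c ?t))"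
  let ?X = "X u1" and ?W = "W (c ?t)"
  have zp: "\<And>y. y \<in> K u1 \<Longrightarrow> y \<odot> z = 0" using q_diff_perp[OF u] by (simp add: z_def)
  have z: "z = b *\<^sub>R ?X + d *\<^sub>R ?W" using perp_c[OF t zp] by (simp add: b_def d_def)
  have "(q (c ?t) + z) \<odot> (q (c ?t) + z) = \<epsilon>" using q_q[of u] u N_U by (auto simp: z_def)
  from perp_norm[OF t zp this] have bd: "2 * d = b\<^sup>2 + (?W \<odot> ?W) * d\<^sup>2" by (simp add: b_def d_def)
  define L where "L = (\<lambda>v. v + (b * (v \<odot> ?X) - d * (v \<odot> ?W)) *\<^sub>R ?W - (b * (v \<odot> ?W) + d * (?W \<odot> ?W) * (v \<odot> ?X)) *\<^sub>R ?X)"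
  have "L \<in> isometries_fixing \<epsilon> (K u1)"
    unfolding L_def
  proof (rule rotation_isometry[OF _ _ refl bd])
    show "?X \<odot> ?X = 1" "?X \<odot> ?W = 0" using X_X[OF v] X_W[OF v] by (simp_all add: X_c[OF t])
    show "y \<odot> ?X = 0 \<and> y \<odot> ?W = 0" if "y \<in> K u1" for y
      using that unfolding K_c[OF t, symmetric] by (simp add: K_def X_c[OF t])
  qed
  moreover have Lv: "L v = v - (v \<odot> ?W) *\<^sub>R z" if "v \<odot> ?X = 0" for v
    using that by (simp add: L_def z algebra_simps)
  have "q u = L (q (c ?t))"
    using X_q[OF v] W_q[OF v] Lv[of "q (c ?t)"] by (simp add: X_c[OF t] ip_commute[of _ "q (c ?t)"] z_def)
  moreover have "S u = L (S (c ?t))"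
    using S_X[OF v] Lv[of "S (c ?t)"] linked_const(1)[OF smooth_S smooth_coefficients(2) D_xi_S_bracket(1) D_xi_coefficients(2) u]
    by (simp add: X_c[OF t] ip_commute[of _ "S (c ?t)"] z_def)
  moreover have "W u = L (W (c ?t))"
    using W_X[OF v] Lv[of "W (c ?t)"] linked_const(1)[OF smooth_W smooth_coefficients(1) D_xi_W D_xi_coefficients(1) u]
    by (simp add: X_c[OF t] z_def)
  moreover have "H u = L (H (c ?t))"
    using H_orth(2)[OF v] Lv[of "H (c ?t)"] linked_const(1)[OF smooth_H smooth_coefficients(3) D_xi_H D_xi_coefficients(3) u]
    by (simp add: X_c[OF t] z_def)
  ultimately show ?thesis by (intro bexI[of _ L]) (simp_all add: map_state_def Y_def)
qed

text \<open>The image contains every nearby point of the same space form that differs from the curve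
  \<open>x \<circ> c\<close> at its own height by a vector of the rotation plane. Such points lie on a conic with the point of the
  curve, and a conic meets a line in at most two points, one of which is far away.\<close>

lemma image_neighbourhood:
  "\<exists>M. open M \<and> x u1 \<in> M \<and> (\<forall>z\<in>M. snd (snd z) \<in> J \<and>
     ((\<forall>y\<in>K u1. y \<odot> (z - x (c (snd (snd z)))) = 0) \<longrightarrow> Q_part z \<odot> Q_part z = \<epsilon> \<longrightarrow> z \<in> x ` U))"
proof -
  have contc: "continuous_on J (\<lambda>t. F (c t))" if "smooth_on U F" for F :: "real^2 \<Rightarrow> 'b::real_normed_vector"
    using s_line[OF that _ zero_I] unfolding c_def
    by (intro continuous_at_imp_continuous_on ballI) (rule has_vector_derivative_continuous)
  have contN: "continuous_on N F" if "smooth_on U F" for F :: "real^2 \<Rightarrow> 'b::real_normed_vector"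
    by (rule continuous_on_subset[OF smooth_on_continuous[OF that] N_U])
  have htJ: "ht u \<in> J" if "u \<in> N" for u using N_eq[OF that] by blast
  have contcN: "continuous_on N (\<lambda>u. F (c (ht u)))" if "smooth_on U F" for F :: "real^2 \<Rightarrow> 'b::real_normed_vector"
    by (rule continuous_on_compose2[OF contc[OF that] contN[OF smooth_ht]]) (use htJ in auto)
  define \<kappa> where "\<kappa> t = W (c t) \<odot> W (c t)" for t
  define f2 where "f2 u = (x u - x (c (ht u))) \<odot> q (c (ht u))" for u
  \<comment> \<open>\<open>M0\<close> bounds \<open>\<kappa>\<close> near \<open>u1\<close>. The
    choice of \<open>\<eta>\<close> gives |\<open>\<kappa>\<close> (d + d')| at most 1 for two
    offsets below it, which excludes the far intersection of line and conic.\<close>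
  define M0 where "M0 = \<bar>\<kappa> (ht u1)\<bar> + 1"
  define \<eta> where "\<eta> = 1 / (2 * M0)"
  have M0: "M0 > 0" and eta: "\<eta> > 0" by (auto simp: M0_def \<eta>_def add_pos_nonneg)
  define N' where "N' = N \<inter> (\<lambda>u. (\<kappa> (ht u), f2 u)) -` ({-M0<..<M0} \<times> {-\<eta><..<\<eta>})"
  have "continuous_on N (\<lambda>u. (\<kappa> (ht u), f2 u))"
    unfolding \<kappa>_def f2_def
    by (intro continuous_on_Pair contcN[OF smooth_coefficients(1)] bounded_bilinear.continuous_on[OF bounded_bilinear_ip]
        continuous_on_diff contN[OF smooth_x] contcN[OF smooth_x] contcN[OF smooth_q])
  then have openN': "open N'"
    unfolding N'_def by (intro continuous_open_preimage open_N open_Times open_greaterThanLessThan)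
  have cu1: "c (ht u1) = u1" by (simp add: c_def G_u1)
  have u1N': "u1 \<in> N'" using u1_N eta by (auto simp: N'_def f2_def cu1 M0_def ip_simps abs_less_iff)
  let ?p = "\<lambda>a b. a *\<^sub>R axis 1 1 + b *\<^sub>R axis 2 1 :: real^2"
  let ?f = "\<lambda>u. ?p (ht u) (x u \<odot> X u1)"
  have "(?f has_derivative (\<lambda>v. ?p (D ht u1 v) (x u1 \<odot> 0 + D x u1 v \<odot> X u1))) (at u1)"
    by (rule has_derivative_add has_derivative_scaleR_left has_derivative_ip smooth_on_has_derivative[OF _ u1_U]
        smooth_ht smooth_x has_derivative_const)+
  then have der: "(?f has_derivative (\<lambda>v. ?p (dh u1 v) (D x u1 v \<odot> X u1))) (at u1)"
    by (simp add: D_ht[OF u1_U] ip_simps)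
  \<comment> \<open>Height and product with \<open>X u1\<close> form a map that is open at
    \<open>u1\<close>, its derivative sending \<open>s\<close> and \<open>\<xi>\<close> to the axes.
    So near \<open>x u1\<close> every point has a partner on the surface with the same two
    values.\<close>
  have "?f u1 \<in> interior (?f ` N')"
  proof (rule sussmann_open_mapping[OF openN' _ u1N' der _ _ order_refl])
    show "continuous_on N' ?f"
      by (rule continuous_on_subset[OF contN[of ?f]])
        (auto simp: N'_def intro!: smooth_on_add smooth_on_scaleR smooth_ht smooth_on_const open_U smooth_on_ip smooth_x)
    show "bounded_linear (\<lambda>w::real^2. w $ 1 *\<^sub>R s u1 + w $ 2 *\<^sub>R \<xi> u1)"
      by (intro bounded_linear_add bounded_linear_scaleR_left[THEN bounded_linear_compose] bounded_linear_vec_nth)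
    show "(\<lambda>v. ?p (dh u1 v) (D x u1 v \<odot> X u1)) \<circ> (\<lambda>w. w $ 1 *\<^sub>R s u1 + w $ 2 *\<^sub>R \<xi> u1) = id"
    proof
      fix w :: "real^2"
      note lin = linear_D[OF smooth_x u1_U]
      have "D x u1 (w $ 1 *\<^sub>R s u1 + w $ 2 *\<^sub>R \<xi> u1) = w $ 1 *\<^sub>R S u1 + w $ 2 *\<^sub>R X u1"
        by (simp add: linear_add[OF lin] linear_scale[OF lin] S_def X_def)
      then show "((\<lambda>v. ?p (dh u1 v) (D x u1 v \<odot> X u1)) \<circ> (\<lambda>w::real^2. w $ 1 *\<^sub>R s u1 + w $ 2 *\<^sub>R \<xi> u1)) w = id w"
        using vec2_eq[of w] by (simp add: dh_def ip_simps S_e[OF u1_U] X_e[OF u1_U] S_X[OF u1_U] X_X[OF u1_U])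
    qed
    show "u1 \<in> interior N'" using u1N' openN' by (simp add: interior_open)
  qed
  then obtain O1 where O1: "open O1" "?f u1 \<in> O1" "O1 \<subseteq> ?f ` N'" by (auto simp: interior_def)
  define J' where "J' = {z :: 'n amb. snd (snd z) \<in> J}"
  have openJ': "open J'"
    using open_vimage[OF interval_J(2), of "\<lambda>z::'n amb. snd (snd z)"] by (simp add: J'_def vimage_def continuous_intros)
  have contJ': "continuous_on J' (\<lambda>z. F (c (snd (snd z))))" if "smooth_on U F" for F :: "real^2 \<Rightarrow> 'b::real_normed_vector"
    by (rule continuous_on_compose2[OF contc[OF that]]) (auto simp: J'_def intro!: continuous_intros)
  define g where "g z = (?p (snd (snd z)) (z \<odot> X u1), (z - x (c (snd (snd z)))) \<odot> q (c (snd (snd z))))" for z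
  have "continuous_on J' g"
    unfolding g_def
    by (intro continuous_intros bounded_bilinear.continuous_on[OF bounded_bilinear_ip] contJ'[OF smooth_x] contJ'[OF smooth_q])
  then have openM: "open (J' \<inter> g -` (O1 \<times> {-\<eta><..<\<eta>}))"
    by (intro continuous_open_preimage openJ' open_Times O1 open_greaterThanLessThan)
  have "x u1 \<in> J' \<inter> g -` (O1 \<times> {-\<eta><..<\<eta>})"
    using O1(2) t1_J eta by (auto simp: J'_def g_def ht_def[symmetric] cu1 ip_simps)
  moreover have "z \<in> x ` U"
    if zM: "z \<in> J' \<inter> g -` (O1 \<times> {-\<eta><..<\<eta>})" and perp: "\<forall>y\<in>K u1. y \<odot> (z - x (c (snd (snd z)))) = 0"
      and nz: "Q_part z \<odot> Q_part z = \<epsilon>" for z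
  proof -
    define t where "t = snd (snd z)"
    have t: "t \<in> J" and tO: "?p t (z \<odot> X u1) \<in> O1" and d1: "\<bar>(z - x (c t)) \<odot> q (c t)\<bar> < \<eta>"
      using zM by (auto simp: J'_def g_def t_def)
    obtain u where u: "u \<in> N'" "?p t (z \<odot> X u1) = ?f u" using O1(3) tO by blast
    have ht: "ht u = t" and xX: "x u \<odot> X u1 = z \<odot> X u1" using vec2_eqD[OF u(2)] by simp_all
    have uN: "u \<in> N" and k: "\<bar>\<kappa> t\<bar> < M0" and d2: "\<bar>(x u - x (c t)) \<odot> q (c t)\<bar> < \<eta>"
      using u(1) by (auto simp: N'_def f2_def ht)
    have uU: "u \<in> U" using uN N_U by blast
    define z1 where "z1 = z - x (c t)"
    define z2 where "z2 = x u - x (c t)"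
    have htc: "ht (c t) = t" by (rule c_N(2)[OF t])
    have z2q: "z2 = q u - q (c t)" by (simp add: z2_def x_eq htc ht)
    have zt: "z \<odot> e = t" by (simp add: ip_e_last t_def)
    have z1q: "z1 = Q_part z - q (c t)"
      by (simp add: z1_def x_eq htc Q_part_eq[of z \<epsilon>] zt)
    have p1: "\<And>y. y \<in> K u1 \<Longrightarrow> y \<odot> z1 = 0" using perp by (simp add: z1_def t_def)
    have p2: "\<And>y. y \<in> K u1 \<Longrightarrow> y \<odot> z2 = 0" using q_diff_perp[OF uN] by (simp add: z2q ht)
    have b: "z1 \<odot> X u1 = z2 \<odot> X u1" by (simp add: z1_def z2_def ip_simps xX)
    define d where "d = - (z1 \<odot> q (c t))"
    define d' where "d' = - (z2 \<odot> q (c t))"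
    have "2 * d = (z1 \<odot> X u1)\<^sup>2 + \<kappa> t * d\<^sup>2"
      unfolding d_def \<kappa>_def by (rule perp_norm[OF t p1]) (simp_all add: z1q nz)
    moreover have "2 * d' = (z2 \<odot> X u1)\<^sup>2 + \<kappa> t * d'\<^sup>2"
      unfolding d'_def \<kappa>_def by (rule perp_norm[OF t p2]) (simp_all add: z2q q_q[OF uU])
    \<comment> \<open>Both offsets solve the same conic equation with the same linear coordinate;
      the difference of the equations factors.\<close>
    ultimately have "(d - d') * (2 - \<kappa> t * (d + d')) = 0"
      unfolding b by (simp add: algebra_simps power2_eq_square)
    moreover have "\<kappa> t * (d + d') < 2"
    proof -
      have "\<bar>d + d'\<bar> \<le> 2 * \<eta>" using d1 d2 by (simp add: d_def d'_def z1_def z2_def)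
      then have "\<bar>\<kappa> t\<bar> * \<bar>d + d'\<bar> \<le> M0 * (2 * \<eta>)" using k M0 by (intro mult_mono) auto
      also have "\<dots> = 1" using M0 by (simp add: \<eta>_def)
      finally show ?thesis using abs_ge_self[of "\<kappa> t * (d + d')"] by (simp add: abs_mult)
    qed
    ultimately have "d = d'" by auto
    then have "z1 = z2" using perp_c[OF t p1] perp_c[OF t p2] b by (simp add: d_def d'_def)
    then have "z = x u" by (simp add: z1_def z2_def)
    then show ?thesis using uU by blast
  qed
  ultimately show ?thesis
    using openM by (intro exI[of _ "J' \<inter> g -` (O1 \<times> {-\<eta><..<\<eta>})"]) (auto simp: J'_def)
qed

end

context class_A_chart
begin

lemma local_structure:
  assumes u1: "u1 \<in> U"
  shows "\<exists>N J c M. open N \<and> u1 \<in> N \<and> N \<subseteq> U \<and> open J \<and> is_interval J \<and>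
    profile_solution \<epsilon> J (\<lambda>t. Y (c t)) \<and> (\<forall>t\<in>J. c t \<in> N \<and> ht (c t) = t) \<and>
    (\<forall>u\<in>N. ht u \<in> J \<and> K u = K u1 \<and> (\<exists>L\<in>isometries_fixing \<epsilon> (K u1). Y u = map_state L (Y (c (ht u))))) \<and>
    open M \<and> x u1 \<in> M \<and> (\<forall>z\<in>M. snd (snd z) \<in> J \<and>
     ((\<forall>y\<in>K u1. y \<odot> (z - x (c (snd (snd z)))) = 0) \<longrightarrow> Q_part z \<odot> Q_part z = \<epsilon> \<longrightarrow> z \<in> x ` U))"
proof -
  obtain \<delta> G N where box: "\<delta> > 0" "open N" "u1 \<in> N" "N \<subseteq> U"
    "\<And>t \<theta>. \<bar>t - ht u1\<bar> < \<delta> \<Longrightarrow> \<bar>\<theta>\<bar> < \<delta> \<Longrightarrow> G t \<theta> \<in> N \<and> ht (G t \<theta>) = t"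
    "\<And>u. u \<in> N \<Longrightarrow> \<bar>ht u - ht u1\<bar> < \<delta> \<and> (\<exists>\<theta>. \<bar>\<theta>\<bar> < \<delta> \<and> u = G (ht u) \<theta>)"
    "G (ht u1) 0 = u1"
    "\<And>t \<theta>. \<bar>t - ht u1\<bar> < \<delta> \<Longrightarrow> \<bar>\<theta>\<bar> < \<delta> \<Longrightarrow>
       ((\<lambda>t. G t \<theta>) has_vector_derivative s (G t \<theta>)) (at t) \<and>
       (G t has_vector_derivative (1 / (W (G t \<theta>) \<odot> q u1)) *\<^sub>R \<xi> (G t \<theta>)) (at \<theta>)"
    "\<And>u. u \<in> N \<Longrightarrow> W u \<odot> q u1 \<noteq> 0"
    by (rule coordinates[OF u1]) blast
  interpret bx: class_A_box \<epsilon> x U u1 \<delta> G N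
    by unfold_locales (fact box)+
  obtain M where M: "open M" "x u1 \<in> M" "\<forall>z\<in>M. snd (snd z) \<in> bx.J \<and>
     ((\<forall>y\<in>K u1. y \<odot> (z - x (bx.c (snd (snd z)))) = 0) \<longrightarrow> Q_part z \<odot> Q_part z = \<epsilon> \<longrightarrow> z \<in> x ` U)"
    using bx.image_neighbourhood by blast
  have J: "\<forall>t\<in>bx.J. bx.c t \<in> N \<and> ht (bx.c t) = t" using bx.c_N by blast
  have "\<forall>u\<in>N. ht u \<in> bx.J \<and> K u = K u1 \<and>
      (\<exists>L\<in>isometries_fixing \<epsilon> (K u1). Y u = map_state L (Y (bx.c (ht u))))"
    using bx.N_eq bx.K_const bx.level_isometry by metis
  with J show ?thesis
    using box(2-4) bx.interval_J(1,2) bx.solution_c M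
    by (intro exI[of _ N] exI[of _ bx.J] exI[of _ bx.c] exI[of _ M] conjI)
qed

end

section \<open>From charts to the surface\<close>

context class_A_chart
begin

text \<open>\<open>S\<close> is determined by the surface: tangent, orthogonal to the horizontal
  direction, of unit height growth. The horizontal unit vector is unique up to the sign
  \<open>k\<close>, which may differ from chart to chart.\<close>

lemma chart_change_frame:
  assumes "class_A_chart \<epsilon> x' U'"
    and N: "open N" "N \<subseteq> U" and \<psi>: "\<psi> ` N \<subseteq> U'" and eq: "\<forall>v\<in>N. x v = x' (\<psi> v)"
    and d\<psi>: "\<forall>v\<in>N. (\<psi> has_derivative \<psi>' v) (at v)" and v: "v \<in> N"
  defines "k \<equiv> X v \<odot> class_A_chart.X \<epsilon> x' (\<psi> v)"
  shows "k * k = 1" "X v = k *\<^sub>R class_A_chart.X \<epsilon> x' (\<psi> v)" "S v = class_A_chart.S \<epsilon> x' (\<psi> v)"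
    "\<psi>' v (\<xi> v) = k *\<^sub>R class_A_chart.\<xi> \<epsilon> x' (\<psi> v)" "\<psi>' v (s v) = class_A_chart.s \<epsilon> x' (\<psi> v)"
    "q v = class_A_chart.q x' (\<psi> v)"
proof -
  interpret c: class_A_chart \<epsilon> x' U' by fact
  have u: "v \<in> U" and u': "\<psi> v \<in> U'" using v N \<psi> by auto
  have "((\<lambda>v. x' (\<psi> v)) has_derivative (\<lambda>w. D x' (\<psi> v) (\<psi>' v w))) (at v)"
    by (rule has_derivative_compose[OF d\<psi>[rule_format, OF v] smooth_on_has_derivative[OF c.smooth_x u']])
  then have "(x has_derivative (\<lambda>w. D x' (\<psi> v) (\<psi>' v w))) (at v)"
    by (rule has_derivative_transform_within_open[OF _ N(1) v]) (simp add: eq)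
  then have chain: "D x v w = D x' (\<psi> v) (\<psi>' v w)" for w
    using frechet_derivative_at by metis
  have XX: "X v = k *\<^sub>R c.X (\<psi> v)"
    using c.Dx_expand(1)[OF u', of "\<psi>' v (\<xi> v)"] unfolding chain[symmetric]
    by (simp add: X_def[symmetric] X_e[OF u] k_def)
  then show X: "X v = k *\<^sub>R c.X (\<psi> v)" .
  show k: "k * k = 1" using X_X[OF u] unfolding XX by (simp add: ip_simps c.X_X[OF u'])
  have S1: "S v = c.S (\<psi> v) + (ip \<epsilon> (S v) (c.X (\<psi> v))) *\<^sub>R c.X (\<psi> v)"
    using c.Dx_expand(1)[OF u', of "\<psi>' v (s v)"] unfolding chain[symmetric]
    by (simp add: S_def[symmetric] S_e[OF u])
  have "k * (ip \<epsilon> (S v) (c.X (\<psi> v))) = 0" using S_X[OF u] unfolding XX by (simp add: ip_simps)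
  then have "ip \<epsilon> (S v) (c.X (\<psi> v)) = 0" using k by auto
  then show S: "S v = c.S (\<psi> v)" using S1 by simp
  have "D x' (\<psi> v) (\<psi>' v (\<xi> v) - k *\<^sub>R c.\<xi> (\<psi> v)) = 0"
    using X c.linear_D[OF c.smooth_x u']
    by (simp add: linear_diff linear_scale chain[symmetric] X_def c.X_def)
  then show "\<psi>' v (\<xi> v) = k *\<^sub>R c.\<xi> (\<psi> v)" using c.Dx_eq_0[OF u'] by simp
  have "D x' (\<psi> v) (\<psi>' v (s v) - c.s (\<psi> v)) = 0"
    using S c.linear_D[OF c.smooth_x u'] by (simp add: linear_diff chain[symmetric] S_def c.S_def)
  then show "\<psi>' v (s v) = c.s (\<psi> v)" using c.Dx_eq_0[OF u'] by simp
  show "q v = c.q (\<psi> v)" by (simp add: q_def c.q_def eq[rule_format, OF v])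
qed

text \<open>The sign \<open>k\<close> enters \<open>W\<close> twice and cancels. Its derivative
  contributes only a multiple of \<open>X\<close>, which the orthogonality of \<open>W\<close> and
  \<open>X\<close> removes.\<close>

lemma chart_change:
  assumes c: "class_A_chart \<epsilon> x' U'"
    and N: "open N" "N \<subseteq> U" and \<psi>: "\<psi> ` N \<subseteq> U'" and eq: "\<forall>v\<in>N. x v = x' (\<psi> v)"
    and d\<psi>: "\<forall>v\<in>N. (\<psi> has_derivative \<psi>' v) (at v)" and v: "v \<in> N"
  shows "K v = class_A_chart.K \<epsilon> x' (\<psi> v)" "Y v = class_A_chart.Y \<epsilon> x' (\<psi> v)"
proof -
  interpret c: class_A_chart \<epsilon> x' U' by fact
  note fr = chart_change_frame[OF c N \<psi> eq d\<psi>]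
  have u: "v \<in> U" and u': "\<psi> v \<in> U'" using v N \<psi> by auto
  let ?k = "\<lambda>v. ip \<epsilon> (X v) (c.X (\<psi> v))"
  have dX': "((\<lambda>v. c.X (\<psi> v)) has_derivative (\<lambda>w. D c.X (\<psi> v) (\<psi>' v w))) (at v)"
    by (rule has_derivative_compose[OF d\<psi>[rule_format, OF v] smooth_on_has_derivative[OF c.smooth_X u']])
  have "((\<lambda>v. ?k v *\<^sub>R c.X (\<psi> v)) has_derivative (\<lambda>w. ?k v *\<^sub>R D c.X (\<psi> v) (\<psi>' v w)
     + (ip \<epsilon> (X v) (D c.X (\<psi> v) (\<psi>' v w)) + ip \<epsilon> (D X v w) (c.X (\<psi> v))) *\<^sub>R c.X (\<psi> v))) (at v)"
    by (rule has_derivative_scaleR[OF has_derivative_ip[OF smooth_on_has_derivative[OF smooth_X u] dX'] dX'])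
  then have "(X has_derivative (\<lambda>w. ?k v *\<^sub>R D c.X (\<psi> v) (\<psi>' v w)
     + (ip \<epsilon> (X v) (D c.X (\<psi> v) (\<psi>' v w)) + ip \<epsilon> (D X v w) (c.X (\<psi> v))) *\<^sub>R c.X (\<psi> v))) (at v)"
    by (rule has_derivative_transform_within_open[OF _ N(1) v]) (rule fr(2)[symmetric])
  from fun_cong[OF frechet_derivative_at[OF this], of "\<xi> v"]
  obtain l where "W v = ?k v *\<^sub>R D c.X (\<psi> v) (?k v *\<^sub>R c.\<xi> (\<psi> v)) + l *\<^sub>R c.X (\<psi> v)"
    unfolding fr(4)[OF v] W_def by metis
  then have W1: "W v = (?k v * ?k v) *\<^sub>R c.W (\<psi> v) + l *\<^sub>R c.X (\<psi> v)"
    by (simp add: linear_scale[OF c.linear_D[OF c.smooth_X u']] c.W_def)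
  have W1: "W v = c.W (\<psi> v) + l *\<^sub>R c.X (\<psi> v)"
    using W1 unfolding fr(1)[OF v] by simp
  have "?k v * (ip \<epsilon> (W v) (c.X (\<psi> v))) = 0"
    using W_X[OF u] by (subst (asm) fr(2)[OF v]) (simp add: ip_simps)
  then have "ip \<epsilon> (W v) (c.X (\<psi> v)) = 0" using fr(1)[OF v] by auto
  then have "l = 0" unfolding W1 by (simp add: ip_simps c.X_X[OF u'] c.W_X[OF u'])
  then have W: "W v = c.W (\<psi> v)" using W1 by simp
  have "((\<lambda>v. c.S (\<psi> v)) has_derivative (\<lambda>w. D c.S (\<psi> v) (\<psi>' v w))) (at v)"
    by (rule has_derivative_compose[OF d\<psi>[rule_format, OF v] smooth_on_has_derivative[OF c.smooth_S u']])
  then have "(S has_derivative (\<lambda>w. D c.S (\<psi> v) (\<psi>' v w))) (at v)"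
    by (rule has_derivative_transform_within_open[OF _ N(1) v]) (rule fr(3)[symmetric])
  from fun_cong[OF frechet_derivative_at[OF this], of "s v"]
  have B: "B v = c.B (\<psi> v)" unfolding fr(5)[OF v] B_def c.B_def by simp
  \<comment> \<open>Invariance of \<open>H\<close> is read off from \<open>two_H_eq\<close>: the
    difference of the two values is a multiple of \<open>S\<close>, while both values are orthogonal
    to \<open>S\<close>.\<close>
  define d where "d = H v - c.H (\<psi> v)"
  have \<tau>: "\<tau> v = c.\<tau> (\<psi> v)" by (simp add: \<tau>_def c.\<tau>_def fr(3)[OF v])
  have "2 *\<^sub>R d = 2 *\<^sub>R H v - 2 *\<^sub>R c.H (\<psi> v)" by (simp add: d_def scaleR_diff_right)
  also have "\<dots> = (2 * (ip \<epsilon> d e)) *\<^sub>R S v"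
    unfolding two_H_eq[OF u] c.two_H_eq[OF u'] d_def
    by (simp add: W B \<tau> fr(3)[OF v] fr(6)[OF v] ip_simps algebra_simps)
  finally have "2 *\<^sub>R d = 2 *\<^sub>R ((ip \<epsilon> d e) *\<^sub>R S v)" by (simp only: scaleR_scaleR)
  then have d: "d = (ip \<epsilon> d e) *\<^sub>R S v" unfolding scaleR_cancel_left by simp
  have "ip \<epsilon> d (S v) = 0" using H_orth(3)[OF u] c.H_orth(3)[OF u'] by (simp add: d_def ip_simps fr(3)[OF v])
  moreover have "ip \<epsilon> d (S v) = (ip \<epsilon> d e) * \<tau> v" by (subst (1) d) (simp add: ip_simps S_S)
  ultimately have "ip \<epsilon> d e = 0" using tau_pos[OF u] by simp
  then have H: "H v = c.H (\<psi> v)" using d by (simp add: d_def)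
  show "Y v = c.Y (\<psi> v)" by (simp add: Y_def c.Y_def W H fr(3)[OF v] fr(6)[OF v])
  have "?k v \<noteq> 0" using fr(1)[OF v] by auto
  then have "ip \<epsilon> y (X v) = 0 \<longleftrightarrow> ip \<epsilon> y (c.X (\<psi> v)) = 0" for y
    by (subst fr(2)[OF v]) (simp add: ip_simps)
  then show "K v = c.K (\<psi> v)" by (simp add: K_def c.K_def W)
qed

end

locale pmc_surface =
  fixes \<epsilon> :: real and X :: "'m topology" and A :: "'m atlas" and f :: "'m \<Rightarrow> 'n::finite amb"
  assumes eps: "\<epsilon> \<in> {-1, 1}"
    and surface: "smooth_surface X A"
    and conn: "connected_space X"
    and immersion: "immersion_QR \<epsilon> X A f"
    and classA: "class_A \<epsilon> A f"
    and pmc: "parallel_mean_curv \<epsilon> A f"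
begin

section \<open>Chart-independent data on the surface\<close>

lemma chart:
  assumes "(U, \<phi>) \<in> A"
  shows "class_A_chart \<epsilon> (f \<circ> \<phi>) U" "openin X (\<phi> ` U)"
    "homeomorphic_map (top_of_set U) (subtopology X (\<phi> ` U)) \<phi>"
    "\<phi> ` U \<subseteq> topspace X"
proof -
  show op: "openin X (\<phi> ` U)" "homeomorphic_map (top_of_set U) (subtopology X (\<phi> ` U)) \<phi>"
    using assms surface unfolding smooth_surface_def by blast+
  show sub: "\<phi> ` U \<subseteq> topspace X" using op(1) by (rule openin_subset)
  show "class_A_chart \<epsilon> (f \<circ> \<phi>) U"
  proof
    show "\<epsilon> \<in> {-1, 1}" by (rule eps)
    show "open U" using assms surface unfolding smooth_surface_def by blast
    show "smooth_on U (f \<circ> \<phi>)" using assms immersion unfolding immersion_QR_def by blast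
    fix u assume u: "u \<in> U"
    show "inj (D (f \<circ> \<phi>) u)" using assms immersion u unfolding immersion_QR_def by blast
    show "(f \<circ> \<phi>) u \<in> QR \<epsilon>" using immersion sub u unfolding immersion_QR_def by auto
    show "T_field \<epsilon> (f \<circ> \<phi>) u \<noteq> 0" using assms classA u unfolding class_A_def Let_def by blast
    show "\<exists>c. shape_op \<epsilon> (f \<circ> \<phi>) u \<zeta> (T_field \<epsilon> (f \<circ> \<phi>) u) = c *\<^sub>R T_field \<epsilon> (f \<circ> \<phi>) u"
      if "\<zeta> \<in> normal_space \<epsilon> (f \<circ> \<phi>) u" for \<zeta>
      using assms classA u that unfolding class_A_def Let_def by blast
    show "normal_conn \<epsilon> (f \<circ> \<phi>) (mean_curv \<epsilon> (f \<circ> \<phi>)) u w = 0" for w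
      using assms pmc u unfolding parallel_mean_curv_def Let_def by blast
  qed
qed

lemma open_image:
  assumes "(U, \<phi>) \<in> A" "open N" "N \<subseteq> U"
  shows "openin X (\<phi> ` N)"
proof -
  have "openin (top_of_set U) N" using assms by (auto simp: openin_open)
  then have "openin (subtopology X (\<phi> ` U)) (\<phi> ` N)"
    using homeomorphic_imp_open_map[OF chart(3)[OF assms(1)]] unfolding open_map_def by blast
  then show ?thesis using chart(2)[OF assms(1)] openin_trans_full by blast
qed

text \<open>An arbitrary choice of chart around each point; \<open>chart_data\<close> shows that the
  data derived from it do not depend on the choice.\<close>

definition chart_at :: "'m \<Rightarrow> (real^2) set \<times> (real^2 \<Rightarrow> 'm) \<times> (real^2)" where
  "chart_at p = (SOME (U, \<phi>, u). (U, \<phi>) \<in> A \<and> u \<in> U \<and> \<phi> u = p)"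

lemma chart_at:
  assumes "p \<in> topspace X"
  obtains U \<phi> u where "chart_at p = (U, \<phi>, u)" "(U, \<phi>) \<in> A" "u \<in> U" "\<phi> u = p"
proof -
  obtain U \<phi> u where "(U, \<phi>) \<in> A" "u \<in> U" "\<phi> u = p"
  proof -
    have "p \<in> (\<Union>(U, \<phi>)\<in>A. \<phi> ` U)" using assms surface unfolding smooth_surface_def by simp
    then show thesis using that by auto
  qed
  then have "case (U, \<phi>, u) of (U, \<phi>, u) \<Rightarrow> (U, \<phi>) \<in> A \<and> u \<in> U \<and> \<phi> u = p" by simp
  then have "case chart_at p of (U, \<phi>, u) \<Rightarrow> (U, \<phi>) \<in> A \<and> u \<in> U \<and> \<phi> u = p"
    unfolding chart_at_def by (rule someI)
  then show thesis using that by (cases "chart_at p") auto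
qed

definition Ym :: "'m \<Rightarrow> 'n state" where
  "Ym p = (case chart_at p of (U, \<phi>, u) \<Rightarrow> class_A_chart.Y \<epsilon> (f \<circ> \<phi>) u)"
definition Km :: "'m \<Rightarrow> 'n amb set" where
  "Km p = (case chart_at p of (U, \<phi>, u) \<Rightarrow> class_A_chart.K \<epsilon> (f \<circ> \<phi>) u)"
definition hm :: "'m \<Rightarrow> real" where "hm p = snd (snd (f p))"

text \<open>The two charts are compared by \<open>chart_change\<close> along the transition map,
  which is smooth on the open overlap by \<open>smooth_surface\<close>.\<close>

lemma chart_data:
  assumes A: "(U, \<phi>) \<in> A" and u: "u \<in> U"
  shows "Ym (\<phi> u) = class_A_chart.Y \<epsilon> (f \<circ> \<phi>) u" "Km (\<phi> u) = class_A_chart.K \<epsilon> (f \<circ> \<phi>) u"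
proof -
  have "\<phi> u \<in> topspace X" using chart(4)[OF A] u by blast
  then obtain U' \<phi>' u' where ch: "chart_at (\<phi> u) = (U', \<phi>', u')" and A': "(U', \<phi>') \<in> A" and u': "u' \<in> U'" "\<phi>' u' = \<phi> u"
    by (rule chart_at)
  interpret a: class_A_chart \<epsilon> "f \<circ> \<phi>" U by (rule chart[OF A])
  let ?\<psi> = "inv_into U' \<phi>' \<circ> \<phi>"
  define N where "N = {v \<in> U. \<phi> v \<in> \<phi>' ` U'}"
  have "continuous_map (top_of_set U) X \<phi>"
    using homeomorphic_imp_continuous_map[OF chart(3)[OF A]] continuous_map_in_subtopology by blast
  then have "openin (top_of_set U) {v \<in> topspace (top_of_set U). \<phi> v \<in> \<phi>' ` U'}"
    using chart(2)[OF A'] openin_continuous_map_preimage by blast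
  then have "openin (top_of_set U) N" by (simp add: N_def)
  then have N: "open N" "N \<subseteq> U" using a.open_U by (auto simp: openin_open_eq N_def)
  have "\<forall>(U, \<phi>)\<in>A. \<forall>(U', \<phi>')\<in>A. smooth_on {u \<in> U. \<phi> u \<in> \<phi>' ` U'} (inv_into U' \<phi>' \<circ> \<phi>)"
    using surface unfolding smooth_surface_def by (elim conjE)
  from bspec[OF bspec[OF this A, unfolded prod.case] A', unfolded prod.case]
  have sm: "smooth_on N ?\<psi>" unfolding N_def .
  have inv: "\<phi>' (?\<psi> v) = \<phi> v" "?\<psi> v \<in> U'" if "v \<in> N" for v
    using that by (auto simp: N_def f_inv_into_f inv_into_into)
  have inj: "inj_on \<phi>' U'"
    using homeomorphic_imp_injective_map[OF chart(3)[OF A']] by simp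
  have uN: "u \<in> N" using u u' by (force simp: N_def)
  have "?\<psi> u = u'" using inj u' by (metis comp_apply inv_into_f_f)
  moreover have "a.K u = class_A_chart.K \<epsilon> (f \<circ> \<phi>') (?\<psi> u) \<and> a.Y u = class_A_chart.Y \<epsilon> (f \<circ> \<phi>') (?\<psi> u)"
  proof (rule conjI; rule a.chart_change[OF chart(1)[OF A'] N, where \<psi>' = "\<lambda>v w. D ?\<psi> v w"])
    show "?\<psi> ` N \<subseteq> U'" "?\<psi> ` N \<subseteq> U'" using inv by blast+
    show "\<forall>v\<in>N. (f \<circ> \<phi>) v = (f \<circ> \<phi>') (?\<psi> v)" "\<forall>v\<in>N. (f \<circ> \<phi>) v = (f \<circ> \<phi>') (?\<psi> v)"
      using inv(1) by simp_all
    show "\<forall>v\<in>N. (?\<psi> has_derivative D ?\<psi> v) (at v)" "\<forall>v\<in>N. (?\<psi> has_derivative D ?\<psi> v) (at v)"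
      using smooth_on_has_derivative[OF sm] by blast+
  qed (rule uN)+
  ultimately show "Ym (\<phi> u) = class_A_chart.Y \<epsilon> (f \<circ> \<phi>) u" "Km (\<phi> u) = class_A_chart.K \<epsilon> (f \<circ> \<phi>) u"
    by (simp_all add: Ym_def Km_def ch)
qed

text \<open>The relations of a chart, stated without it. The horizontal unit vector is quantified
  existentially, being defined only up to sign.\<close>

lemma frame_at:
  assumes "p \<in> topspace X"
  defines "Z \<equiv> Ym p"
  shows "f p = pq Z + hm p *\<^sub>R e_last" "ip \<epsilon> (pq Z) (pq Z) = \<epsilon>" "ip \<epsilon> (pq Z) e_last = 0"
    "ip \<epsilon> (pS Z) e_last = 1" "ip \<epsilon> (pW Z) (pq Z) = -1" "e_last \<in> Km p"
    "f p \<in> QR \<epsilon>"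
    "\<exists>X0. ip \<epsilon> X0 X0 = 1 \<and> ip \<epsilon> (pq Z) X0 = 0 \<and> ip \<epsilon> (pS Z) X0 = 0 \<and> ip \<epsilon> (pW Z) X0 = 0 \<and>
       ip \<epsilon> (pH Z) X0 = 0 \<and> Km p = {y. ip \<epsilon> y X0 = 0 \<and> ip \<epsilon> y (pW Z) = 0}"
proof -
  obtain U \<phi> u where A: "(U, \<phi>) \<in> A" and u: "u \<in> U" "\<phi> u = p"
    using chart_at[OF assms(1)] by metis
  interpret a: class_A_chart \<epsilon> "f \<circ> \<phi>" U by (rule chart[OF A])
  have Z: "Z = a.Y u" using chart_data(1)[OF A u(1)] u(2) by (simp add: Z_def)
  have K: "Km p = a.K u" using chart_data(2)[OF A u(1)] u(2) by simp
  have h: "hm p = a.ht u" by (simp add: hm_def a.ht_def u(2))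
  show "f p = pq Z + hm p *\<^sub>R e_last" using a.x_eq[of u] by (simp add: Z a.Y_def h u(2))
  show "ip \<epsilon> (pq Z) (pq Z) = \<epsilon>" "ip \<epsilon> (pq Z) e_last = 0" "ip \<epsilon> (pS Z) e_last = 1" "ip \<epsilon> (pW Z) (pq Z) = -1"
    using a.q_q[OF u(1)] a.q_e a.S_e[OF u(1)] a.W_q[OF u(1)] by (simp_all add: Z a.Y_def)
  show "e_last \<in> Km p" using a.e_in_K[OF u(1)] K by simp
  show "f p \<in> QR \<epsilon>" using a.in_QR[OF u(1)] u(2) by simp
  show "\<exists>X0. ip \<epsilon> X0 X0 = 1 \<and> ip \<epsilon> (pq Z) X0 = 0 \<and> ip \<epsilon> (pS Z) X0 = 0 \<and> ip \<epsilon> (pW Z) X0 = 0 \<and>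
       ip \<epsilon> (pH Z) X0 = 0 \<and> Km p = {y. ip \<epsilon> y X0 = 0 \<and> ip \<epsilon> y (pW Z) = 0}"
    by (rule exI[of _ "a.X u"])
      (simp add: Z a.Y_def K a.K_def a.X_X[OF u(1)] a.X_q[OF u(1)] ip_commute[of _ "a.q u" "a.X u"]
        a.S_X[OF u(1)] a.W_X[OF u(1)] a.H_orth[OF u(1)])
qed

lemma local_profile:
  assumes p1: "p1 \<in> topspace X"
  obtains N J Z M where "openin X N" "p1 \<in> N" "open J" "is_interval J" "profile_solution \<epsilon> J Z"
    "\<And>t. t \<in> J \<Longrightarrow> \<exists>p\<in>N. hm p = t \<and> Ym p = Z t"
    "\<And>p. p \<in> N \<Longrightarrow> hm p \<in> J \<and> Km p = Km p1 \<and> (\<exists>L\<in>isometries_fixing \<epsilon> (Km p1). Ym p = map_state L (Z (hm p)))"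
    "open M" "f p1 \<in> M"
    "\<And>z. z \<in> M \<Longrightarrow> snd (snd z) \<in> J"
    "\<And>z. z \<in> M \<Longrightarrow> (\<And>y. y \<in> Km p1 \<Longrightarrow> ip \<epsilon> y (z - (pq (Z (snd (snd z))) + snd (snd z) *\<^sub>R e_last)) = 0) \<Longrightarrow>
      ip \<epsilon> (Q_part z) (Q_part z) = \<epsilon> \<Longrightarrow> z \<in> f ` topspace X"
proof -
  obtain U \<phi> u1 where A: "(U, \<phi>) \<in> A" and u1: "u1 \<in> U" "\<phi> u1 = p1"
    using chart_at[OF assms(1)] by metis
  interpret a: class_A_chart \<epsilon> "f \<circ> \<phi>" U by (rule chart[OF A])
  note data = chart_data[OF A]
  from a.local_structure[OF u1(1)] obtain N J c M where
    N: "open N" "u1 \<in> N" "N \<subseteq> U" and J: "open J" "is_interval J"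
    and sol: "profile_solution \<epsilon> J (\<lambda>t. a.Y (c t))" and c: "\<And>t. t \<in> J \<Longrightarrow> c t \<in> N \<and> a.ht (c t) = t"
    and NL: "\<And>u. u \<in> N \<Longrightarrow> a.ht u \<in> J \<and> a.K u = a.K u1 \<and> (\<exists>L\<in>isometries_fixing \<epsilon> (a.K u1). a.Y u = map_state L (a.Y (c (a.ht u))))"
    and M: "open M" "(f \<circ> \<phi>) u1 \<in> M" and MJ: "\<And>z. z \<in> M \<Longrightarrow> snd (snd z) \<in> J"
    and Mz: "\<And>z. z \<in> M \<Longrightarrow> (\<forall>y\<in>a.K u1. ip \<epsilon> y (z - (f \<circ> \<phi>) (c (snd (snd z)))) = 0) \<Longrightarrow> ip \<epsilon> (Q_part z) (Q_part z) = \<epsilon> \<Longrightarrow> z \<in> (f \<circ> \<phi>) ` U"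
    by (elim exE conjE) metis
  have ht: "hm (\<phi> u) = a.ht u" for u by (simp add: hm_def a.ht_def)
  have K1: "Km p1 = a.K u1" using data(2)[OF u1(1)] u1(2) by simp
  show thesis
  proof (rule that[of "\<phi> ` N" J "\<lambda>t. a.Y (c t)" M])
    show "openin X (\<phi> ` N)" by (rule open_image[OF A N(1,3)])
    show "p1 \<in> \<phi> ` N" using N(2) u1(2) by blast
    show "\<exists>p\<in>\<phi> ` N. hm p = t \<and> Ym p = a.Y (c t)" if "t \<in> J" for t
      using c[OF that] data(1) N(3) ht by (intro bexI[of _ "\<phi> (c t)"]) auto
    show "hm p \<in> J \<and> Km p = Km p1 \<and> (\<exists>L\<in>isometries_fixing \<epsilon> (Km p1). Ym p = map_state L (a.Y (c (hm p))))"
      if "p \<in> \<phi> ` N" for p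
      using that NL N(3) data K1 ht by (auto simp: subset_iff)
    show "f p1 \<in> M" using M(2) u1(2) by simp
    show "z \<in> f ` topspace X" if z: "z \<in> M"
      and perp: "\<And>y. y \<in> Km p1 \<Longrightarrow> ip \<epsilon> y (z - (pq (a.Y (c (snd (snd z)))) + snd (snd z) *\<^sub>R e_last)) = 0"
      and n: "ip \<epsilon> (Q_part z) (Q_part z) = \<epsilon>" for z
    proof -
      have "(f \<circ> \<phi>) (c (snd (snd z))) = pq (a.Y (c (snd (snd z)))) + snd (snd z) *\<^sub>R e_last"
        using a.x_eq[of "c (snd (snd z))"] c[OF MJ[OF z]] by (simp add: a.Y_def)
      then have "z \<in> (f \<circ> \<phi>) ` U" using Mz[OF z _ n] perp K1 by metis
      then show ?thesis using chart(4)[OF A] by auto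
    qed
  qed (use J sol M MJ in auto)
qed

text \<open>The last hypothesis makes both \<open>P\<close> and its complement open.\<close>

lemma connected_induct:
  assumes "P \<subseteq> topspace X" "P \<noteq> {}"
    and "\<And>p. p \<in> topspace X \<Longrightarrow> \<exists>N. openin X N \<and> p \<in> N \<and> (N \<inter> P \<noteq> {} \<longrightarrow> N \<subseteq> P)"
  shows "P = topspace X"
proof -
  have "openin X P"
    by (subst openin_subopen) (use assms in blast)
  moreover have "openin X (topspace X - P)"
  proof (subst openin_subopen, intro ballI)
    fix p assume p: "p \<in> topspace X - P"
    then obtain N where N: "openin X N" "p \<in> N" "N \<inter> P \<noteq> {} \<longrightarrow> N \<subseteq> P" using assms(3) by blast
    then have "N \<subseteq> topspace X - P" using p openin_subset by blast
    then show "\<exists>T. openin X T \<and> p \<in> T \<and> T \<subseteq> topspace X - P" using N by blast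
  qed
  ultimately show ?thesis using conn assms(1,2) by (auto simp: connected_space_clopen_in closedin_def)
qed

lemma Km_constant:
  assumes p0: "p0 \<in> topspace X" and p: "p \<in> topspace X"
  shows "Km p = Km p0"
proof -
  have "{p \<in> topspace X. Km p = Km p0} = topspace X"
  proof (rule connected_induct)
    fix p1 assume "p1 \<in> topspace X"
    then obtain N where N: "openin X N" "p1 \<in> N" "\<And>p. p \<in> N \<Longrightarrow> Km p = Km p1"
      by (rule local_profile) blast
    have "N \<subseteq> {p \<in> topspace X. Km p = Km p0}" if "p \<in> N" "Km p = Km p0" for p
      using N(3) that openin_subset[OF N(1)] by auto
    then show "\<exists>N. openin X N \<and> p1 \<in> N \<and> (N \<inter> {p \<in> topspace X. Km p = Km p0} \<noteq> {} \<longrightarrow> N \<subseteq> {p \<in> topspace X. Km p = Km p0})"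
      using N(1,2) by (intro exI[of _ N] conjI impI) auto
  qed (use p0 in auto)
  then show ?thesis using p by blast
qed

text \<open>The last clause ties every height in \<open>I\<close> to a point of the surface.
  Algebraic relations can thus be transported from the surface to \<open>Z\<close>, instead of being
  derived from the differential equation.\<close>

definition profile :: "'m \<Rightarrow> real set \<Rightarrow> (real \<Rightarrow> 'n state) \<Rightarrow> bool" where
  "profile p0 I Z \<longleftrightarrow> open I \<and> is_interval I \<and> hm p0 \<in> I \<and> profile_solution \<epsilon> I Z \<and> Z (hm p0) = Ym p0 \<and>
     (\<forall>t\<in>I. \<exists>p\<in>topspace X. \<exists>L\<in>isometries_fixing \<epsilon> (Km p0). hm p = t \<and> Ym p = map_state L (Z t))"

text \<open>Continuation takes place over the surface, not over the height axis, since points of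
  equal height may be far apart. A local profile sharing a point with a given one is moved onto it
  by an isometry, agrees with it on the common heights by uniqueness, and extends it.\<close>

lemma profile_covers:
  assumes p0: "p0 \<in> topspace X" and p: "p \<in> topspace X"
  shows "\<exists>I Z. profile p0 I Z \<and> hm p \<in> I \<and> (\<exists>L\<in>isometries_fixing \<epsilon> (Km p0). Ym p = map_state L (Z (hm p)))"
proof -
  let ?G = "isometries_fixing \<epsilon> (Km p0)"
  note e0 = frame_at(6)[OF p0]
  define P where "P = {p \<in> topspace X. \<exists>I Z. profile p0 I Z \<and> hm p \<in> I \<and> (\<exists>L\<in>?G. Ym p = map_state L (Z (hm p)))}"
  have "P = topspace X"
  proof (rule connected_induct)
    show "P \<subseteq> topspace X" by (auto simp: P_def)
    from p0 obtain N J Z where N: "openin X N" "p0 \<in> N" and J: "open J" "is_interval J" and Z: "profile_solution \<epsilon> J Z"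
      and Zp: "\<And>t. t \<in> J \<Longrightarrow> \<exists>p\<in>N. hm p = t \<and> Ym p = Z t"
      and pZ: "\<And>p. p \<in> N \<Longrightarrow> hm p \<in> J \<and> Km p = Km p0 \<and> (\<exists>L\<in>?G. Ym p = map_state L (Z (hm p)))"
      by (rule local_profile) blast
    obtain L where L: "L \<in> ?G" "Ym p0 = map_state L (Z (hm p0))" using pZ[OF N(2)] by blast
    obtain L' where L': "L' \<in> ?G" "\<And>x. L' (L x) = x" using isometries_fixing_inverse[OF eps L(1)] by metis
    \<comment> \<open>The local solution is moved so as to pass through \<open>Ym p0\<close> itself
      at the base height.\<close>
    have "profile p0 J (\<lambda>t. map_state L (Z t))"
      unfolding profile_def
    proof (intro conjI ballI)
      fix t assume t: "t \<in> J"
      obtain p where p: "p \<in> N" "hm p = t" "Ym p = Z t" using Zp[OF t] by blast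
      then have "p \<in> topspace X" "Ym p = map_state L' (map_state L (Z t))"
        using openin_subset[OF N(1)] by (auto simp: map_state_cancel L'(2))
      then show "\<exists>p\<in>topspace X. \<exists>L''\<in>?G. hm p = t \<and> Ym p = map_state L'' (map_state L (Z t))"
        using p L' by blast
    qed (use J L pZ[OF N(2)] profile_solution_map_state[OF L(1) e0 Z] in auto)
    moreover have "Ym p0 = map_state (\<lambda>x. x) (map_state L (Z (hm p0)))" using L by (simp add: map_state_id)
    ultimately have "p0 \<in> P" unfolding P_def using p0 pZ[OF N(2)] isometries_fixing_id by blast
    then show "P \<noteq> {}" by blast
    fix p1 assume p1: "p1 \<in> topspace X"
    have K1: "Km p1 = Km p0" by (rule Km_constant[OF p0 p1])
    from p1 obtain N J Z1 where N: "openin X N" "p1 \<in> N" and J: "open J" "is_interval J" and Z1: "profile_solution \<epsilon> J Z1"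
      and Zp: "\<And>t. t \<in> J \<Longrightarrow> \<exists>p\<in>N. hm p = t \<and> Ym p = Z1 t"
      and pZ: "\<And>p. p \<in> N \<Longrightarrow> hm p \<in> J \<and> Km p = Km p1 \<and> (\<exists>L\<in>isometries_fixing \<epsilon> (Km p1). Ym p = map_state L (Z1 (hm p)))"
      by (rule local_profile) blast
    have "N \<subseteq> P" if p2: "p2 \<in> N" "p2 \<in> P" for p2
    proof -
      let ?t = "hm p2"
      obtain I Z L where IZ: "profile p0 I Z" and tI: "?t \<in> I" and L: "L \<in> ?G" "Ym p2 = map_state L (Z ?t)"
        using p2(2) unfolding P_def by blast
      obtain L1 where tJ: "?t \<in> J" and L1: "L1 \<in> ?G" "Ym p2 = map_state L1 (Z1 ?t)" using pZ[OF p2(1)] K1 by auto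
      obtain L' where L': "L' \<in> ?G" "\<And>x. L' (L x) = x" using isometries_fixing_inverse[OF eps L(1)] by metis
      \<comment> \<open>\<open>L2\<close> moves the local solution so that it meets \<open>Z\<close>
        at the height of the common point \<open>p2\<close>.\<close>
      define L2 where "L2 = L' \<circ> L1"
      have L2: "L2 \<in> ?G" unfolding L2_def by (rule isometries_fixing_comp[OF L'(1) L1(1)])
      obtain L3 where L3: "L3 \<in> ?G" "\<And>x. L3 (L2 x) = x" using isometries_fixing_inverse[OF eps L2] by metis
      define Z2 where "Z2 t = map_state L2 (Z1 t)" for t
      have Z2: "profile_solution \<epsilon> J Z2" unfolding Z2_def by (rule profile_solution_map_state[OF L2 e0 Z1])
      have eq: "Z ?t = Z2 ?t"
        unfolding Z2_def L2_def map_state_comp[symmetric] L1(2)[symmetric] L(2) by (simp add: map_state_cancel L'(2))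
      have I: "open I" "is_interval I" "profile_solution \<epsilon> I Z" "hm p0 \<in> I"
        using IZ by (auto simp: profile_def)
      have agree: "Z t = Z2 t" if "t \<in> I" "t \<in> J" for t
      proof (rule profile_solution_unique[where I = "I \<inter> J" and ?t0.0 = "hm p2"])
        show "is_interval (I \<inter> J)" using I J by (simp add: is_interval_Int)
        show "profile_solution \<epsilon> (I \<inter> J) Z" "profile_solution \<epsilon> (I \<inter> J) Z2"
          using I(3) Z2 by (auto simp: profile_solution_def)
      qed (use tI tJ that eq in auto)
      define Z3 where "Z3 t = (if t \<in> I then Z t else Z2 t)" for t
      have Z3I: "Z3 t = Z t" if "t \<in> I" for t using that by (simp add: Z3_def)
      have Z3J: "Z3 t = Z2 t" if "t \<in> J" for t using that agree by (simp add: Z3_def)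
      have "profile_solution \<epsilon> (I \<union> J) Z3"
        unfolding profile_solution_def
      proof
        fix t assume "t \<in> I \<union> J"
        then consider "t \<in> I" | "t \<in> J" by blast
        then show "(Z3 has_vector_derivative profile_field \<epsilon> (Z3 t)) (at t)"
        proof cases
          case 1
          then have "(Z has_vector_derivative profile_field \<epsilon> (Z3 t)) (at t)"
            using I(3) by (simp add: profile_solution_def Z3I)
          then show ?thesis
            by (rule has_vector_derivative_transform_within_open[OF _ I(1) 1]) (simp add: Z3I)
        next
          case 2
          then have "(Z2 has_vector_derivative profile_field \<epsilon> (Z3 t)) (at t)"
            using Z2 by (simp add: profile_solution_def Z3J)
          then show ?thesis
            by (rule has_vector_derivative_transform_within_open[OF _ J(1) 2]) (simp add: Z3J)
        qed
      qed
      moreover have "is_interval (I \<union> J)"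
        using I(2) J(2) tI tJ connected_Un[of I J] by (auto simp: is_interval_connected_1)
      moreover have "\<exists>p\<in>topspace X. \<exists>L\<in>?G. hm p = t \<and> Ym p = map_state L (Z3 t)" if "t \<in> I \<union> J" for t
      proof (cases "t \<in> I")
        case True
        then show ?thesis using IZ by (auto simp: profile_def Z3I)
      next
        case False
        then have t: "t \<in> J" using that by blast
        obtain p where p: "p \<in> N" "hm p = t" "Ym p = Z1 t" using Zp[OF t] by blast
        then have "p \<in> topspace X" "Ym p = map_state L3 (Z3 t)"
          using openin_subset[OF N(1)] by (auto simp: Z3J[OF t] Z2_def map_state_cancel L3(2))
        then show ?thesis using p L3(1) by blast
      qed
      ultimately have prof: "profile p0 (I \<union> J) Z3"
        unfolding profile_def using I J(1) IZ by (auto simp: Z3I profile_def)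
      show "N \<subseteq> P"
      proof
        fix p assume p: "p \<in> N"
        then have top: "p \<in> topspace X" using openin_subset[OF N(1)] by blast
        obtain L4 where L4: "L4 \<in> ?G" "Ym p = map_state L4 (Z1 (hm p))" and h: "hm p \<in> J" using pZ[OF p] K1 by auto
        have "Ym p = map_state (L4 \<circ> L3) (Z3 (hm p))"
          using L4(2) by (simp add: Z3J[OF h] Z2_def map_state_comp[symmetric] map_state_cancel L3(2))
        then show "p \<in> P"
          unfolding P_def using prof h top isometries_fixing_comp[OF L4(1) L3(1)] by blast
      qed
    qed
    then show "\<exists>N. openin X N \<and> p1 \<in> N \<and> (N \<inter> P \<noteq> {} \<longrightarrow> N \<subseteq> P)" using N by blast
  qed
  then show ?thesis using p by (auto simp: P_def)
qed

lemma profiles_agree: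
  assumes "profile p0 I Z" "profile p0 I' Z'" "t \<in> I" "t \<in> I'"
  shows "Z t = Z' t"
proof (rule profile_solution_unique[where I = "I \<inter> I'" and ?t0.0 = "hm p0"])
  show "is_interval (I \<inter> I')" using assms by (simp add: is_interval_Int profile_def)
  show "profile_solution \<epsilon> (I \<inter> I') Z" "profile_solution \<epsilon> (I \<inter> I') Z'"
    using assms by (auto simp: profile_solution_def profile_def)
  show "hm p0 \<in> I \<inter> I'" "Z (hm p0) = Z' (hm p0)" using assms by (auto simp: profile_def)
qed (use assms in auto)

text \<open>All profiles take the value \<open>Ym p0\<close> at the height of \<open>p0\<close>, so
  they agree on overlaps and their union is one profile for the whole surface.\<close>

lemma global_profile:
  assumes p0: "p0 \<in> topspace X"
  obtains I Z where "profile p0 I Z"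
    "\<And>p. p \<in> topspace X \<Longrightarrow> hm p \<in> I \<and> (\<exists>L\<in>isometries_fixing \<epsilon> (Km p0). Ym p = map_state L (Z (hm p)))"
proof -
  define \<I> where "\<I> = {I. \<exists>Z. profile p0 I Z}"
  define Z where "Z t = (SOME z. \<exists>I Z'. profile p0 I Z' \<and> t \<in> I \<and> z = Z' t)" for t
  have Zeq: "Z t = Z' t" if "profile p0 I Z'" "t \<in> I" for t I Z'
  proof -
    have "\<exists>z. \<exists>I Z'. profile p0 I Z' \<and> t \<in> I \<and> z = Z' t" using that by blast
    then have "\<exists>I Z'. profile p0 I Z' \<and> t \<in> I \<and> Z t = Z' t" unfolding Z_def by (rule someI_ex)
    then show ?thesis using profiles_agree that by metis
  qed
  have "profile p0 (\<Union>\<I>) Z"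
    unfolding profile_def
  proof (intro conjI ballI)
    show "open (\<Union>\<I>)" by (auto simp: \<I>_def profile_def)
    have "connected (\<Union>\<I>)"
      by (rule connected_Union) (auto simp: \<I>_def profile_def is_interval_connected_1)
    then show "is_interval (\<Union>\<I>)" by (simp add: is_interval_connected_1)
    obtain I Z' where I: "profile p0 I Z'" using profile_covers[OF p0 p0] by blast
    then have h: "hm p0 \<in> I" by (simp add: profile_def)
    then show "hm p0 \<in> \<Union>\<I>" using I by (auto simp: \<I>_def)
    show "Z (hm p0) = Ym p0" using Zeq[OF I h] I by (simp add: profile_def)
    show "profile_solution \<epsilon> (\<Union>\<I>) Z"
      unfolding profile_solution_def
    proof
      fix t assume "t \<in> \<Union>\<I>"
      then obtain I Z' where I: "profile p0 I Z'" "t \<in> I" by (auto simp: \<I>_def)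
      then have "(Z' has_vector_derivative profile_field \<epsilon> (Z t)) (at t)" "open I"
        using Zeq[OF I] by (auto simp: profile_def profile_solution_def)
      then show "(Z has_vector_derivative profile_field \<epsilon> (Z t)) (at t)"
        by (rule has_vector_derivative_transform_within_open[OF _ _ I(2)]) (rule Zeq[OF I(1), symmetric])
    qed
    fix t assume "t \<in> \<Union>\<I>"
    then obtain I Z' where I: "profile p0 I Z'" "t \<in> I" by (auto simp: \<I>_def)
    then show "\<exists>p\<in>topspace X. \<exists>L\<in>isometries_fixing \<epsilon> (Km p0). hm p = t \<and> Ym p = map_state L (Z t)"
      using Zeq[OF I] by (auto simp: profile_def)
  qed
  moreover have "hm p \<in> \<Union>\<I> \<and> (\<exists>L\<in>isometries_fixing \<epsilon> (Km p0). Ym p = map_state L (Z (hm p)))"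
    if "p \<in> topspace X" for p
    using profile_covers[OF p0 that] Zeq unfolding \<I>_def by auto
  ultimately show thesis using that by blast
qed

end

section \<open>The rotational surface\<close>

lemma openin_top_of_set_local:
  assumes "S \<subseteq> R" "\<And>z. z \<in> S \<Longrightarrow> \<exists>M. open M \<and> z \<in> M \<and> M \<inter> R \<subseteq> S"
  shows "openin (top_of_set R) S"
proof -
  have "openin (top_of_set R) (R \<inter> \<Union>{M. open M \<and> M \<inter> R \<subseteq> S})"
    by (rule openin_open_Int, rule open_Union) simp
  moreover have "R \<inter> \<Union>{M. open M \<and> M \<inter> R \<subseteq> S} = S"
  proof (rule set_eqI, rule iffI)
    fix z assume z: "z \<in> S"
    from assms(2)[OF z] obtain M where M: "open M" "z \<in> M" "M \<inter> R \<subseteq> S" by (elim exE conjE)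
    then have "z \<in> \<Union>{M. open M \<and> M \<inter> R \<subseteq> S}" by (intro UnionI[of M]) simp_all
    then show "z \<in> R \<inter> \<Union>{M. open M \<and> M \<inter> R \<subseteq> S}" using assms(1) z by (intro IntI) (rule subsetD)
  next
    fix z assume "z \<in> R \<inter> \<Union>{M. open M \<and> M \<inter> R \<subseteq> S}"
    then have z: "z \<in> R" "\<exists>M. z \<in> M \<and> M \<inter> R \<subseteq> S" by auto
    from z(2) obtain M where "z \<in> M" "M \<inter> R \<subseteq> S" by (elim exE conjE)
    then show "z \<in> S" using z(1) by (intro subsetD[of "M \<inter> R" S] IntI)
  qed
  ultimately show ?thesis by simp
qed

lemma continuous_on_interval_pos:
  fixes g :: "real \<Rightarrow> real"
  assumes I: "is_interval I" and g: "continuous_on I g" and nz: "\<And>t. t \<in> I \<Longrightarrow> g t \<noteq> 0"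
    and t0: "t0 \<in> I" "g t0 > 0" and t: "t \<in> I"
  shows "g t > 0"
proof (rule ccontr)
  assume "\<not> g t > 0"
  moreover have "connected (g ` I)" using I g by (auto intro: connected_continuous_image simp: is_interval_connected_1)
  ultimately have "0 \<in> g ` I"
    using t0 t connectedD_interval[of "g ` I" "g t" "g t0" 0] by auto
  then show False using nz by auto
qed

text \<open>Each entry of \<open>profile_field\<close> is a combination of \<open>q\<close>,
  \<open>S\<close>, \<open>W\<close>, \<open>H\<close> and \<open>e_last\<close> with scalar
  coefficients. Regarding these as known functions of time, the images under \<open>l\<close> solve
  a homogeneous linear system. In effect, the span of \<open>e_last\<close> and the initial state is
  invariant.\<close>

lemma profile_solution_functional:
  fixes l :: "'n::finite amb \<Rightarrow> real"
  assumes I: "is_interval I" and t0: "t0 \<in> I" and t: "t \<in> I" and Z: "profile_solution \<epsilon> I Z"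
    and l: "bounded_linear l" and e: "l e_last = 0"
    and init: "l (pq (Z t0)) = 0" "l (pS (Z t0)) = 0" "l (pW (Z t0)) = 0" "l (pH (Z t0)) = 0"
  shows "l (pq (Z t)) = 0" "l (pS (Z t)) = 0" "l (pW (Z t)) = 0" "l (pH (Z t)) = 0"
proof -
  note lin = bounded_linear.linear[OF l]
  define lY :: "'n state \<Rightarrow> real \<times> real \<times> real \<times> real" where
    "lY Y = (l (pq Y), l (pS Y), l (pW Y), l (pH Y))" for Y
  have blY: "bounded_linear lY"
    unfolding lY_def
    by (intro bounded_linear_Pair bounded_linear_compose[OF l] bounded_linear_state)
  define C1 where "C1 t = ip \<epsilon> (pS (Z t)) (pS (Z t))" for t
  define C2 where "C2 t = 2 * C1 t * ip \<epsilon> (pH (Z t)) e_last" for t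
  define C3 where "C3 t = \<epsilon> * (2 * C1 t - 1)" for t
  define C4 where "C4 t = ip \<epsilon> (pW (Z t)) (pS (Z t))" for t
  define C5 where "C5 t = \<epsilon> * ip \<epsilon> (pH (Z t)) e_last" for t
  define C6 where "C6 t = 2 * ip \<epsilon> (pH (Z t)) (pH (Z t)) - ip \<epsilon> (pH (Z t)) (pW (Z t))" for t
  note cont = bounded_bilinear.continuous_on[OF bounded_bilinear_ip]
    bounded_linear.continuous_on[OF bounded_linear_state(1) profile_solution_continuous[OF Z]]
    bounded_linear.continuous_on[OF bounded_linear_state(2) profile_solution_continuous[OF Z]]
    bounded_linear.continuous_on[OF bounded_linear_state(3) profile_solution_continuous[OF Z]]
    bounded_linear.continuous_on[OF bounded_linear_state(4) profile_solution_continuous[OF Z]]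
  have "(\<lambda>t. lY (Z t)) t = 0"
  \<comment> \<open>The 1 comes from the first entry, the factor 3 from the bound for
    \<open>2 * d - c\<close>; the other terms are the remaining coefficients.\<close>
  proof (rule linear_growth_zero_continuous[OF I t0 t,
        where C = "\<lambda>t. 1 + 3 * \<bar>C1 t\<bar> + \<bar>C2 t\<bar> + \<bar>C3 t\<bar> + \<bar>C4 t\<bar> + \<bar>C5 t\<bar> + \<bar>C6 t\<bar>"
        and \<phi>' = "\<lambda>t. lY (profile_field \<epsilon> (Z t))"])
    show "continuous_on I (\<lambda>t. 1 + 3 * \<bar>C1 t\<bar> + \<bar>C2 t\<bar> + \<bar>C3 t\<bar> + \<bar>C4 t\<bar> + \<bar>C5 t\<bar> + \<bar>C6 t\<bar>)"
      unfolding C1_def C2_def C3_def C4_def C5_def C6_def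
      by (intro continuous_on_add continuous_on_mult continuous_on_rabs continuous_on_const continuous_on_diff cont)
    show "((\<lambda>t. lY (Z t)) has_vector_derivative lY (profile_field \<epsilon> (Z t))) (at t)" if "t \<in> I" for t
      using bounded_linear.has_vector_derivative[OF blY] Z that by (simp add: profile_solution_def)
    show "lY (Z t0) = 0" by (simp add: lY_def init zero_prod_def)
    fix t
    define a b c d where "a = l (pq (Z t))" and "b = l (pS (Z t))" and "c = l (pW (Z t))" and "d = l (pH (Z t))"
    define n where "n = norm (lY (Z t))"
    have Zn: "lY (Z t) = (a, b, c, d)" by (simp add: lY_def a_def b_def c_def d_def)
    have "norm (b, c, d) \<le> n" "norm (c, d) \<le> norm (b, c, d)"
      using norm_snd_le[of "(b, c, d)" a] norm_snd_le[of "(c, d)" b] by (simp_all add: n_def Zn)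
    then have n: "\<bar>a\<bar> \<le> n" "\<bar>b\<bar> \<le> n" "\<bar>c\<bar> \<le> n" "\<bar>d\<bar> \<le> n"
      using norm_fst_le[of a "(b, c, d)"] norm_fst_le[of b "(c, d)"] norm_fst_le[of c d] norm_snd_le[of d c]
      by (simp_all add: n_def Zn)
    have F: "lY (profile_field \<epsilon> (Z t)) =
      (b, C1 t * (2 * d - c) - C2 t * b - C3 t * a, C4 t * c, C5 t * a - C6 t * b)"
      by (simp add: lY_def profile_field_def linear_diff[OF lin] linear_scale[OF lin] e
          C1_def C2_def C3_def C4_def C5_def C6_def a_def b_def c_def d_def)
    have "norm (lY (profile_field \<epsilon> (Z t)))
      \<le> \<bar>b\<bar> + (\<bar>C1 t * (2 * d - c) - C2 t * b - C3 t * a\<bar> + (\<bar>C4 t * c\<bar> + \<bar>C5 t * a - C6 t * b\<bar>))"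
      unfolding F real_norm_def[symmetric]
      by (intro order_trans[OF norm_Pair_le] add_left_mono norm_Pair_le order_refl)
    also have "\<dots> \<le> n + ((\<bar>C1 t\<bar> * (3 * n) + \<bar>C2 t\<bar> * n + \<bar>C3 t\<bar> * n) + (\<bar>C4 t\<bar> * n + (\<bar>C5 t\<bar> * n + \<bar>C6 t\<bar> * n)))"
    proof (intro add_mono)
      show "\<bar>b\<bar> \<le> n" by fact
      have "\<bar>C1 t * (2 * d - c)\<bar> \<le> \<bar>C1 t\<bar> * (3 * n)"
        unfolding abs_mult by (rule mult_left_mono) (use n in linarith, simp)
      moreover have "\<bar>C2 t * b\<bar> \<le> \<bar>C2 t\<bar> * n" "\<bar>C3 t * a\<bar> \<le> \<bar>C3 t\<bar> * n"
        unfolding abs_mult by (intro mult_left_mono n abs_ge_zero)+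
      ultimately show "\<bar>C1 t * (2 * d - c) - C2 t * b - C3 t * a\<bar> \<le> \<bar>C1 t\<bar> * (3 * n) + \<bar>C2 t\<bar> * n + \<bar>C3 t\<bar> * n"
        by linarith
      show "\<bar>C4 t * c\<bar> \<le> \<bar>C4 t\<bar> * n" unfolding abs_mult by (intro mult_left_mono n abs_ge_zero)
      have "\<bar>C5 t * a\<bar> \<le> \<bar>C5 t\<bar> * n" "\<bar>C6 t * b\<bar> \<le> \<bar>C6 t\<bar> * n"
        unfolding abs_mult by (intro mult_left_mono n abs_ge_zero)+
      then show "\<bar>C5 t * a - C6 t * b\<bar> \<le> \<bar>C5 t\<bar> * n + \<bar>C6 t\<bar> * n" by linarith
    qed
    also have "\<dots> = (1 + 3 * \<bar>C1 t\<bar> + \<bar>C2 t\<bar> + \<bar>C3 t\<bar> + \<bar>C4 t\<bar> + \<bar>C5 t\<bar> + \<bar>C6 t\<bar>) * n"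
      by (simp add: algebra_simps)
    finally show "norm (lY (profile_field \<epsilon> (Z t))) \<le>
        (1 + 3 * \<bar>C1 t\<bar> + \<bar>C2 t\<bar> + \<bar>C3 t\<bar> + \<bar>C4 t\<bar> + \<bar>C5 t\<bar> + \<bar>C6 t\<bar>) * norm (lY (Z t))"
      by (simp add: n_def)
  qed
  then show "l (pq (Z t)) = 0" "l (pS (Z t)) = 0" "l (pW (Z t)) = 0" "l (pH (Z t)) = 0"
    by (simp_all add: lY_def zero_prod_def)
qed

text \<open>Reversed Cauchy-Schwarz inequality on one sheet of the hyperboloid; it shows below that
  a reflection keeps the sheet.\<close>

lemma QR_hyperbolic_ip_neg:
  assumes "p \<in> QR (-1)" "p' \<in> QR (-1)"
  shows "ip (-1) p (Q_part p') < 0"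
proof -
  obtain a b t where p: "p = (a, b, t)" by (cases p)
  obtain a' b' t' where p': "p' = (a', b', t')" by (cases p')
  have a: "a\<^sup>2 = 1 + b \<bullet> b" "a'\<^sup>2 = 1 + b' \<bullet> b'" and pos: "a > 0" "a' > 0"
    using assms by (auto simp: p p' QR_def)
  have "(b \<bullet> b')\<^sup>2 \<le> (b \<bullet> b) * (b' \<bullet> b')" using Cauchy_Schwarz_ineq[of b b'] by simp
  also have "\<dots> < (1 + b \<bullet> b) * (1 + b' \<bullet> b')"
    using inner_ge_zero[of b] inner_ge_zero[of b'] by (simp add: algebra_simps add_pos_nonneg)
  also have "\<dots> = (a * a')\<^sup>2" by (simp add: a power_mult_distrib)
  finally have "b \<bullet> b' < a * a'" using pos by (intro power2_less_imp_less[of "b \<bullet> b'"]) auto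
  then show ?thesis by (simp add: p p' ip_def Q_part_def)
qed

text \<open>The reflection along \<open>e_first - p\<close> swaps these two vectors of equal square
  norm. It is called for because \<open>flat_subspace\<close> asks for \<open>e_first\<close>,
  whereas the construction yields spaces through \<open>q0\<close>.\<close>

lemma ambient_isometry_to_e_first:
  fixes p :: "'n::finite amb"
  assumes eps: "\<epsilon> \<in> {-1, 1}" and p: "p \<in> QR \<epsilon>" and pe: "ip \<epsilon> p e_last = 0"
  obtains \<Phi> where "linear \<Phi>" "\<And>x. \<Phi> (\<Phi> x) = x" "\<And>x y. ip \<epsilon> (\<Phi> x) (\<Phi> y) = ip \<epsilon> x y"
    "\<Phi> e_last = e_last" "\<Phi> p = e_first" "\<Phi> ` QR \<epsilon> = QR \<epsilon>"
proof (cases "p = e_first")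
  case True
  show thesis by (rule that[of "\<lambda>x. x"]) (auto simp: linear_iff True)
next
  case False
  obtain a b t where abt: "p = (a, b, t)" by (cases p)
  have t0: "t = 0" using pe by (simp add: abt ip_e_last)
  have a: "\<epsilon> * a\<^sup>2 + b \<bullet> b = \<epsilon>" "\<epsilon> = -1 \<longrightarrow> a > 0" using p by (auto simp: abt QR_def)
  have Qp: "Q_part p = p" by (simp add: abt t0 Q_part_def)
  let ?f = "e_first :: 'n amb"
  have Qf: "Q_part ?f = ?f" by (simp add: e_first_def Q_part_def)
  have ff: "ip \<epsilon> ?f ?f = \<epsilon>" and fp: "ip \<epsilon> ?f p = \<epsilon> * a" and fe: "ip \<epsilon> ?f e_last = 0"
    by (simp_all add: ip_def e_first_def e_last_def abt)
  have pp: "ip \<epsilon> p p = \<epsilon>" using p by (simp add: QR_iff Qp)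
  have a1: "a \<noteq> 1"
  proof
    assume "a = 1"
    then have "b = 0" using a by simp
    then show False using False \<open>a = 1\<close> t0 by (simp add: abt e_first_def)
  qed
  define d where "d = ?f - p"
  have dd: "ip \<epsilon> d d = 2 * \<epsilon> * (1 - a)"
    by (simp add: d_def ip_simps ff fp pp ip_commute[of \<epsilon> p ?f] algebra_simps)
  then have dd0: "ip \<epsilon> d d \<noteq> 0" using a1 eps by auto
  define \<Phi> where "\<Phi> v = v - (2 * ip \<epsilon> v d / ip \<epsilon> d d) *\<^sub>R d" for v
  have lin: "linear \<Phi>"
    unfolding linear_iff \<Phi>_def by (simp add: ip_simps algebra_simps add_divide_distrib)
  have \<Phi>d: "ip \<epsilon> (\<Phi> v) d = - ip \<epsilon> v d" for v
    using dd0 by (simp add: \<Phi>_def ip_simps)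
  have inv: "\<Phi> (\<Phi> v) = v" for v
    unfolding \<Phi>_def[of "\<Phi> v"] \<Phi>d by (simp add: \<Phi>_def)
  have iso: "ip \<epsilon> (\<Phi> v) (\<Phi> w) = ip \<epsilon> v w" for v w
  proof -
    have "ip \<epsilon> (\<Phi> v) (\<Phi> w) = ip \<epsilon> (\<Phi> v) w - (2 * ip \<epsilon> w d / ip \<epsilon> d d) * ip \<epsilon> (\<Phi> v) d"
      by (simp add: \<Phi>_def[of w] ip_simps)
    also have "\<dots> = ip \<epsilon> v w"
      unfolding \<Phi>d using dd0 by (simp add: \<Phi>_def[of v] ip_simps ip_commute[of \<epsilon> d w])
    finally show ?thesis .
  qed
  have "ip \<epsilon> e_last d = 0" using pe fe by (simp add: d_def ip_simps ip_commute[of \<epsilon> e_last])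
  then have \<Phi>e: "\<Phi> e_last = e_last" by (simp add: \<Phi>_def)
  have "ip \<epsilon> p d = - (ip \<epsilon> d d) / 2"
    unfolding dd by (simp add: d_def ip_simps pp fp ip_commute[of \<epsilon> p ?f] algebra_simps)
  then have \<Phi>p: "\<Phi> p = ?f" using dd0 by (simp add: \<Phi>_def d_def)
  have sub: "\<Phi> y \<in> QR \<epsilon>" if y: "y \<in> QR \<epsilon>" for y
  proof -
    have ye: "ip \<epsilon> (\<Phi> y) e_last = ip \<epsilon> y e_last" using iso[of y e_last] \<Phi>e by simp
    have Q: "Q_part (\<Phi> y) = \<Phi> (Q_part y)"
      unfolding Q_part_eq[of _ \<epsilon>] ye by (simp add: linear_diff[OF lin] linear_scale[OF lin] \<Phi>e)
    \<comment> \<open>Up to sign the first coordinate of the image is the product of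
      \<open>y\<close> with \<open>p\<close>, two points of the same sheet.\<close>
    have "fst (\<Phi> y) > 0" if "\<epsilon> = -1"
    proof -
      have "- fst (\<Phi> y) = ip \<epsilon> (\<Phi> y) ?f" by (simp add: that ip_def e_first_def)
      also have "\<dots> = ip \<epsilon> y p" using iso[of y p] \<Phi>p by simp
      also have "\<dots> < 0" using QR_hyperbolic_ip_neg[of y p] y p Qp that by simp
      finally show ?thesis by simp
    qed
    then show ?thesis using y iso by (simp add: QR_iff Q)
  qed
  have "\<Phi> ` QR \<epsilon> = QR \<epsilon>"
  proof
    show "QR \<epsilon> \<subseteq> \<Phi> ` QR \<epsilon>" using sub inv by (metis image_eqI subsetI)
  qed (use sub in blast)
  then show thesis using that[OF lin inv iso \<Phi>e \<Phi>p] by blast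
qed

locale pmc_profile = pmc_surface \<epsilon> X A f
  for \<epsilon> :: real and X :: "'m topology" and A :: "'m atlas" and f :: "'m \<Rightarrow> 'n::finite amb" +
  fixes p0 :: 'm and I :: "real set" and Z :: "real \<Rightarrow> 'n state" and X0 :: "'n amb"
  assumes p0: "p0 \<in> topspace X" and profile: "profile p0 I Z"
    and cover: "\<And>p. p \<in> topspace X \<Longrightarrow> hm p \<in> I \<and> (\<exists>L\<in>isometries_fixing \<epsilon> (Km p0). Ym p = map_state L (Z (hm p)))"
    and X0: "ip \<epsilon> X0 X0 = 1" "ip \<epsilon> (pq (Ym p0)) X0 = 0" "ip \<epsilon> (pS (Ym p0)) X0 = 0"
      "ip \<epsilon> (pW (Ym p0)) X0 = 0" "ip \<epsilon> (pH (Ym p0)) X0 = 0"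
      "Km p0 = {y. ip \<epsilon> y X0 = 0 \<and> ip \<epsilon> y (pW (Ym p0)) = 0}"
begin

section \<open>The linear configuration at the base point\<close>

abbreviation e :: "'n amb" where "e \<equiv> e_last"
definition q0 :: "'n amb" where "q0 = pq (Ym p0)"
definition W0 :: "'n amb" where "W0 = pW (Ym p0)"
definition K0 :: "'n amb set" where "K0 = {y. ip \<epsilon> y X0 = 0 \<and> ip \<epsilon> y W0 = 0}"
text \<open>Six generators: \<open>e\<close>, the four entries of the state, and \<open>X0\<close>.
  They may be dependent, which only lowers the dimension.\<close>

definition V :: "'n amb set" where "V = span {e, q0, pS (Ym p0), X0, W0, pH (Ym p0)}"
definition P1 :: "'n amb set" where "P1 = {v \<in> V. ip \<epsilon> v X0 = 0}"
definition P0 :: "'n amb set" where "P0 = {v \<in> V. ip \<epsilon> v X0 = 0 \<and> ip \<epsilon> v W0 = 0}"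
definition \<alpha> :: "real \<Rightarrow> 'n amb" where "\<alpha> t = pq (Z t) + t *\<^sub>R e"

lemma K0: "Km p0 = K0" by (simp add: K0_def W0_def X0(6))

lemma e_K0: "e \<in> K0" using frame_at(6)[OF p0] K0 by simp

lemma base_frame:
  "ip \<epsilon> q0 q0 = \<epsilon>" "ip \<epsilon> q0 e = 0" "ip \<epsilon> q0 X0 = 0" "ip \<epsilon> X0 q0 = 0" "ip \<epsilon> W0 q0 = -1" "ip \<epsilon> q0 W0 = -1"
  "ip \<epsilon> W0 X0 = 0" "ip \<epsilon> X0 W0 = 0" "ip \<epsilon> e X0 = 0" "ip \<epsilon> e W0 = 0"
  using frame_at[OF p0] X0 e_K0 by (simp_all add: q0_def W0_def K0_def ip_commute)

lemma subspaces: "subspace V" "subspace P1" "subspace P0"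
proof -
  show V: "subspace V" by (simp add: V_def)
  then show "subspace P1" "subspace P0"
    unfolding subspace_def P1_def P0_def by (simp_all add: ip_simps)
qed

lemma V_members: "e \<in> V" "q0 \<in> V" "pS (Ym p0) \<in> V" "X0 \<in> V" "W0 \<in> V" "pH (Ym p0) \<in> V"
  unfolding V_def by (rule span_base; simp)+

lemma P_sub: "P0 \<subseteq> P1" "P1 \<subseteq> V" "P0 \<subseteq> K0"
  by (auto simp: P0_def P1_def K0_def)

lemma P_members: "e \<in> P0" "e \<in> P1" "q0 \<in> P1" "q0 \<notin> P0"
  using V_members base_frame by (simp_all add: P0_def P1_def)

lemma Q_part_q0: "Q_part q0 = q0" using Q_part_eq[of q0 \<epsilon>] base_frame by simp

text \<open>From \<open>P0\<close> to \<open>P1\<close> the vector \<open>q0\<close> is added, as it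
  pairs to -1 with \<open>W0\<close>; from \<open>P1\<close> to \<open>V\<close> the unit vector
  \<open>X0\<close>. Both steps also work for null \<open>W0\<close>, so the axis always has
  codimension 2 in \<open>V\<close>.\<close>

lemma dims: "dim V = dim P0 + 2" "dim P1 = dim P0 + 1" "dim P0 \<ge> 1" "dim P0 \<le> 4"
proof -
  have "P1 = span (insert q0 P0)"
  proof
    show "span (insert q0 P0) \<subseteq> P1"
      by (rule span_minimal) (use P_sub P_members subspaces in auto)
    show "P1 \<subseteq> span (insert q0 P0)"
    proof
      fix y assume y: "y \<in> P1"
      have "y + ip \<epsilon> y W0 *\<^sub>R q0 \<in> P0"
        using y V_members base_frame subspaces(1)
        by (auto simp: P1_def P0_def ip_simps intro!: subspace_add subspace_scale)
      then have "(y + ip \<epsilon> y W0 *\<^sub>R q0) - ip \<epsilon> y W0 *\<^sub>R q0 \<in> span (insert q0 P0)"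
        by (intro span_diff span_scale span_base) auto
      then show "y \<in> span (insert q0 P0)" by simp
    qed
  qed
  then have "dim P1 = dim (insert q0 P0)" by simp
  also have "\<dots> = dim P0 + 1"
    using P_members(4) subspaces(3) by (simp add: dim_insert span_eq_iff[THEN iffD2])
  finally show 1: "dim P1 = dim P0 + 1" .
  have "V = span (insert X0 P1)"
  proof
    show "span (insert X0 P1) \<subseteq> V"
      by (rule span_minimal) (use P_sub V_members subspaces in auto)
    show "V \<subseteq> span (insert X0 P1)"
    proof
      fix y assume y: "y \<in> V"
      have "y - ip \<epsilon> y X0 *\<^sub>R X0 \<in> P1"
        using y V_members X0(1) subspaces(1)
        by (auto simp: P1_def ip_simps intro!: subspace_diff subspace_scale)
      then have "(y - ip \<epsilon> y X0 *\<^sub>R X0) + ip \<epsilon> y X0 *\<^sub>R X0 \<in> span (insert X0 P1)"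
        by (intro span_add span_scale span_base) auto
      then show "y \<in> span (insert X0 P1)" by simp
    qed
  qed
  then have "dim V = dim (insert X0 P1)" by simp
  also have "\<dots> = dim P1 + 1"
  proof -
    have "span P1 = P1" using span_eq_iff subspaces(2) by blast
    moreover have "X0 \<notin> P1" using X0(1) by (simp add: P1_def)
    ultimately have "X0 \<notin> span P1" by metis
    then show ?thesis by (simp add: dim_insert)
  qed
  finally show 2: "dim V = dim P0 + 2" using 1 by simp
  have "dim V \<le> card {e, q0, pS (Ym p0), X0, W0, pH (Ym p0)}"
    unfolding V_def dim_span by (rule dim_le_card') simp
  also have "\<dots> \<le> 6" by (simp add: card_insert_if)
  finally show "dim P0 \<le> 4" using 2 by simp
  \<comment> \<open>A positive dimension of the axis makes \<open>dim P0 - 1\<close>, the later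
    value of \<open>s\<close>, a true difference of natural numbers.\<close>
  have "\<not> P0 \<subseteq> {0}" using P_members(1) by (auto simp: e_last_def zero_prod_def)
  then have "dim P0 \<noteq> 0" by (simp add: dim_eq_0)
  then show "dim P0 \<ge> 1" by linarith
qed

lemma I: "open I" "is_interval I" "hm p0 \<in> I" "profile_solution \<epsilon> I Z" "Z (hm p0) = Ym p0"
  using profile by (auto simp: profile_def)

lemma realized: "t \<in> I \<Longrightarrow> \<exists>p\<in>topspace X. \<exists>L\<in>isometries_fixing \<epsilon> K0. hm p = t \<and> Ym p = map_state L (Z t)"
  using profile K0 by (auto simp: profile_def)

text \<open>An isometry carries each \<open>Z t\<close> to the state of a surface point, where the
  relations are known.\<close>

lemma Z_frame:
  assumes t: "t \<in> I"
  shows "ip \<epsilon> (pq (Z t)) (pq (Z t)) = \<epsilon>" "ip \<epsilon> (pq (Z t)) e = 0" "ip \<epsilon> (pS (Z t)) e = 1"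
    "ip \<epsilon> (pW (Z t)) (pq (Z t)) = -1" "\<And>y. y \<in> K0 \<Longrightarrow> ip \<epsilon> y (pW (Z t)) = 0"
proof -
  obtain p L where p: "p \<in> topspace X" and L: "L \<in> isometries_fixing \<epsilon> K0" and Y: "Ym p = map_state L (Z t)"
    using realized[OF t] by blast
  note fr = frame_at(2-5)[OF p] and iso = isometries_fixingD(2)[OF L] and fx = isometries_fixingD(3)[OF L]
  note Le = fx[OF e_K0]
  have eq: "ip \<epsilon> (L y) e = ip \<epsilon> y e" for y using iso[of y e] Le by simp
  show "ip \<epsilon> (pq (Z t)) (pq (Z t)) = \<epsilon>" "ip \<epsilon> (pq (Z t)) e = 0" "ip \<epsilon> (pS (Z t)) e = 1"
    "ip \<epsilon> (pW (Z t)) (pq (Z t)) = -1"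
    using fr by (simp_all add: Y map_state_def iso eq)
  fix y assume y: "y \<in> K0"
  have "K0 = Km p" using Km_constant[OF p0 p] K0 by simp
  then have "ip \<epsilon> y (pW (Ym p)) = 0" using frame_at(8)[OF p] y by auto
  then have "ip \<epsilon> (L y) (L (pW (Z t))) = 0" by (simp add: Y map_state_def fx[OF y])
  then show "ip \<epsilon> y (pW (Z t)) = 0" by (simp add: iso)
qed

lemma Z_X0:
  assumes t: "t \<in> I"
  shows "ip \<epsilon> (pq (Z t)) X0 = 0" "ip \<epsilon> (pW (Z t)) X0 = 0"
proof -
  have bl: "bounded_linear (\<lambda>v. ip \<epsilon> v X0)"
    by (rule bounded_bilinear.bounded_linear_left[OF bounded_bilinear_ip])
  show "ip \<epsilon> (pq (Z t)) X0 = 0" "ip \<epsilon> (pW (Z t)) X0 = 0"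
    using profile_solution_functional[OF I(2,3) t I(4) bl] X0 base_frame by (simp_all add: I(5))
qed

text \<open>Invariance of the span, tested with Euclidean functionals, since the Euclidean double
  complement of a subspace is the subspace itself.\<close>

lemma Z_V: assumes t: "t \<in> I" shows "pq (Z t) \<in> V"
proof -
  have "pq (Z t) \<bullet> y = 0" if y: "y \<in> V\<^sup>\<bottom>" for y
  proof -
    have "v \<bullet> y = 0" if "v \<in> V" for v
      using y that by (simp add: orthogonal_comp_def orthogonal_def)
    then show ?thesis
      using profile_solution_functional(1)[OF I(2,3) t I(4) bounded_linear_inner_left] V_members
      by (simp add: I(5) q0_def W0_def)
  qed
  then have "pq (Z t) \<in> V\<^sup>\<bottom>\<^sup>\<bottom>" by (auto simp: orthogonal_comp_def orthogonal_def inner_commute)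
  then show ?thesis by (simp add: orthogonal_comp_self subspaces(1))
qed

lemma W_decomposition:
  assumes "\<And>y. y \<in> K0 \<Longrightarrow> ip \<epsilon> y z = 0"
  shows "z = ip \<epsilon> z X0 *\<^sub>R X0 - ip \<epsilon> z q0 *\<^sub>R W0"
proof (rule ip_eqI[OF eps])
  fix y
  have "y - ip \<epsilon> y X0 *\<^sub>R X0 + ip \<epsilon> y W0 *\<^sub>R q0 \<in> K0"
    by (simp add: K0_def ip_simps base_frame X0(1))
  from assms[OF this] show "ip \<epsilon> z y = ip \<epsilon> (ip \<epsilon> z X0 *\<^sub>R X0 - ip \<epsilon> z q0 *\<^sub>R W0) y"
    by (simp add: ip_simps ip_commute[of \<epsilon> y z] ip_commute[of \<epsilon> X0 z] ip_commute[of \<epsilon> q0 z]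
        ip_commute[of \<epsilon> X0 y] ip_commute[of \<epsilon> W0 y] algebra_simps)
qed

lemma continuous_Z: "continuous_on I (\<lambda>t. pq (Z t))" "continuous_on I (\<lambda>t. pW (Z t))"
  by (rule bounded_linear.continuous_on[OF bounded_linear_state(1) profile_solution_continuous[OF I(4)]],
      rule bounded_linear.continuous_on[OF bounded_linear_state(3) profile_solution_continuous[OF I(4)]])

text \<open>\<open>W\<close> stays a multiple of \<open>W0\<close>, and <W,q> = -1 keeps the factor
  from vanishing, so it remains positive as at the base point. The same relation then fixes the
  sign, and with it the side of the axis.\<close>

lemma W0_negative: assumes t: "t \<in> I" shows "ip \<epsilon> (pq (Z t)) W0 < 0"
proof -
  let ?\<omega> = "\<lambda>t. - ip \<epsilon> (pW (Z t)) q0"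
  have W: "pW (Z t) = ?\<omega> t *\<^sub>R W0" if "t \<in> I" for t
    using W_decomposition[OF Z_frame(5)[OF that]] Z_X0(2)[OF that] by simp
  have eq: "?\<omega> t * ip \<epsilon> W0 (pq (Z t)) = -1" if "t \<in> I" for t
    using Z_frame(4)[OF that] by (subst (asm) W[OF that]) (simp add: ip_simps)
  have "?\<omega> t > 0"
  proof (rule continuous_on_interval_pos[OF I(2) _ _ I(3) _ t])
    show "continuous_on I ?\<omega>"
      by (intro continuous_on_minus bounded_bilinear.continuous_on[OF bounded_bilinear_ip] continuous_Z continuous_on_const)
    show "?\<omega> t \<noteq> 0" if "t \<in> I" for t using eq[OF that] by auto
    show "?\<omega> (hm p0) > 0" using base_frame by (simp add: I(5) W0_def[symmetric])
  qed
  then have "ip \<epsilon> W0 (pq (Z t)) < 0" using eq[OF t] 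
    by (smt (verit) mult_nonneg_nonneg)
  then show ?thesis by (simp add: ip_commute)
qed

section \<open>The profile curve\<close>

lemma alpha_e: "t \<in> I \<Longrightarrow> ip \<epsilon> (\<alpha> t) e = t" "t \<in> I \<Longrightarrow> Q_part (\<alpha> t) = pq (Z t)"
  using Z_frame(2) by (simp_all add: \<alpha>_def ip_simps ip_e_last_e_last Q_part_eq[of _ \<epsilon>])

lemma alpha_P1: "t \<in> I \<Longrightarrow> \<alpha> t \<in> P1"
  using Z_V Z_X0(1) V_members subspaces(1) base_frame
  by (auto simp: \<alpha>_def P1_def ip_simps intro!: subspace_add subspace_scale)

text \<open>In the hyperbolic case \<open>q\<close> is timelike, so its first coordinate cannot
  vanish along the curve and stays positive.\<close>

lemma alpha_QR: assumes t: "t \<in> I" shows "\<alpha> t \<in> QR \<epsilon>"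
proof -
  have "fst (pq (Z t)) > 0" if "\<epsilon> = -1"
  proof (rule continuous_on_interval_pos[OF I(2) _ _ I(3) _ t])
    show "continuous_on I (\<lambda>t. fst (pq (Z t)))" by (intro continuous_on_fst continuous_Z)
    show "fst (pq (Z t)) \<noteq> 0" if "t \<in> I" for t
    proof
      assume "fst (pq (Z t)) = 0"
      then have "ip \<epsilon> (pq (Z t)) (pq (Z t)) \<ge> 0" by (simp add: ip_def)
      then show False using Z_frame(1)[OF that] \<open>\<epsilon> = -1\<close> by simp
    qed
    have "fst (f p0) > 0" using frame_at(7)[OF p0] that by (simp add: QR_iff)
    then show "fst (pq (Z (hm p0))) > 0"
      using frame_at(1)[OF p0] by (simp add: I(5) e_last_def)
  qed
  moreover have "fst (\<alpha> t) = fst (pq (Z t))" by (simp add: \<alpha>_def e_last_def)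
  ultimately show ?thesis by (simp add: QR_iff alpha_e(2)[OF t] Z_frame(1)[OF t])
qed

lemma alpha_half_space:
  assumes t: "t \<in> I"
  shows "\<exists>p\<in>P0. \<exists>c>0. \<alpha> t = p + c *\<^sub>R q0"
proof -
  \<comment> \<open>\<open>q0\<close> is the transversal direction; subtracting this multiple of it
    cancels the product with \<open>W0\<close>.\<close>
  let ?c = "- ip \<epsilon> (pq (Z t)) W0"
  have "\<alpha> t - ?c *\<^sub>R q0 \<in> V"
    using alpha_P1[OF t] P_sub(2) V_members(2) subspaces(1) by (intro subspace_diff subspace_scale) auto
  then have "\<alpha> t - ?c *\<^sub>R q0 \<in> P0"
    using Z_X0(1)[OF t] base_frame by (simp add: P0_def ip_simps \<alpha>_def)
  then show ?thesis using W0_negative[OF t] by (intro bexI[of _ "\<alpha> t - ?c *\<^sub>R q0"] exI[of _ ?c]) auto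
qed

lemma alpha_deriv: assumes t: "t \<in> I" shows "(\<alpha> has_vector_derivative pS (Z t)) (at t)"
proof -
  have "((\<lambda>t. pq (Z t)) has_vector_derivative pq (profile_field \<epsilon> (Z t))) (at t)"
    by (rule bounded_linear.has_vector_derivative[OF bounded_linear_state(1)])
      (use I(4) t in \<open>simp add: profile_solution_def\<close>)
  moreover have "((\<lambda>t. t *\<^sub>R e) has_vector_derivative e) (at t)"
    unfolding has_vector_derivative_def by (rule has_derivative_scaleR_left[OF has_derivative_ident])
  ultimately have "(\<alpha> has_vector_derivative pq (profile_field \<epsilon> (Z t)) + e) (at t)"
    unfolding \<alpha>_def[abs_def] by (rule has_vector_derivative_add)
  then show ?thesis by (simp add: profile_field_def)
qed

lemma alpha_smooth: "smooth_on I \<alpha>"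
  unfolding \<alpha>_def[abs_def] smooth_on_def
proof
  fix k
  have "Ck_on k I (\<lambda>t. t)"
  proof (cases k)
    case (Suc j)
    show ?thesis unfolding Suc
      by (rule Ck_on_SucI[OF I(1), where f' = "\<lambda>_ v. v"]) (auto intro: Ck_on_const[OF I(1)])
  qed (simp add: continuous_on_id)
  then have "Ck_on k I (\<lambda>t. t *\<^sub>R e)"
    by (rule Ck_on_bounded_linear[OF I(1) bounded_linear_scaleR_left])
  moreover have "Ck_on k I (\<lambda>t. pq (Z t))"
    using profile_solution_smooth[OF I(1,4)] Ck_on_bounded_linear[OF I(1) bounded_linear_state(1)]
    by (auto simp: smooth_on_def)
  ultimately show "Ck_on k I (\<lambda>t. pq (Z t) + t *\<^sub>R e)" by (intro Ck_on_add[OF I(1)])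
qed

text \<open>The displacement \<open>L v - v\<close> is orthogonal to the fixed set
  \<open>K0\<close>, hence lies in the plane of \<open>X0\<close> and \<open>W0\<close>, which
  \<open>V\<close> contains.\<close>

lemma isometry_V:
  assumes L: "L \<in> isometries_fixing \<epsilon> K0"
  shows "L ` V = V"
proof -
  have sub: "L v \<in> V" if L: "L \<in> isometries_fixing \<epsilon> K0" and v: "v \<in> V" for L v
  proof -
    have "ip \<epsilon> y (L v - v) = 0" if "y \<in> K0" for y
      using isometries_fixingD(2)[OF L, of y v] isometries_fixingD(3)[OF L that] by (simp add: ip_simps)
    from W_decomposition[OF this] have "L v - v \<in> V"
      using V_members subspaces(1) by (metis subspace_diff subspace_scale)
    then have "(L v - v) + v \<in> V" using v subspaces(1) by (intro subspace_add)
    then show ?thesis by simp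
  qed
  obtain L' where L': "L' \<in> isometries_fixing \<epsilon> K0" "\<And>x. L (L' x) = x"
    using isometries_fixing_inverse[OF eps L] by metis
  show ?thesis
  proof
    show "V \<subseteq> L ` V" using sub[OF L'(1)] L'(2) by (metis image_eqI subsetI)
  qed (use sub[OF L] in blast)
qed

lemma isometry_rotations: "L \<in> isometries_fixing \<epsilon> K0 \<Longrightarrow> L \<in> rotations \<epsilon> V P0"
  using isometry_V P_sub(3) unfolding rotations_def by (auto simp: isometries_fixingD)

lemma f_orbit: assumes p: "p \<in> topspace X" shows "\<exists>L\<in>isometries_fixing \<epsilon> K0. hm p \<in> I \<and> f p = L (\<alpha> (hm p))"
proof -
  obtain L where L: "L \<in> isometries_fixing \<epsilon> K0" "Ym p = map_state L (Z (hm p))" and h: "hm p \<in> I"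
    using cover[OF p] K0 by auto
  have "f p = L (\<alpha> (hm p))"
    using frame_at(1)[OF p] isometries_fixingD(1)[OF L(1)] isometries_fixingD(3)[OF L(1) e_K0]
    by (simp add: L(2) map_state_def \<alpha>_def linear_add linear_scale)
  then show ?thesis using L h by blast
qed

text \<open>\<open>rotations\<close> fixes only \<open>P0\<close>, the part of \<open>K0\<close> in
  \<open>V\<close>, while the local description of the image involves all of \<open>K0\<close>.
  Removing the plane component of \<open>z\<close> leaves a vector orthogonal to all of
  \<open>V\<close>, in particular to \<open>q0\<close> and itself; positivity on the complement of
  \<open>q0\<close> makes it zero.\<close>

lemma V_nondegenerate:
  assumes z: "z \<in> V" "\<And>y. y \<in> P0 \<Longrightarrow> ip \<epsilon> y z = 0" and y: "y \<in> K0"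
  shows "ip \<epsilon> y z = 0"
proof -
  define z' where "z' = z - ip \<epsilon> z X0 *\<^sub>R X0 + ip \<epsilon> z q0 *\<^sub>R W0"
  have z'V: "z' \<in> V"
    unfolding z'_def using z(1) V_members subspaces(1) by (intro subspace_add subspace_diff subspace_scale)
  have orth: "ip \<epsilon> v z' = 0" if v: "v \<in> V" for v
  proof -
    have "v - ip \<epsilon> v X0 *\<^sub>R X0 + ip \<epsilon> v W0 *\<^sub>R q0 \<in> P0"
      using v V_members subspaces(1)
      by (auto simp: P0_def ip_simps base_frame X0(1) intro!: subspace_add subspace_diff subspace_scale)
    from z(2)[OF this] show ?thesis
      by (simp add: z'_def ip_simps ip_commute[of \<epsilon> X0 z] ip_commute[of \<epsilon> q0 z] algebra_simps)
  qed
  have "ip \<epsilon> z' (Q_part q0) = 0" using orth[OF V_members(2)] by (simp add: Q_part_q0 ip_commute)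
  then have "z' = 0"
    using tangent_QR_positive[OF eps _ \<open>ip \<epsilon> z' (Q_part q0) = 0\<close>] orth[OF z'V] base_frame(1) Q_part_q0 by fastforce
  then have "z = ip \<epsilon> z X0 *\<^sub>R X0 - ip \<epsilon> z q0 *\<^sub>R W0" by (simp add: z'_def algebra_simps)
  moreover have "ip \<epsilon> y (ip \<epsilon> z X0 *\<^sub>R X0 - ip \<epsilon> z q0 *\<^sub>R W0) = 0"
    using y by (simp add: K0_def ip_simps)
  ultimately show ?thesis by metis
qed

text \<open>An orbit point near \<open>f p\<close> is compared with the point of the local curve at
  the same height. Both arise from \<open>\<alpha> t\<close> by maps fixing \<open>P0\<close>, so
  their difference is orthogonal to \<open>P0\<close>, hence to \<open>K0\<close>, and
  \<open>local_profile\<close> puts the orbit point into the image. Reflections in the rotation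
  group are covered as well.\<close>

lemma orbit_open:
  "openin (top_of_set (\<Union>L\<in>rotations \<epsilon> V P0. L ` \<alpha> ` I)) (f ` topspace X)"
proof -
  let ?O = "\<Union>L\<in>rotations \<epsilon> V P0. L ` \<alpha> ` I"
  have sub: "f ` topspace X \<subseteq> ?O" using f_orbit isometry_rotations by fastforce
  have "\<exists>M. open M \<and> f p \<in> M \<and> M \<inter> ?O \<subseteq> f ` topspace X" if p: "p \<in> topspace X" for p
  proof -
    have Kp: "Km p = K0" using Km_constant[OF p0 p] K0 by simp
    from p obtain N J Z1 M where N: "openin X N" and Zp: "\<And>t. t \<in> J \<Longrightarrow> \<exists>p\<in>N. hm p = t \<and> Ym p = Z1 t"
      and M: "open M" "f p \<in> M" "\<And>z. z \<in> M \<Longrightarrow> snd (snd z) \<in> J"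
      "\<And>z. z \<in> M \<Longrightarrow> (\<And>y. y \<in> Km p \<Longrightarrow> ip \<epsilon> y (z - (pq (Z1 (snd (snd z))) + snd (snd z) *\<^sub>R e_last)) = 0) \<Longrightarrow>
        ip \<epsilon> (Q_part z) (Q_part z) = \<epsilon> \<Longrightarrow> z \<in> f ` topspace X"
      by (rule local_profile) blast
    have "z \<in> f ` topspace X" if zM: "z \<in> M" and zO: "z \<in> ?O" for z
    proof -
      obtain L t where L: "L \<in> rotations \<epsilon> V P0" and t: "t \<in> I" and z: "z = L (\<alpha> t)" using zO by blast
      have lin: "linear L" and LV: "L ` V = V" and iso: "\<And>x y. x \<in> V \<Longrightarrow> y \<in> V \<Longrightarrow> ip \<epsilon> (L x) (L y) = ip \<epsilon> x y"
        and fx: "\<And>y. y \<in> P0 \<Longrightarrow> L y = y"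
        using L unfolding rotations_def by blast+
      have aV: "\<alpha> t \<in> V" using alpha_P1[OF t] P_sub by blast
      have Le: "L e = e" by (rule fx[OF P_members(1)])
      have zt: "ip \<epsilon> z e = t" using iso[OF aV V_members(1)] alpha_e(1)[OF t] by (simp add: z Le)
      then have zt': "snd (snd z) = t" by (simp add: ip_e_last)
      have Qz: "Q_part z = L (pq (Z t))"
        by (simp add: Q_part_eq[of z \<epsilon>] zt) (simp add: z \<alpha>_def linear_add[OF lin] linear_scale[OF lin] Le)
      have nz: "ip \<epsilon> (Q_part z) (Q_part z) = \<epsilon>"
        unfolding Qz using iso[OF Z_V[OF t] Z_V[OF t]] Z_frame(1)[OF t] by simp
      have tJ: "t \<in> J" using M(3)[OF zM] zt' by simp
      obtain p' where p': "p' \<in> N" "hm p' = t" "Ym p' = Z1 t" using Zp[OF tJ] by blast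
      then have p'X: "p' \<in> topspace X" using openin_subset[OF N] by blast
      obtain L' where L': "L' \<in> isometries_fixing \<epsilon> K0" "f p' = L' (\<alpha> t)" using f_orbit[OF p'X] p'(2) by blast
      have c: "pq (Z1 (snd (snd z))) + snd (snd z) *\<^sub>R e = L' (\<alpha> t)"
        using frame_at(1)[OF p'X] L'(2) p' zt' by simp
      have "ip \<epsilon> y (z - L' (\<alpha> t)) = 0" if "y \<in> Km p" for y
      proof (rule V_nondegenerate)
        show "y \<in> K0" using that Kp by simp
        have "L' (\<alpha> t) \<in> V" "z \<in> V" using isometry_V[OF L'(1)] aV LV z by blast+
        then show "z - L' (\<alpha> t) \<in> V" using subspaces(1) by (intro subspace_diff)
        fix y assume y: "y \<in> P0"
        have yV: "y \<in> V" and yK: "y \<in> K0" using y P_sub by auto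
        have "ip \<epsilon> y z = ip \<epsilon> y (\<alpha> t)" using iso[OF yV aV] fx[OF y] by (simp add: z)
        moreover have "ip \<epsilon> y (L' (\<alpha> t)) = ip \<epsilon> y (\<alpha> t)"
          using isometries_fixingD(2)[OF L'(1), of y "\<alpha> t"] isometries_fixingD(3)[OF L'(1) yK] by simp
        ultimately show "ip \<epsilon> y (z - L' (\<alpha> t)) = 0" by (simp add: ip_simps)
      qed
      then show ?thesis using M(4)[OF zM _ nz] unfolding c by blast
    qed
    then show ?thesis using M(1,2) by blast
  qed
  then show ?thesis using sub by (intro openin_top_of_set_local) (auto simp only: image_iff)
qed

lemma q0_QR: "q0 \<in> QR \<epsilon>"
proof -
  have "fst (f p0) = fst q0" using frame_at(1)[OF p0] by (simp add: q0_def e_last_def)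
  then show ?thesis using frame_at(7)[OF p0] base_frame(1) by (simp add: QR_iff Q_part_q0)
qed

text \<open>The dimensions are those of \<open>P0\<close> and one less. An involution taking
  \<open>q0\<close> to \<open>e_first\<close> brings the configuration into standard position and
  also serves as the ambient isometry moving it back.\<close>

lemma rotational:
  "\<exists>m s N N' C. m \<le> 4 \<and> s \<le> 3 \<and>
     totally_geodesic_product \<epsilon> m N \<and> totally_geodesic_product \<epsilon> s N' \<and> N' \<subseteq> N \<and> C \<subseteq> N' \<and>
     rotational_surface \<epsilon> m N C (f ` topspace X)"
proof -
  obtain \<Phi> where lin: "linear \<Phi>" and inv: "\<And>x. \<Phi> (\<Phi> x) = x" and iso: "\<And>x y. ip \<epsilon> (\<Phi> x) (\<Phi> y) = ip \<epsilon> x y"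
    and \<Phi>e: "\<Phi> e_last = e_last" and \<Phi>q: "\<Phi> q0 = e_first" and \<Phi>QR: "\<Phi> ` QR \<epsilon> = QR \<epsilon>"
    using ambient_isometry_to_e_first[OF eps q0_QR base_frame(2)] by blast
  have inj: "inj \<Phi>" by (rule inj_on_inverseI[of _ \<Phi>]) (rule inv)
  have im: "\<Phi> ` (\<Phi> ` S) = S" for S by (simp add: image_image inv)
  have mem: "\<Phi> x \<in> \<Phi> ` S \<longleftrightarrow> x \<in> S" for x S using inj by (simp add: inj_image_mem_iff)
  have dimI: "dim (\<Phi> ` S) = dim S" for S by (rule dim_image_eq[OF lin inj_on_subset[OF inj subset_UNIV]])
  have amb: "ambient_isometry \<epsilon> \<Phi>"
    unfolding ambient_isometry_def
  proof (intro conjI allI)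
    show "bij \<Phi>" by (rule involuntory_imp_bij) (rule inv)
    show "ip \<epsilon> (\<Phi> x - \<Phi> y) (\<Phi> x - \<Phi> y) = ip \<epsilon> (x - y) (x - y)" for x y
      using iso[of "x - y" "x - y"] by (simp add: linear_diff[OF lin])
  qed (rule \<Phi>QR)
  have flatV: "flat_subspace (dim P0) (\<Phi> ` V)"
    unfolding flat_subspace_def
    using linear_subspace_image[OF lin subspaces(1)] dims(1) dimI mem[of q0 V] mem[of e V] V_members \<Phi>e \<Phi>q by simp
  have flatP: "flat_subspace (dim P0 - 1) (\<Phi> ` P1)"
    unfolding flat_subspace_def
    using linear_subspace_image[OF lin subspaces(2)] dims(2,3) dimI mem[of q0 P1] mem[of e P1] P_members \<Phi>e \<Phi>q by simp
  define N where "N = \<Phi> ` (\<Phi> ` V \<inter> QR \<epsilon>)"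
  define N' where "N' = \<Phi> ` (\<Phi> ` P1 \<inter> QR \<epsilon>)"
  have "N' \<subseteq> N" using P_sub(2) by (auto simp: N_def N'_def)
  moreover have "\<alpha> ` I \<subseteq> N'"
  proof
    fix y assume "y \<in> \<alpha> ` I"
    then obtain t where t: "t \<in> I" "y = \<alpha> t" by blast
    have "\<Phi> y \<in> \<Phi> ` P1 \<inter> QR \<epsilon>" using alpha_P1[OF t(1)] alpha_QR[OF t(1)] \<Phi>QR t(2) by blast
    then show "y \<in> N'" unfolding N'_def using inv by (metis image_eqI)
  qed
  moreover have "totally_geodesic_product \<epsilon> (dim P0) N" "totally_geodesic_product \<epsilon> (dim P0 - 1) N'"
    unfolding totally_geodesic_product_def N_def N'_def using amb flatV flatP by blast+
  moreover have "rotational_surface \<epsilon> (dim P0) N (\<alpha> ` I) (f ` topspace X)"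
    unfolding rotational_surface_def
  proof (intro exI conjI)
    show "ambient_isometry \<epsilon> \<Phi>" by (rule amb)
    show "flat_subspace (dim P0) (\<Phi> ` V)" by (rule flatV)
    show "N = \<Phi> ` (\<Phi> ` V \<inter> QR \<epsilon>)" by (rule N_def)
    show "subspace (\<Phi> ` P1)" "subspace (\<Phi> ` P0)" using linear_subspace_image[OF lin] subspaces by blast+
    show "\<Phi> ` P1 \<subseteq> \<Phi> ` V" "\<Phi> ` P0 \<subseteq> \<Phi> ` P1" using P_sub by blast+
    show "dim (\<Phi> ` P1) = dim P0 + 1" "dim (\<Phi> ` P0) = dim P0" by (simp_all add: dimI dims)
    show "e_first \<in> \<Phi> ` P1" "e_last \<in> \<Phi> ` P1" using flatP by (simp_all add: flat_subspace_def)
    show "e_last \<in> \<Phi> ` P0" using mem[of e P0] P_members \<Phi>e by simp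
    show "e_first \<in> \<Phi> ` P1 - \<Phi> ` P0" using mem[of q0 P1] mem[of q0 P0] P_members \<Phi>q by simp
    have bl: "bounded_linear \<Phi>" using lin by (simp add: linear_conv_bounded_linear)
    show "regular_curve I (\<lambda>t. \<Phi> (\<alpha> t))"
      unfolding regular_curve_def
    proof (intro conjI ballI)
      show "open I" "is_interval I" "I \<noteq> {}" using I by auto
      show "smooth_on I (\<lambda>t. \<Phi> (\<alpha> t))" by (rule smooth_on_bounded_linear[OF I(1) bl alpha_smooth])
      fix t assume t: "t \<in> I"
      have "vector_derivative (\<lambda>t. \<Phi> (\<alpha> t)) (at t) = \<Phi> (pS (Z t))"
        by (rule vector_derivative_at[OF bounded_linear.has_vector_derivative[OF bl alpha_deriv[OF t]]])
      moreover have "ip \<epsilon> (\<Phi> (pS (Z t))) e = 1" using iso[of "pS (Z t)" e] Z_frame(3)[OF t] \<Phi>e by simp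
      ultimately show "vector_derivative (\<lambda>t. \<Phi> (\<alpha> t)) (at t) \<noteq> 0" by (auto simp: ip_zero_left)
    qed
    show "(\<lambda>t. \<Phi> (\<alpha> t)) ` I \<subseteq> QR \<epsilon> \<inter> {p + c *\<^sub>R e_first |p c. p \<in> \<Phi> ` P0 \<and> c > 0}"
    proof
      fix y assume "y \<in> (\<lambda>t. \<Phi> (\<alpha> t)) ` I"
      then obtain t where t: "t \<in> I" "y = \<Phi> (\<alpha> t)" by blast
      obtain p c where pc: "p \<in> P0" "c > 0" "\<alpha> t = p + c *\<^sub>R q0" using alpha_half_space[OF t(1)] by blast
      have "y = \<Phi> p + c *\<^sub>R e_first"
        by (simp add: t(2) pc(3) linear_add[OF lin] linear_scale[OF lin] \<Phi>q)
      moreover have "y \<in> QR \<epsilon>" using alpha_QR[OF t(1)] \<Phi>QR t(2) by blast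
      ultimately show "y \<in> QR \<epsilon> \<inter> {p + c *\<^sub>R e_first |p c. p \<in> \<Phi> ` P0 \<and> c > 0}" using pc by blast
    qed
    show "\<alpha> ` I = \<Phi> ` (\<lambda>t. \<Phi> (\<alpha> t)) ` I" by (simp add: image_image inv)
    \<comment> \<open>The reflection is its own inverse, so conjugation with it exchanges the
      rotation groups of the two configurations.\<close>
    have conj: "\<Phi> \<circ> L \<circ> \<Phi> \<in> rotations \<epsilon> (\<Phi> ` S) (\<Phi> ` P)" if "L \<in> rotations \<epsilon> S P" for L S P
    proof -
      have L: "linear L" "L ` S = S" "\<forall>x\<in>S. \<forall>y\<in>S. ip \<epsilon> (L x) (L y) = ip \<epsilon> x y" "\<forall>p\<in>P. L p = p"
        using that unfolding rotations_def by blast+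
      have "(\<Phi> \<circ> L \<circ> \<Phi>) ` (\<Phi> ` S) = \<Phi> ` (L ` S)" by (simp add: image_image inv)
      then show ?thesis
        unfolding rotations_def using L lin by (simp add: linear_compose inv iso)
    qed
    have "(\<Union>L\<in>rotations \<epsilon> V P0. L ` \<alpha> ` I) = \<Phi> ` (\<Union>L\<in>rotations \<epsilon> (\<Phi> ` V) (\<Phi> ` P0). L ` (\<lambda>t. \<Phi> (\<alpha> t)) ` I)"
    proof
      show "(\<Union>L\<in>rotations \<epsilon> V P0. L ` \<alpha> ` I) \<subseteq> \<Phi> ` (\<Union>L\<in>rotations \<epsilon> (\<Phi> ` V) (\<Phi> ` P0). L ` (\<lambda>t. \<Phi> (\<alpha> t)) ` I)"
      proof
        fix y assume "y \<in> (\<Union>L\<in>rotations \<epsilon> V P0. L ` \<alpha> ` I)"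
        then obtain L t where L: "L \<in> rotations \<epsilon> V P0" "t \<in> I" "y = L (\<alpha> t)" by blast
        have "y = \<Phi> ((\<Phi> \<circ> L \<circ> \<Phi>) (\<Phi> (\<alpha> t)))" by (simp add: inv L(3))
        then show "y \<in> \<Phi> ` (\<Union>L\<in>rotations \<epsilon> (\<Phi> ` V) (\<Phi> ` P0). L ` (\<lambda>t. \<Phi> (\<alpha> t)) ` I)"
          using conj[OF L(1)] L(2) by blast
      qed
      show "\<Phi> ` (\<Union>L\<in>rotations \<epsilon> (\<Phi> ` V) (\<Phi> ` P0). L ` (\<lambda>t. \<Phi> (\<alpha> t)) ` I) \<subseteq> (\<Union>L\<in>rotations \<epsilon> V P0. L ` \<alpha> ` I)"
      proof
        fix y assume "y \<in> \<Phi> ` (\<Union>L\<in>rotations \<epsilon> (\<Phi> ` V) (\<Phi> ` P0). L ` (\<lambda>t. \<Phi> (\<alpha> t)) ` I)"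
        then obtain L t where L: "L \<in> rotations \<epsilon> (\<Phi> ` V) (\<Phi> ` P0)" "t \<in> I" "y = \<Phi> (L (\<Phi> (\<alpha> t)))" by blast
        have "\<Phi> \<circ> L \<circ> \<Phi> \<in> rotations \<epsilon> V P0" using conj[OF L(1)] by (simp add: im)
        moreover have "y = (\<Phi> \<circ> L \<circ> \<Phi>) (\<alpha> t)" using L(3) by simp
        ultimately show "y \<in> (\<Union>L\<in>rotations \<epsilon> V P0. L ` \<alpha> ` I)" using L(2) by blast
      qed
    qed
    then show "openin (top_of_set (\<Phi> ` (\<Union>L\<in>rotations \<epsilon> (\<Phi> ` V) (\<Phi> ` P0). L ` (\<lambda>t. \<Phi> (\<alpha> t)) ` I))) (f ` topspace X)"
      using orbit_open by simp
  qed
  ultimately show ?thesis using dims(3,4)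
    by (intro exI[of _ "dim P0"] exI[of _ "dim P0 - 1"] exI[of _ N] exI[of _ N'] exI[of _ "\<alpha> ` I"]) auto
qed

end

theorem corollary8:
  fixes \<epsilon> :: real
    and X :: "'m topology"
    and A :: "'m atlas"
    and f :: "'m \<Rightarrow> real \<times> (real ^ 'n::finite) \<times> real"
  assumes "\<epsilon> \<in> {-1, 1}"
    and "smooth_surface X A"
    and "connected_space X" and "topspace X \<noteq> {}"
    and "immersion_QR \<epsilon> X A f"
    and "class_A \<epsilon> A f"
    and "parallel_mean_curv \<epsilon> A f"
  shows "\<exists>m s N N' C. m \<le> 4 \<and> s \<le> 3 \<and>
           totally_geodesic_product \<epsilon> m N \<and>
           totally_geodesic_product \<epsilon> s N' \<and> N' \<subseteq> N \<and> C \<subseteq> N' \<and>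
           rotational_surface \<epsilon> m N C (f ` topspace X)"
proof -
  interpret pmc_surface \<epsilon> X A f by unfold_locales (fact assms)+
  obtain p0 where p0: "p0 \<in> topspace X" using assms(4) by blast
  show ?thesis
  proof (rule global_profile[OF p0])
    fix I Z
    assume IZ: "profile p0 I Z"
      "\<And>p. p \<in> topspace X \<Longrightarrow> hm p \<in> I \<and> (\<exists>L\<in>isometries_fixing \<epsilon> (Km p0). Ym p = map_state L (Z (hm p)))"
    from frame_at(8)[OF p0] obtain X0 where X0: "ip \<epsilon> X0 X0 = 1"
      "ip \<epsilon> (pq (Ym p0)) X0 = 0" "ip \<epsilon> (pS (Ym p0)) X0 = 0"
      "ip \<epsilon> (pW (Ym p0)) X0 = 0" "ip \<epsilon> (pH (Ym p0)) X0 = 0"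
      "Km p0 = {y. ip \<epsilon> y X0 = 0 \<and> ip \<epsilon> y (pW (Ym p0)) = 0}"
      by (elim exE conjE)
    interpret pmc_profile \<epsilon> X A f p0 I Z X0 by unfold_locales (fact p0 IZ X0)+
    show ?thesis by (rule rotational)
  qed
qed

end
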